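(* Fix a difference equation $\hat{\boldsymbol\omega}=(1/\hat f,\hat q,\hat w)\in\Omega_N^{\mathbb{R},+}$. Then $(\hat{\boldsymbol\omega},\mathbf{C})$ has exactly $N-2$ eigenvalues; for each $\mathbf{A}\in\mathcal{B}_{1,3}\setminus\{\mathbf{C}\}$, $(\hat{\boldsymbol\omega},\mathbf{A})$ has exactly $N-1$ eigenvalues; and for each $\mathbf{A}\in\mathcal{O}_{1,3}^{\mathbb{C}}\setminus\mathcal{B}_{1,3}$, $(\hat{\boldsymbol\omega},\mathbf{A})$ has exactly $N$ eigenvalues $\lambda_n(\mathbf{A}):=\lambda_n(\hat{\boldsymbol\omega},\mathbf{A})$, $0\le n\le N-1$, which satisfy that: (i) the $\lambda_n(\mathbf{A})$ are continuous in $\mathcal{O}_{1,3}^{\mathbb{C}}\setminus\mathcal{B}_{1,3}$; (ii) the $\lambda_n(\mathbf{A})$ restricted in $\mathcal{B}_{1,3}^-$, $\mathcal{B}_{1,3r}^+$ and $\mathcal{B}_{1,3l}^+$ are non-decreasing in the $a_{12}$-direction and in the $b_{22}$-direction; (iii) the $\lambda_n(\mathbf{A})$, $0\le n\le N-1$, are not continuous at each point of $\mathcal{B}_{1,3}$ and furthermore: (iiia) they have the following asymptotic behaviors near any given $\mathbf{A}_0\in\mathcal{B}_{1,3r}$: $$\lim_{\mathcal{B}_{1,3}^-\cup\mathcal{B}_{1,3r}\ni\mathbf{A}\to\mathbf{A}_0}\lambda_n(\mathbf{A})=\lambda_n(\mathbf{A}_0),\ 0\le n\le N-2,\quad \lim_{\mathcal{B}_{1,3}^-\ni\mathbf{A}\to\mathbf{A}_0}\lambda_{N-1}(\mathbf{A})=+\infty,$$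 $$\lim_{\mathcal{B}_{1,3r}^+\ni\mathbf{A}\to\mathbf{A}_0}\lambda_0(\mathbf{A})=-\infty,\quad \lim_{\mathcal{B}_{1,3r}^+\ni\mathbf{A}\to\mathbf{A}_0}\lambda_n(\mathbf{A})=\lambda_{n-1}(\mathbf{A}_0),\ 1\le n\le N-1;$$ (iiib) they have the following asymptotic behaviors near any given $\mathbf{A}_0\in\mathcal{B}_{1,3l}$: $$\lim_{\mathcal{B}_{1,3}^-\ni\mathbf{A}\to\mathbf{A}_0}\lambda_0(\mathbf{A})=-\infty,\quad \lim_{\mathcal{B}_{1,3}^-\ni\mathbf{A}\to\mathbf{A}_0}\lambda_n(\mathbf{A})=\lambda_{n-1}(\mathbf{A}_0),\ 1\le n\le N-1,$$ $$\lim_{\mathcal{B}_{1,3l}^+\cup\mathcal{B}_{1,3l}\ni\mathbf{A}\to\mathbf{A}_0}\lambda_n(\mathbf{A})=\lambda_n(\mathbf{A}_0),\ 0\le n\le N-2,\quad \lim_{\mathcal{B}_{1,3l}^+\ni\mathbf{A}\to\mathbf{A}_0}\lambda_{N-1}(\mathbf{A})=+\infty;$$ (iiic) they have the following asymptotic behaviors near $\mathbf{C}$: $$\lim_{\mathcal{B}_{1,3r}^+\cup\mathcal{B}_{1,3r}\cup\mathcal{B}_{1,3}^-\ni\mathbf{A}\to\mathbf{C}}\lambda_0(\mathbf{A})=-\infty,\quad \lim_{\mathcal{B}_{1,3r}^+\ni\mathbf{A}\to\mathbf{C}}\lambda_1(\mathbf{A})=-\infty,$$ $$\lim_{\mathcal{B}_{1,3l}^+\cup\mathcal{B}_{1,3l}\ni\mathbf{A}\to\mathbf{C}}\lambda_n(\mathbf{A})=\lambda_n(\mathbf{C}),\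 0\le n\le N-3,$$ $$\lim_{\mathcal{B}_{1,3r}\cup\mathcal{B}_{1,3}^-\ni\mathbf{A}\to\mathbf{C}}\lambda_n(\mathbf{A})=\lambda_{n-1}(\mathbf{C}),\ 1\le n\le N-2,$$ $$\lim_{\mathcal{B}_{1,3r}^+\ni\mathbf{A}\to\mathbf{C}}\lambda_n(\mathbf{A})=\lambda_{n-2}(\mathbf{C}),\ 2\le n\le N-1,$$ $$\lim_{\mathcal{B}_{1,3l}^+\cup\mathcal{B}_{1,3l}\ni\mathbf{A}\to\mathbf{C}}\lambda_{N-2}(\mathbf{A})=+\infty,\quad \lim_{\mathcal{B}_{1,3l}^+\cup\mathcal{B}_{1,3}^-\ni\mathbf{A}\to\mathbf{C}}\lambda_{N-1}(\mathbf{A})=+\infty.$$ Consequently, $\lambda_n(\mathbf{A})$ restricted in $\mathcal{B}_{1,3}^-\cup\mathcal{B}_{1,3r}$ and in $\mathcal{B}_{1,3l}^+\cup\mathcal{B}_{1,3l}\cup\{\mathbf{C}\}$ is continuous for each $0\le n\le N-3$, and $\lambda_{N-2}(\mathbf{A})$ restricted in $\mathcal{B}_{1,3}^-\cup\mathcal{B}_{1,3r}$ and in $\mathcal{B}_{1,3l}^+\cup\mathcal{B}_{1,3l}$ is continuous.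
   Context: Fix an integer $N\ge 2$. A self-adjoint discrete Sturm–Liouville problem is a pair $(\boldsymbol\omega,\mathbf{A})$. Here $\boldsymbol\omega=(1/f,q,w)$ with real sequences $f=\{f_n\}_{n=0}^N$, $q=\{q_n\}_{n=1}^N$, $w=\{w_n\}_{n=1}^N$, $f_n\ne0$, $w_n>0$, encodes the equation $-\nabla(f_n\Delta y_n)+q_ny_n=\lambda w_ny_n$, $1\le n\le N$, for $y=(y_0,\dots,y_{N+1})$, with $\Delta y_n=y_{n+1}-y_n$, $\nabla y_n=y_n-y_{n-1}$; $\Omega_N^{\mathbb{R},+}\subset\mathbb{R}^{3N+1}$ is the set of all such $(1/f,q,w)$. $\mathbf{A}=[A\,|\,B]$ encodes the boundary condition $A\begin{pmatrix}y_0\\ f_0\Delta y_0\end{pmatrix}+B\begin{pmatrix}y_N\\ f_N\Delta y_N\end{pmatrix}=0$, where $A,B$ are complex $2\times2$ matrices with $\mathrm{rank}(A,B)=2$ and $AJA^*=BJB^*$, $J=\begin{pmatrix}0&1\\-1&0\end{pmatrix}$; $[A\,|\,B]$ is the class of the $2\times4$ matrix $(A,B)$ modulo left multiplication by $GL(2,\mathbb{C})$, and $\mathcal{B}^{\mathbb{C}}$ is the set of all such classes, topologized as a subspace of the quotient of the rank-2 complex $2\times4$ matrices by $GL(2,\mathbb{C})$. An eigenvalue of $(\boldsymbol\omega,\mathbf{A})$ is a $\lambda$ for which a nonzero $y$ solves the equation and the boundary condition. Eigenvalues are real and finite in number; they are counted with multiplicity (the dimension of the solution space) and listed as $\lambda_0\le\lambda_1\le\cdots$;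 $\lambda_n$ is defined at a problem only if it has more than $n$ eigenvalues, and $\lambda_n$ is regarded as not continuous at a point where it is not defined. Assertions over empty ranges of $n$ are vacuous. $\mathcal{O}_{1,3}^{\mathbb{C}}=\left\{\left[\begin{array}{cccc}1&a_{12}&0&\bar z\\0&z&-1&b_{22}\end{array}\right]:a_{12},b_{22}\in\mathbb{R},\ z\in\mathbb{C}\right\}$, an open subset of $\mathcal{B}^{\mathbb{C}}$ with coordinates $(a_{12},\mathrm{Re}\,z,\mathrm{Im}\,z,b_{22})$ identifying it with $\mathbb{R}^4$. For the fixed $\hat{\boldsymbol\omega}$ put $\mathbf{C}=\left[\begin{array}{cccc}1&1/\hat f_0&0&0\\0&0&1&0\end{array}\right]$ and, for $\mathbf{A}\in\mathcal{O}_{1,3}^{\mathbb{C}}$, $d(\mathbf{A})=(a_{12}-1/\hat f_0)b_{22}-|z|^2$. Then $\mathcal{B}_{1,3}=\{\mathbf{A}\in\mathcal{O}_{1,3}^{\mathbb{C}}:d(\mathbf{A})=0\}$; $\mathcal{B}_{1,3}^-=\{d(\mathbf{A})<0\}$; $\mathcal{B}_{1,3r}=\{\mathbf{A}\in\mathcal{B}_{1,3}:a_{12}\ge1/\hat f_0,\ b_{22}\ge0\}\setminus\{\mathbf{C}\}$; $\mathcal{B}_{1,3l}=\{\mathbf{A}\in\mathcal{B}_{1,3}:a_{12}\le1/\hat f_0,\ b_{22}\le0\}\setminus\{\mathbf{C}\}$; $\mathcal{B}_{1,3r}^+=\{d(\mathbf{A})>0,\ a_{12}\ge1/\hat f_0,\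 b_{22}\ge0\}$; $\mathcal{B}_{1,3l}^+=\{d(\mathbf{A})>0,\ a_{12}\le1/\hat f_0,\ b_{22}\le0\}$. Monotone in a coordinate direction means with the other coordinates fixed.
   Formalization: In (iii), discontinuity of each λ_n at each point of B_{1,3} is asserted except at points A ≠ C with 0<n<N−1 and λ_n(A)=λ_{n−1}(A) (a double eigenvalue), where the jump is zero and λ_n is in fact continuous, so the unrestricted claim fails. *)

theory Defs
  imports "HOL-Analysis.Analysis" "HOL-Library.Function_Algebras"
begin

section \<open>Discrete Sturm-Liouville equations\<close>

text \<open>
  An equation is the triple \<open>\<omega> = (1/f, q, w)\<close>, so the first component is the reciprocal of
  the leading coefficient \<open>f\<close>.  Only the entries \<open>f\<^sub>0, \<dots>, f\<^sub>N\<close>, \<open>q\<^sub>1, \<dots>, q\<^sub>N\<close>, \<open>w\<^sub>1, \<dots>, w\<^sub>N\<close> of the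
  three sequences are ever used.
\<close>

type_synonym sl_equation = "(nat \<Rightarrow> real) \<times> (nat \<Rightarrow> real) \<times> (nat \<Rightarrow> real)"

definition Omega :: "nat \<Rightarrow> sl_equation set" where
  "Omega N = {(g, q, w). (\<forall>n\<le>N. g n \<noteq> 0) \<and> (\<forall>n\<in>{1..N}. w n > 0)}"

definition coeff_f :: "sl_equation \<Rightarrow> nat \<Rightarrow> real" where
  "coeff_f \<omega> n = 1 / fst \<omega> n"

definition coeff_q :: "sl_equation \<Rightarrow> nat \<Rightarrow> real" where
  "coeff_q \<omega> n = fst (snd \<omega>) n"

definition coeff_w :: "sl_equation \<Rightarrow> nat \<Rightarrow> real" where
  "coeff_w \<omega> n = snd (snd \<omega>) n"

definition fdiff :: "(nat \<Rightarrow> complex) \<Rightarrow> nat \<Rightarrow> complex" where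
  "fdiff y n = y (n + 1) - y n"

definition bdiff :: "(nat \<Rightarrow> complex) \<Rightarrow> nat \<Rightarrow> complex" where
  "bdiff y n = y n - y (n - 1)"

definition solves_equation :: "nat \<Rightarrow> sl_equation \<Rightarrow> complex \<Rightarrow> (nat \<Rightarrow> complex) \<Rightarrow> bool" where
  "solves_equation N \<omega> \<mu> y \<longleftrightarrow>
     (\<forall>n\<in>{1..N}. - bdiff (\<lambda>k. of_real (coeff_f \<omega> k) * fdiff y k) n + of_real (coeff_q \<omega> n) * y n
        = \<mu> * of_real (coeff_w \<omega> n) * y n)"


section \<open>Self-adjoint boundary conditions\<close>

definition left_block :: "complex^4^2 \<Rightarrow> complex^2^2" where
  "left_block M = vector [vector [M$1$1, M$1$2], vector [M$2$1, M$2$2]]"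

definition right_block :: "complex^4^2 \<Rightarrow> complex^2^2" where
  "right_block M = vector [vector [M$1$3, M$1$4], vector [M$2$3, M$2$4]]"

definition conj_transpose :: "complex^2^2 \<Rightarrow> complex^2^2" where
  "conj_transpose A = (\<chi> i j. cnj (A$j$i))"

definition J_mat :: "complex^2^2" where
  "J_mat = vector [vector [0, 1], vector [-1, 0]]"

definition full_rank :: "(complex^4^2) set" where
  "full_rank = {M. rank M = 2}"

definition bc_class :: "complex^4^2 \<Rightarrow> (complex^4^2) set" where
  "bc_class M = {T ** M | T :: complex^2^2. invertible T}"

definition rank2_quotient :: "(complex^4^2) set topology" where
  "rank2_quotient = topology (\<lambda>U. U \<subseteq> bc_class ` full_rank \<and>
     openin (top_of_set full_rank) {M \<in> full_rank. bc_class M \<in> U})"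

definition BC :: "(complex^4^2) set set" where
  "BC = {bc_class M | M. M \<in> full_rank \<and>
     left_block M ** J_mat ** conj_transpose (left_block M)
       = right_block M ** J_mat ** conj_transpose (right_block M)}"

definition BC_top :: "(complex^4^2) set topology" where
  "BC_top = subtopology rank2_quotient BC"

lemma openin_rank2_quotient:
  "openin rank2_quotient U \<longleftrightarrow> U \<subseteq> bc_class ` full_rank \<and>
     openin (top_of_set full_rank) {M \<in> full_rank. bc_class M \<in> U}"
proof -
  have "istopology (\<lambda>U. U \<subseteq> bc_class ` full_rank \<and>
     openin (top_of_set full_rank) {M \<in> full_rank. bc_class M \<in> U})"
    unfolding istopology_def
  proof (intro conjI allI impI)
    fix S T :: "(complex^4^2) set set"
    assume S: "S \<subseteq> bc_class ` full_rank \<and> openin (top_of_set full_rank) {M \<in> full_rank. bc_class M \<in> S}"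
      and T: "T \<subseteq> bc_class ` full_rank \<and> openin (top_of_set full_rank) {M \<in> full_rank. bc_class M \<in> T}"
    show "S \<inter> T \<subseteq> bc_class ` full_rank" using S by blast
    have eq: "{M \<in> full_rank. bc_class M \<in> S \<inter> T} =
        {M \<in> full_rank. bc_class M \<in> S} \<inter> {M \<in> full_rank. bc_class M \<in> T}" by blast
    show "openin (top_of_set full_rank) {M \<in> full_rank. bc_class M \<in> S \<inter> T}"
      unfolding eq using S T by (intro openin_Int) auto
  next
    fix K :: "(complex^4^2) set set set"
    assume K: "\<forall>U\<in>K. U \<subseteq> bc_class ` full_rank \<and> openin (top_of_set full_rank) {M \<in> full_rank. bc_class M \<in> U}"
    then show "\<Union> K \<subseteq> bc_class ` full_rank" by blast
    have "{M \<in> full_rank. bc_class M \<in> \<Union> K} = (\<Union>U\<in>K. {M \<in> full_rank. bc_class M \<in> U})" by blast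
    moreover have "openin (top_of_set full_rank) (\<Union>U\<in>K. {M \<in> full_rank. bc_class M \<in> U})"
      by (rule openin_Union) (use K in blast)
    ultimately show "openin (top_of_set full_rank) {M \<in> full_rank. bc_class M \<in> \<Union> K}"
      by simp
  qed
  then show ?thesis by (simp add: rank2_quotient_def)
qed

lemma topspace_rank2_quotient: "topspace rank2_quotient = bc_class ` full_rank"
proof (rule antisym)
  show "topspace rank2_quotient \<subseteq> bc_class ` full_rank"
    using openin_rank2_quotient[of "topspace rank2_quotient"] by auto
  have "{M \<in> full_rank. bc_class M \<in> bc_class ` full_rank} = full_rank" by blast
  then have "openin rank2_quotient (bc_class ` full_rank)"
    by (simp add: openin_rank2_quotient)
  then show "bc_class ` full_rank \<subseteq> topspace rank2_quotient"
    by (rule openin_subset)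
qed

lemma quotient_map_bc_class: "quotient_map (top_of_set full_rank) rank2_quotient bc_class"
  by (auto simp: quotient_map_def topspace_rank2_quotient openin_rank2_quotient)

lemma topspace_BC_top: "topspace BC_top = BC"
  by (auto simp: BC_top_def topspace_rank2_quotient BC_def)

text \<open>
  The condition is invariant under left multiplication by \<open>GL(2)\<close>, so all
  representatives of a class agree on it.
\<close>

definition satisfies_bc ::
    "nat \<Rightarrow> sl_equation \<Rightarrow> (complex^4^2) set \<Rightarrow> (nat \<Rightarrow> complex) \<Rightarrow> bool" where
  "satisfies_bc N \<omega> \<A> y \<longleftrightarrow> (\<forall>M\<in>\<A>.
     left_block M *v vector [y 0, of_real (coeff_f \<omega> 0) * fdiff y 0]
     + right_block M *v vector [y N, of_real (coeff_f \<omega> N) * fdiff y N] = 0)"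


section \<open>Eigenvalues\<close>

text \<open>
  A vector \<open>(y\<^sub>0, \<dots>, y\<^bsub>N+1\<^esub>)\<close> is represented by a sequence vanishing beyond \<open>N + 1\<close>, so that
  the dimension of the solution space is the one in \<open>\<complex>\<close>-vectors of length \<open>N + 2\<close>.
\<close>

definition sol_space ::
    "nat \<Rightarrow> sl_equation \<Rightarrow> (complex^4^2) set \<Rightarrow> complex \<Rightarrow> (nat \<Rightarrow> complex) set" where
  "sol_space N \<omega> \<A> \<mu> =
     {y. (\<forall>n>N+1. y n = 0) \<and> solves_equation N \<omega> \<mu> y \<and> satisfies_bc N \<omega> \<A> y}"

definition is_eigenvalue ::
    "nat \<Rightarrow> sl_equation \<Rightarrow> (complex^4^2) set \<Rightarrow> complex \<Rightarrow> bool" where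
  "is_eigenvalue N \<omega> \<A> \<mu> \<longleftrightarrow> (\<exists>y\<in>sol_space N \<omega> \<A> \<mu>. y \<noteq> 0)"

definition seq_scale :: "complex \<Rightarrow> (nat \<Rightarrow> complex) \<Rightarrow> nat \<Rightarrow> complex" where
  "seq_scale c y = (\<lambda>n. c * y n)"

interpretation seq: vector_space seq_scale
  by unfold_locales (auto simp: seq_scale_def fun_eq_iff algebra_simps)

definition multiplicity_eig ::
    "nat \<Rightarrow> sl_equation \<Rightarrow> (complex^4^2) set \<Rightarrow> complex \<Rightarrow> nat" where
  "multiplicity_eig N \<omega> \<A> \<mu> = seq.dim (sol_space N \<omega> \<A> \<mu>)"

text \<open>
  The existence of such a list expresses that the eigenvalues, which are a priori complex, are
  real and finite in number; the list is then unique.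
\<close>

definition eigenvalue_list ::
    "nat \<Rightarrow> sl_equation \<Rightarrow> (complex^4^2) set \<Rightarrow> real list \<Rightarrow> bool" where
  "eigenvalue_list N \<omega> \<A> xs \<longleftrightarrow> sorted xs \<and>
     {\<mu>. is_eigenvalue N \<omega> \<A> \<mu>} = of_real ` set xs \<and>
     (\<forall>x\<in>set xs. count (mset xs) x = multiplicity_eig N \<omega> \<A> (of_real x))"

definition has_exactly_eigenvalues ::
    "nat \<Rightarrow> sl_equation \<Rightarrow> (complex^4^2) set \<Rightarrow> nat \<Rightarrow> bool" where
  "has_exactly_eigenvalues N \<omega> \<A> k \<longleftrightarrow> (\<exists>xs. eigenvalue_list N \<omega> \<A> xs \<and> length xs = k)"

definition nth_defined :: "nat \<Rightarrow> sl_equation \<Rightarrow> nat \<Rightarrow> (complex^4^2) set \<Rightarrow> bool" where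
  "nth_defined N \<omega> n \<A> \<longleftrightarrow> (\<exists>xs. eigenvalue_list N \<omega> \<A> xs \<and> n < length xs)"

text \<open>Meaningful only where \<^const>\<open>nth_defined\<close> holds.\<close>

definition nth_eigenvalue :: "nat \<Rightarrow> sl_equation \<Rightarrow> nat \<Rightarrow> (complex^4^2) set \<Rightarrow> real" where
  "nth_eigenvalue N \<omega> n \<A> = (THE xs. eigenvalue_list N \<omega> \<A> xs) ! n"

text \<open>Continuity of \<open>\<lambda>\<^sub>n\<close>, for the fixed equation, as a partial function on \<^const>\<open>BC\<close>.\<close>

definition nth_continuous_at :: "nat \<Rightarrow> sl_equation \<Rightarrow> nat \<Rightarrow> (complex^4^2) set \<Rightarrow> bool" where
  "nth_continuous_at N \<omega> n \<A> \<longleftrightarrow> nth_defined N \<omega> n \<A> \<and>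
     topcontinuous_at (subtopology BC_top {\<B>. nth_defined N \<omega> n \<B>}) euclideanreal
       (nth_eigenvalue N \<omega> n) \<A>"

definition nth_continuous_on :: "nat \<Rightarrow> sl_equation \<Rightarrow> nat \<Rightarrow> (complex^4^2) set set \<Rightarrow> bool" where
  "nth_continuous_on N \<omega> n S \<longleftrightarrow> (\<forall>\<A>\<in>S. nth_defined N \<omega> n \<A>) \<and>
     continuous_map (subtopology BC_top S) euclideanreal (nth_eigenvalue N \<omega> n)"

definition near :: "(complex^4^2) set \<Rightarrow> (complex^4^2) set set \<Rightarrow> (complex^4^2) set filter" where
  "near \<A> S = atin_within BC_top \<A> S"


section \<open>The chart \<open>\<O>\<^sub>1\<^sub>,\<^sub>3\<close> and its subsets\<close>

definition bc13 :: "real \<Rightarrow> complex \<Rightarrow> real \<Rightarrow> (complex^4^2) set" where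
  "bc13 a z b = bc_class (vector [vector [1, of_real a, 0, cnj z], vector [0, z, -1, of_real b]])"

definition O13 :: "(complex^4^2) set set" where
  "O13 = {bc13 a z b | a z b. True}"

definition bcC :: "sl_equation \<Rightarrow> (complex^4^2) set" where
  "bcC \<omega> = bc_class (vector [vector [1, of_real (1 / coeff_f \<omega> 0), 0, 0], vector [0, 0, 1, 0]])"

text \<open>\<open>C\<close> is the point of \<^const>\<open>O13\<close> with \<open>a = 1 / f\<^sub>0\<close>, \<open>z = 0\<close>, \<open>b = 0\<close>: the last rows differ by a sign.\<close>

definition d13 :: "sl_equation \<Rightarrow> real \<Rightarrow> complex \<Rightarrow> real \<Rightarrow> real" where
  "d13 \<omega> a z b = (a - 1 / coeff_f \<omega> 0) * b - (cmod z)\<^sup>2"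

definition B13 :: "sl_equation \<Rightarrow> (complex^4^2) set set" where
  "B13 \<omega> = {bc13 a z b | a z b. d13 \<omega> a z b = 0}"

definition B13_minus :: "sl_equation \<Rightarrow> (complex^4^2) set set" where
  "B13_minus \<omega> = {bc13 a z b | a z b. d13 \<omega> a z b < 0}"

definition B13r :: "sl_equation \<Rightarrow> (complex^4^2) set set" where
  "B13r \<omega> = {bc13 a z b | a z b. d13 \<omega> a z b = 0 \<and> a \<ge> 1 / coeff_f \<omega> 0 \<and> b \<ge> 0} - {bcC \<omega>}"

definition B13l :: "sl_equation \<Rightarrow> (complex^4^2) set set" where
  "B13l \<omega> = {bc13 a z b | a z b. d13 \<omega> a z b = 0 \<and> a \<le> 1 / coeff_f \<omega> 0 \<and> b \<le> 0} - {bcC \<omega>}"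

definition B13r_plus :: "sl_equation \<Rightarrow> (complex^4^2) set set" where
  "B13r_plus \<omega> = {bc13 a z b | a z b. d13 \<omega> a z b > 0 \<and> a \<ge> 1 / coeff_f \<omega> 0 \<and> b \<ge> 0}"

definition B13l_plus :: "sl_equation \<Rightarrow> (complex^4^2) set set" where
  "B13l_plus \<omega> = {bc13 a z b | a z b. d13 \<omega> a z b > 0 \<and> a \<le> 1 / coeff_f \<omega> 0 \<and> b \<le> 0}"

text \<open>The representing matrix of a class in \<^const>\<open>O13\<close> is unique, so the coordinates
  \<open>(a, z, b)\<close> used above are well defined.\<close>

definition nondecreasing_a12 :: "((complex^4^2) set \<Rightarrow> real) \<Rightarrow> (complex^4^2) set set \<Rightarrow> bool" where
  "nondecreasing_a12 F S \<longleftrightarrow>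
     (\<forall>a a' z b. bc13 a z b \<in> S \<and> bc13 a' z b \<in> S \<and> a \<le> a' \<longrightarrow> F (bc13 a z b) \<le> F (bc13 a' z b))"

definition nondecreasing_b22 :: "((complex^4^2) set \<Rightarrow> real) \<Rightarrow> (complex^4^2) set set \<Rightarrow> bool" where
  "nondecreasing_b22 F S \<longleftrightarrow>
     (\<forall>a z b b'. bc13 a z b \<in> S \<and> bc13 a z b' \<in> S \<and> b \<le> b' \<longrightarrow> F (bc13 a z b) \<le> F (bc13 a z b'))"

end

theory Submission
  imports Defs
begin

text \<open>
  Put \<open>\<sigma> = (f\<^sub>0 \<Delta>y\<^sub>0, - f\<^sub>N \<Delta>y\<^sub>N)\<close>.  In the variables \<open>(y\<^sub>1, \<dots>, y\<^sub>N, \<sigma>)\<close> the problem with boundary condition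
  \<open>(a, z, b)\<close> is the pencil \<open>M\<^sub>Q(\<mu>)\<close> of the Hermitian block matrix with diagonal blocks \<open>L - \<mu> W\<close>
  and \<open>Q\<close>, where \<open>L\<close> is a fixed Jacobi matrix and the \<open>2 \<times> 2\<close> matrix \<open>Q\<close> has determinant \<open>d(a, z, b)\<close>.

  If \<open>\<mu>\<close> is not an eigenvalue, then \<open>M\<^sub>Q(\<mu>)\<close> is nondegenerate and the number of its negative squares is
  the number of eigenvalues below \<open>\<mu>\<close> plus the number of nonpositive eigenvalues of \<open>Q\<close>: the
  eigenfunctions together with the eigenvectors of \<open>Q\<close> form an \<open>M\<^sub>Q(\<mu>)\<close>-orthogonal family, and
  comparing its semidefinite parts with the maximal definite subspaces by dimension leaves no
  room for anything else.  The number of negative squares is locally constant in \<open>Q\<close> and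
  monotone in \<open>Q\<close>, hence near \<open>Q\<^sub>0\<close> the counting function of the eigenvalues changes exactly by the
  difference of the numbers of nonpositive eigenvalues of \<open>Q\<^sub>0\<close> and \<open>Q\<close>.  All the limits, and the
  monotonicity, can be read off from this.
\<close>

section \<open>Finite families of sequences\<close>

text \<open>Eliminating \<sigma> would bring in the inverse of Q, which blows up exactly at the
  singular boundary conditions that the theorem is about; in the bordered pencil Q enters linearly
  and no point is exceptional. The price is a weight that vanishes on the two border variables, so
  that a kernel vector of Q acts as an eigenvector at \<infinity>. Such a vector is isotropic for
  the pencil, and in a nondegenerate form an isotropic direction accounts for one negative and one
  positive square. This is why the nonpositive rather than the negative eigenvalues of Q are
  counted, and why the nullity of Q is the number of eigenvalues missing from N. The number of
  eigenfunctions is not known in advance: their construction only shows that it is at least N minus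
  the nullity, and equality comes out of the same dimension comparison that gives the count.\<close>

lemma homogeneous_system:
  fixes \<Psi> :: "('i \<Rightarrow> complex) set"
  assumes "finite \<Psi>" "finite I" "card \<Psi> < card I"
  shows "\<exists>c. (\<exists>i\<in>I. c i \<noteq> 0) \<and> (\<forall>\<psi>\<in>\<Psi>. (\<Sum>i\<in>I. c i * \<psi> i) = 0)" (is "?P \<Psi> I")
proof -
  \<comment> \<open>The induction runs on a bound r, since elimination may identify functionals and
    so lower the cardinality by more than one.\<close>
  have "\<lbrakk>finite \<Psi>; finite I; card \<Psi> \<le> r; r < card I\<rbrakk> \<Longrightarrow> ?P \<Psi> I" for \<Psi> I r
  proof (induction r arbitrary: \<Psi> I)
    case 0
    then obtain i where "i \<in> I" by (metis card.empty ex_in_conv less_irrefl)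
    moreover have "\<Psi> = {}" using 0 by simp
    ultimately show ?case by (intro exI[of _ "\<lambda>_. 1"]) auto
  next
    case (Suc r)
    have [simp]: "finite I" using Suc.prems by auto
    show ?case
    proof (cases "\<forall>\<phi>\<in>\<Psi>. \<forall>i\<in>I. \<phi> i = 0")
      case True
      have "I \<noteq> {}" using Suc.prems by auto
      then show ?thesis using True by (intro exI[of _ "\<lambda>_. 1"]) auto
    next
      case False
      then obtain \<phi> j where j: "\<phi> \<in> \<Psi>" "j \<in> I" "\<phi> j \<noteq> 0" by auto
      define \<Phi> where "\<Phi> = \<Psi> - {\<phi>}"
      have \<Phi>: "finite \<Phi>" "card \<Phi> \<le> r" "\<Psi> = insert \<phi> \<Phi>"
        using Suc.prems j by (auto simp: \<Phi>_def)
      \<comment> \<open>Gaussian elimination with pivot \<open>\<phi> j\<close>: the functional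
        \<open>g \<psi>\<close> no longer involves the unknown j, whose value is recovered at the
        end from the equation of \<phi>.\<close>
      define g where "g = (\<lambda>\<psi> i. \<psi> i - \<psi> j * \<phi> i / \<phi> j)"
      have "card (g ` \<Phi>) \<le> r" using card_image_le[of \<Phi> g] \<Phi> by simp
      moreover have "r < card (I - {j})" using Suc.prems j by simp
      ultimately obtain c where c: "\<exists>i\<in>I - {j}. c i \<noteq> 0"
          "\<forall>\<psi>\<in>g ` \<Phi>. (\<Sum>i\<in>I - {j}. c i * \<psi> i) = 0"
        using Suc.IH[of "g ` \<Phi>" "I - {j}"] \<Phi> by auto
      define c' where "c' = c (j := - (\<Sum>i\<in>I - {j}. c i * \<phi> i) / \<phi> j)"
      have split: "(\<Sum>i\<in>I. c' i * \<psi> i) = c' j * \<psi> j + (\<Sum>i\<in>I - {j}. c i * \<psi> i)" for \<psi>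
        by (subst sum.remove[OF _ j(2)]) (auto simp: c'_def intro!: sum.cong)
      have "(\<Sum>i\<in>I. c' i * \<phi> i) = 0"
        using j by (simp add: split) (simp add: c'_def)
      moreover have "(\<Sum>i\<in>I. c' i * \<psi> i) = 0" if "\<psi> \<in> \<Phi>" for \<psi>
      proof -
        have "0 = (\<Sum>i\<in>I - {j}. c i * g \<psi> i)" using c that by auto
        also have "\<dots> = (\<Sum>i\<in>I - {j}. c i * \<psi> i) - \<psi> j / \<phi> j * (\<Sum>i\<in>I - {j}. c i * \<phi> i)"
          by (simp add: g_def right_diff_distrib sum_subtractf sum_distrib_left) (simp add: mult_ac)
        finally show ?thesis by (simp add: split) (simp add: c'_def)
      qed
      moreover have "\<exists>i\<in>I. c' i \<noteq> 0" using c j by (auto simp: c'_def)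
      ultimately show ?thesis using \<Phi> by (intro exI[of _ c']) auto
    qed
  qed
  then show ?thesis using assms by blast
qed

text \<open>Indexed families, not sets, are combined, so that a repeated vector counts as a
  dependence.\<close>

definition lincomb :: "('i \<Rightarrow> complex) \<Rightarrow> ('i \<Rightarrow> nat \<Rightarrow> complex) \<Rightarrow> 'i set \<Rightarrow> nat \<Rightarrow> complex" where
  "lincomb c u I = (\<lambda>n. \<Sum>i\<in>I. c i * u i n)"

text \<open>A copy of \<complex>^m inside the space of all sequences, which lets all dimensions
  share one type.\<close>

definition vecs :: "nat \<Rightarrow> (nat \<Rightarrow> complex) set" where
  "vecs m = {x. \<forall>n\<ge>m. x n = 0}"

lemma lincomb_vecs: "(\<And>i. i \<in> I \<Longrightarrow> u i \<in> vecs m) \<Longrightarrow> lincomb c u I \<in> vecs m"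
  by (simp add: vecs_def lincomb_def)

lemma lincomb_Plus:
  "finite I \<Longrightarrow> finite J \<Longrightarrow> lincomb c (case_sum u v) (I <+> J)
    = lincomb (c \<circ> Inl) u I + lincomb (c \<circ> Inr) v J"
  by (simp add: lincomb_def fun_eq_iff sum.Plus)

lemma dependent_family:
  assumes "finite I" "m < card I" "\<And>i. i \<in> I \<Longrightarrow> u i \<in> vecs m"
  shows "\<exists>c. (\<exists>i\<in>I. c i \<noteq> 0) \<and> lincomb c u I = 0"
proof -
  have "card ((\<lambda>n i. u i n) ` {..<m}) < card I"
    using card_image_le[of "{..<m}" "\<lambda>n i. u i n"] assms by simp
  then obtain c where c: "\<exists>i\<in>I. c i \<noteq> 0" "\<forall>n<m. (\<Sum>i\<in>I. c i * u i n) = 0"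
    using homogeneous_system[of "(\<lambda>n i. u i n) ` {..<m}" I] assms by auto
  have "lincomb c u I n = 0" for n
    by (cases "n < m") (use c assms in \<open>auto simp: lincomb_def vecs_def\<close>)
  then have "lincomb c u I = 0" by (simp add: fun_eq_iff)
  then show ?thesis using c by blast
qed


section \<open>Hermitian forms\<close>

text \<open>Continuity refers to the product topology on sequences. It holds because the forms in
  use read finitely many entries, and it serves the minimisation of quotients and the closedness of
  orthogonal complements.\<close>

locale hermitian_form =
  fixes F :: "(nat \<Rightarrow> complex) \<Rightarrow> (nat \<Rightarrow> complex) \<Rightarrow> complex"
  assumes lin: "F (\<lambda>n. c * x n + y n) v = c * F x v + F y v"
    and sym: "F y x = cnj (F x y)"
    and cont: "continuous_on UNIV (\<lambda>x. F x v)"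
    and cont_diag: "continuous_on UNIV (\<lambda>x. F x x)"
begin

lemma zero [simp]: "F 0 v = 0" "F (\<lambda>_. 0) v = 0"
proof -
  show "F (\<lambda>_. 0) v = 0"
    using lin[of 1 "\<lambda>_. 0" "\<lambda>_. 0" v] by simp
  then show "F 0 v = 0" by (simp add: zero_fun_def)
qed

lemma add: "F (x + y) v = F x v + F y v"
  using lin[of 1 x y v] by (simp add: plus_fun_def)

lemma scale: "F (\<lambda>n. c * x n) v = c * F x v"
  using lin[of c x "\<lambda>_. 0" v] by simp

lemma zero_right [simp]: "F v 0 = 0" "F v (\<lambda>_. 0) = 0"
  by (subst sym, simp)+

lemma lin_right: "F v (\<lambda>n. c * x n + y n) = cnj c * F v x + F v y"
  by (metis lin sym complex_cnj_add complex_cnj_mult complex_cnj_cnj)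

lemma add_right: "F v (x + y) = F v x + F v y"
  using lin_right[of v 1 x y] by (simp add: plus_fun_def)

lemma scale_right: "F v (\<lambda>n. c * x n) = cnj c * F v x"
  using lin_right[of v c x "\<lambda>_. 0"] by simp

lemma lincomb: "F (lincomb c u I) v = (\<Sum>i\<in>I. c i * F (u i) v)"
proof (induction I rule: infinite_finite_induct)
  case (insert i I)
  then have "lincomb c u (insert i I) = (\<lambda>n. c i * u i n + lincomb c u I n)"
    by (simp add: lincomb_def)
  then show ?case using insert by (simp add: lin)
qed (auto simp: lincomb_def)

lemma lincomb_right: "F v (lincomb c u I) = (\<Sum>i\<in>I. cnj (c i) * F v (u i))"
  by (subst sym) (simp add: lincomb sym[of "u _" v])

lemma diag_real: "F x x = of_real (Re (F x x))"
  using sym[of x x] by (metis Reals_cnj_iff of_real_Re)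

lemma lincomb_orthogonal:
  assumes "finite I" "\<And>i j. i \<in> I \<Longrightarrow> j \<in> I \<Longrightarrow> i \<noteq> j \<Longrightarrow> F (u i) (u j) = 0"
    and "\<And>i. i \<in> I \<Longrightarrow> F (u i) (u i) = of_real (\<theta> i)"
  shows "F (lincomb c u I) (lincomb c u I) = of_real (\<Sum>i\<in>I. (cmod (c i))\<^sup>2 * \<theta> i)"
proof -
  have "F (lincomb c u I) (lincomb c u I) = (\<Sum>i\<in>I. c i * (\<Sum>j\<in>I. cnj (c j) * F (u i) (u j)))"
    unfolding lincomb by (simp add: lincomb_right)
  also have "\<dots> = (\<Sum>i\<in>I. c i * (cnj (c i) * of_real (\<theta> i)))"
  proof (rule sum.cong[OF refl])
    fix i assume i: "i \<in> I"
    have "(\<Sum>j\<in>I. cnj (c j) * F (u i) (u j)) = (\<Sum>j\<in>I. if j = i then cnj (c i) * of_real (\<theta> i) else 0)"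
      by (rule sum.cong) (use assms i in auto)
    then show "c i * (\<Sum>j\<in>I. cnj (c j) * F (u i) (u j)) = c i * (cnj (c i) * of_real (\<theta> i))"
      using i assms(1) by simp
  qed
  also have "\<dots> = of_real (\<Sum>i\<in>I. (cmod (c i))\<^sup>2 * \<theta> i)"
    by (simp add: complex_norm_square[symmetric] mult.assoc[symmetric])
  finally show ?thesis .
qed

end

lemma hermitian_diff:
  assumes "hermitian_form F" "hermitian_form G"
  shows "hermitian_form (\<lambda>x y. F x y - of_real r * G x y)"
proof -
  interpret F: hermitian_form F by fact
  interpret G: hermitian_form G by fact
  show ?thesis
  proof
    show "F (\<lambda>n. c * x n + y n) v - of_real r * G (\<lambda>n. c * x n + y n) v
        = c * (F x v - of_real r * G x v) + (F y v - of_real r * G y v)" for c x y v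
      unfolding F.lin G.lin by (simp add: algebra_simps)
    show "F y x - of_real r * G y x = cnj (F x y - of_real r * G x y)" for x y
      using F.sym[of y x] G.sym[of y x] by simp
    show "continuous_on UNIV (\<lambda>x. F x v - of_real r * G x v)" for v
      by (intro continuous_intros F.cont G.cont)
    show "continuous_on UNIV (\<lambda>x. F x x - of_real r * G x x)"
      by (intro continuous_intros F.cont_diag G.cont_diag)
  qed
qed

section \<open>Rayleigh quotients and simultaneous diagonalisation\<close>

lemma subspace_lin:
  assumes "seq.subspace V" "x \<in> V" "y \<in> V"
  shows "(\<lambda>n. c * x n + y n) \<in> V"
proof -
  have "seq_scale c x + y \<in> V" using assms by (intro seq.subspace_add seq.subspace_scale)
  then show ?thesis by (simp add: seq_scale_def plus_fun_def)
qed

lemma subspace_intro: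
  assumes "0 \<in> V" "\<And>x y c. x \<in> V \<Longrightarrow> y \<in> V \<Longrightarrow> (\<lambda>n. c * x n + y n) \<in> V"
  shows "seq.subspace V"
proof (rule seq.subspaceI)
  fix x y c assume "x \<in> V"
  show "x + y \<in> V" if "y \<in> V" using assms(2)[OF \<open>x \<in> V\<close> that, of 1] by (simp add: plus_fun_def)
  show "seq_scale c x \<in> V" using assms(2)[OF \<open>x \<in> V\<close> assms(1), of c] by (simp add: seq_scale_def)
qed fact

text \<open>If \<open>F x x = 0\<close>, then the form at v + c x is a real-affine function of c; a
  nonzero slope would drive it below zero.\<close>

lemma psd_null_vector:
  assumes "hermitian_form F"
    and V: "seq.subspace V"
    and psd: "\<And>x. x \<in> V \<Longrightarrow> Re (F x x) \<ge> 0"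
    and x: "x \<in> V" "F x x = 0" and v: "v \<in> V"
  shows "F x v = 0"
proof (rule ccontr)
  interpret hermitian_form F by fact
  assume nz: "F x v \<noteq> 0"
  define r where "r = Re (F v v)"
  \<comment> \<open>Chosen so that the form takes the value -1 at v + c x.\<close>
  define t where "t = - (r + 1) / (2 * (cmod (F x v))\<^sup>2)"
  define c where "c = of_real t * cnj (F x v)"
  have "F (\<lambda>n. c * x n + v n) (\<lambda>n. c * x n + v n) = c * F x v + cnj c * F v x + F v v"
    unfolding lin lin_right by (simp add: x algebra_simps)
  also have "\<dots> = of_real (2 * t * (cmod (F x v))\<^sup>2 + r)"
  proof -
    have "F v v = of_real r" unfolding r_def by (rule diag_real)
    moreover have "c * F x v = of_real (t * (cmod (F x v))\<^sup>2)"
      by (simp add: c_def complex_norm_square[symmetric] mult_ac)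
    moreover have "cnj c * F v x = of_real (t * (cmod (F x v))\<^sup>2)"
      by (subst sym) (simp add: c_def complex_norm_square[symmetric] mult_ac)
    ultimately show ?thesis by simp
  qed
  also have "2 * t * (cmod (F x v))\<^sup>2 + r = -1"
    using nz by (simp add: t_def field_simps)
  finally have "Re (F (\<lambda>n. c * x n + v n) (\<lambda>n. c * x n + v n)) = -1" by simp
  then show False using psd[OF subspace_lin[OF V x(1) v, of c]] by simp
qed

text \<open>In the product topology the sphere is a closed part of a product of unit discs and
  points {0}, hence compact by Tychonoff.\<close>

lemma compact_unit_sphere:
  assumes "closed V" "V \<subseteq> vecs m"
  shows "compact {x \<in> V. (\<Sum>n<m. (cmod (x n))\<^sup>2) = 1}"
proof -
  define K :: "(nat \<Rightarrow> complex) set" where "K = Pi UNIV (\<lambda>n. if n < m then cball 0 1 else {0})"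
  have "compactin (product_topology (\<lambda>i::nat. euclidean) UNIV)
      (PiE UNIV (\<lambda>n. if n < m then cball (0::complex) 1 else {0}))"
    by (subst compactin_PiE) auto
  then have "compact K" by (simp add: K_def euclidean_product_topology PiE_UNIV_domain)
  moreover have "closed {x::nat\<Rightarrow>complex. (\<Sum>n<m. (cmod (x n))\<^sup>2) = 1}"
    by (intro closed_Collect_eq continuous_intros) auto
  ultimately have "compact (K \<inter> (V \<inter> {x. (\<Sum>n<m. (cmod (x n))\<^sup>2) = 1}))"
    using assms by (intro compact_Int_closed closed_Int) auto
  moreover have "K \<inter> (V \<inter> {x. (\<Sum>n<m. (cmod (x n))\<^sup>2) = 1}) = {x \<in> V. (\<Sum>n<m. (cmod (x n))\<^sup>2) = 1}"
  proof -
    have "x \<in> K" if "x \<in> V" and 1: "(\<Sum>n<m. (cmod (x n))\<^sup>2) = 1" for x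
    proof -
      have "cmod (x n) \<le> 1" if "n < m" for n
      proof -
        have "(cmod (x n))\<^sup>2 \<le> (\<Sum>n<m. (cmod (x n))\<^sup>2)" using that by (intro member_le_sum) auto
        then show ?thesis using 1 by (simp add: power_le_one_iff abs_square_le_1)
      qed
      then show ?thesis using that assms(2) by (auto simp: K_def vecs_def)
    qed
    then show ?thesis by auto
  qed
  ultimately show ?thesis by simp
qed

text \<open>At a minimiser of H / W the form H - \<mu> W is positive semidefinite on V and has a
  null vector, so \<open>psd_null_vector\<close> yields the eigenvalue equation without
  differentiation. The minimum is sought on the Euclidean sphere, whose compactness is known; as the
  quotient is scale invariant, W is normalised afterwards.\<close>

lemma rayleigh_minimizer:
  assumes "hermitian_form H" "hermitian_form W"
    and V: "seq.subspace V" "closed V" "V \<subseteq> vecs m"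
    and pos: "\<And>x. x \<in> V \<Longrightarrow> x \<noteq> 0 \<Longrightarrow> Re (W x x) > 0"
    and nontriv: "\<exists>x\<in>V. x \<noteq> 0"
  shows "\<exists>x\<in>V. \<exists>\<mu>. W x x = 1 \<and> (\<forall>v\<in>V. H x v = of_real \<mu> * W x v)
    \<and> (\<forall>v\<in>V. Re (H v v) \<ge> \<mu> * Re (W v v))"
proof -
  interpret H: hermitian_form H by fact
  interpret W: hermitian_form W by fact
  let ?S = "\<lambda>x. \<Sum>n<m. (cmod (x n))\<^sup>2"
  define K where "K = {x \<in> V. ?S x = 1}"
  have S0: "?S x > 0" if "x \<in> V" "x \<noteq> 0" for x
  proof -
    obtain n where n: "x n \<noteq> 0" using \<open>x \<noteq> 0\<close> by (auto simp: fun_eq_iff)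
    then have "n < m" using V(3) that by (force simp: vecs_def not_less)
    then show ?thesis using n by (intro sum_pos2[of _ n]) auto
  qed
  have scaleV: "(\<lambda>n. c * x n) \<in> V" if "x \<in> V" for c x
    using subspace_lin[OF V(1) that seq.subspace_0[OF V(1)], of c] by simp
  have normalise: "\<exists>c. c \<noteq> 0 \<and> (\<lambda>n. of_real c * x n) \<in> K" if "x \<in> V" "x \<noteq> 0" for x
  proof (intro exI[of _ "1 / sqrt (?S x)"] conjI)
    show "1 / sqrt (?S x) \<noteq> 0" using S0[OF that] by simp
    have "(\<Sum>n<m. (cmod (of_real (1 / sqrt (?S x)) * x n))\<^sup>2) = ?S x / (sqrt (?S x))\<^sup>2"
      by (simp add: norm_mult norm_divide power_mult_distrib power_divide sum_nonneg
          flip: sum_divide_distrib)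
    also have "\<dots> = 1" using S0[OF that] by simp
    finally show "(\<lambda>n. of_real (1 / sqrt (?S x)) * x n) \<in> K"
      using scaleV[OF that(1), of "of_real (1 / sqrt (?S x))"] unfolding K_def by blast
  qed
  have "compact K" unfolding K_def by (rule compact_unit_sphere) (use V in auto)
  moreover have "K \<noteq> {}" using nontriv normalise by blast
  moreover have Wpos: "Re (W x x) > 0" if "x \<in> K" for x
  proof -
    have "x \<noteq> 0" using that by (auto simp: K_def)
    then show ?thesis using pos that by (auto simp: K_def)
  qed
  moreover have "continuous_on K (\<lambda>x. Re (H x x) / Re (W x x))"
  proof (intro continuous_intros)
    show "continuous_on K (\<lambda>x. H x x)" "continuous_on K (\<lambda>x. W x x)"
      using H.cont_diag W.cont_diag by (auto intro: continuous_on_subset)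
  qed (use Wpos in force)
  ultimately obtain x where x: "x \<in> K" "\<And>y. y \<in> K \<Longrightarrow> Re (H x x) / Re (W x x) \<le> Re (H y y) / Re (W y y)"
    using continuous_attains_inf[of K] by blast
  define \<mu> where "\<mu> = Re (H x x) / Re (W x x)"
  have xV: "x \<in> V" using x by (simp add: K_def)
  have ge: "Re (H v v) \<ge> \<mu> * Re (W v v)" if v: "v \<in> V" for v
  proof (cases "v = 0")
    case False
    then obtain c where c: "c \<noteq> 0" "(\<lambda>n. of_real c * v n) \<in> K" using normalise v by blast
    define y where "y = (\<lambda>n. of_real c * v n)"
    have y: "y \<in> K" using c by (simp add: y_def)
    have Hy: "Re (H y y) = c\<^sup>2 * Re (H v v)" unfolding y_def H.scale H.scale_right
      by (simp add: power2_eq_square)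
    have Wy: "Re (W y y) = c\<^sup>2 * Re (W v v)" unfolding y_def W.scale W.scale_right
      by (simp add: power2_eq_square)
    have "\<mu> \<le> Re (H v v) / Re (W v v)" using x(2)[OF y] c by (simp add: \<mu>_def Hy Wy)
    then show ?thesis using pos[OF v False] by (simp add: field_simps)
  qed auto
  define F where "F = (\<lambda>x y. H x y - of_real \<mu> * W x y)"
  have F: "hermitian_form F" unfolding F_def by (rule hermitian_diff) fact+
  have F0: "F x x = 0"
  proof -
    have "F x x = of_real (Re (H x x) - \<mu> * Re (W x x))"
      unfolding F_def by (subst H.diag_real, subst W.diag_real) simp
    also have "\<dots> = 0" using Wpos[OF x(1)] by (simp add: \<mu>_def)
    finally show ?thesis .
  qed
  have eig: "H x v = of_real \<mu> * W x v" if "v \<in> V" for v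
    using psd_null_vector[OF F V(1) _ xV F0 that] ge by (simp add: F_def)
  define c where "c = 1 / sqrt (Re (W x x))"
  define u where "u = (\<lambda>n. of_real c * x n)"
  have "u \<in> V" unfolding u_def by (rule scaleV[OF xV])
  moreover have "W u u = 1"
  proof -
    have "W u u = of_real (c\<^sup>2) * W x x"
      unfolding u_def W.scale W.scale_right by (simp add: power2_eq_square)
    also have "\<dots> = of_real (c\<^sup>2 * Re (W x x))" by (subst W.diag_real) simp
    also have "c\<^sup>2 * Re (W x x) = 1" using Wpos[OF x(1)] by (simp add: c_def power_divide)
    finally show ?thesis by simp
  qed
  moreover have "\<forall>v\<in>V. H u v = of_real \<mu> * W u v"
    unfolding u_def H.scale W.scale using eig by simp
  ultimately show ?thesis using ge by blast
qed

lemma sum_seq_scale: "(\<Sum>i\<in>I. seq_scale (c i) (u i)) = lincomb c u I"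
proof -
  have "(\<Sum>i\<in>I. seq_scale (c i) (u i)) n = (\<Sum>i\<in>I. c i * u i n)" for n
    by (induction I rule: infinite_finite_induct) (auto simp: seq_scale_def)
  then show ?thesis by (simp add: lincomb_def fun_eq_iff)
qed

lemma lincomb_in_subspace:
  assumes "seq.subspace V" "\<And>i. i \<in> I \<Longrightarrow> u i \<in> V"
  shows "lincomb c u I \<in> V"
  unfolding sum_seq_scale[symmetric]
  by (intro seq.subspace_sum[OF assms(1)] seq.subspace_scale[OF assms(1)] assms(2))

lemma subspace_kernel:
  assumes "hermitian_form W" "seq.subspace V"
  shows "seq.subspace {v \<in> V. \<forall>i\<in>I. W v (x i) = 0}"
proof -
  interpret W: hermitian_form W by fact
  show ?thesis
    by (rule subspace_intro) (use assms seq.subspace_0 subspace_lin in \<open>auto simp: W.lin\<close>)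
qed

text \<open>Successively minimising the Rayleigh quotient on the complement of the vectors found so far
  yields the eigenvalues in increasing order.\<close>

lemma spectral_theorem:
  assumes H: "hermitian_form H" and W: "hermitian_form W"
    and V: "seq.subspace V" "closed V" "V \<subseteq> vecs m"
    and pos: "\<And>x. x \<in> V \<Longrightarrow> x \<noteq> 0 \<Longrightarrow> Re (W x x) > 0"
  obtains k :: nat and x :: "nat \<Rightarrow> nat \<Rightarrow> complex" and \<mu> :: "nat \<Rightarrow> real"
  where "\<And>i. i < k \<Longrightarrow> x i \<in> V"
    and "\<And>i j. i < k \<Longrightarrow> j < k \<Longrightarrow> W (x i) (x j) = (if i = j then 1 else 0)"
    and "\<And>i v. i < k \<Longrightarrow> v \<in> V \<Longrightarrow> H (x i) v = of_real (\<mu> i) * W (x i) v"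
    and "\<And>i j. i \<le> j \<Longrightarrow> j < k \<Longrightarrow> \<mu> i \<le> \<mu> j"
    and "\<And>v. v \<in> V \<Longrightarrow> (\<And>i. i < k \<Longrightarrow> W v (x i) = 0) \<Longrightarrow> v = 0"
proof -
  interpret H: hermitian_form H by fact
  interpret W: hermitian_form W by fact
  \<comment> \<open>The last clause, minimality on the complement of the earlier vectors, is what
    keeps the eigenvalues increasing when a vector is appended.\<close>
  define P where "P = (\<lambda>(k::nat) (x::nat \<Rightarrow> nat \<Rightarrow> complex) \<mu>. (\<forall>i<k. x i \<in> V) \<and>
     (\<forall>i<k. \<forall>j<k. W (x i) (x j) = (if i = j then 1 else 0)) \<and>
     (\<forall>i<k. \<forall>v\<in>V. H (x i) v = of_real (\<mu> i) * W (x i) v) \<and>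
     (\<forall>j<k. \<forall>i\<le>j. \<mu> i \<le> (\<mu> j :: real)) \<and>
     (\<forall>i<k. \<forall>v\<in>V. (\<forall>j<i. W v (x j) = 0) \<longrightarrow> Re (H v v) \<ge> \<mu> i * Re (W v v)))"
  have bound: "k \<le> m" if "P k x \<mu>" for k x \<mu>
  proof (rule ccontr)
    assume "\<not> k \<le> m"
    moreover have "x i \<in> vecs m" if "i \<in> {..<k}" for i
      using that \<open>P k x \<mu>\<close> V(3) by (auto simp: P_def)
    ultimately obtain c where c: "\<exists>i\<in>{..<k}. c i \<noteq> 0" "lincomb c x {..<k} = 0"
      using dependent_family[of "{..<k}" m x] by auto
    have "c j = 0" if "j < k" for j
    proof -
      have "0 = W (lincomb c x {..<k}) (x j)" using c by simp
      also have "\<dots> = (\<Sum>i<k. if i = j then c i else 0)"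
        unfolding W.lincomb by (rule sum.cong) (use \<open>P k x \<mu>\<close> that in \<open>auto simp: P_def\<close>)
      also have "\<dots> = c j" using that by simp
      finally show ?thesis by simp
    qed
    then show False using c by auto
  qed
  have ext: "\<exists>x' \<mu>'. P (Suc k) x' \<mu>'"
    if P: "P k x \<mu>" and ex: "\<exists>v\<in>V. (\<forall>i<k. W v (x i) = 0) \<and> v \<noteq> 0" for k x \<mu>
  proof -
    define U where "U = {v \<in> V. \<forall>i\<in>{..<k}. W v (x i) = 0}"
    have "closed U"
    proof -
      have "U = V \<inter> (\<Inter>i\<in>{..<k}. {v. W v (x i) = 0})" by (auto simp: U_def)
      moreover have "closed {v. W v (x i) = 0}" for i
        by (intro closed_Collect_eq W.cont continuous_on_const)
      ultimately show ?thesis using V by auto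
    qed
    moreover have "seq.subspace U" unfolding U_def by (rule subspace_kernel) fact+
    moreover have "U \<subseteq> V" by (auto simp: U_def)
    moreover have "\<exists>v\<in>U. v \<noteq> 0" using ex by (auto simp: U_def)
    ultimately obtain u \<nu> where u: "u \<in> U" "W u u = 1" "\<forall>v\<in>U. H u v = of_real \<nu> * W u v"
        "\<forall>v\<in>U. Re (H v v) \<ge> \<nu> * Re (W v v)"
      using rayleigh_minimizer[OF H W, of U m] V(3) pos by blast
    have ux: "W u (x i) = 0" "W (x i) u = 0" if "i < k" for i
      using u that by (auto simp: U_def W.sym[of "x i" u])
    \<comment> \<open>The minimiser satisfies the equation on U only. For general v the W-projection
      c onto the earlier vectors is split off; both forms vanish between u and c.\<close>
    have Hu: "H u v = of_real \<nu> * W u v" if v: "v \<in> V" for v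
    proof -
      define c where "c = lincomb (\<lambda>i. W v (x i)) x {..<k}"
      define r where "r = v - c"
      have "c \<in> V"
        unfolding c_def by (rule lincomb_in_subspace[OF V(1)]) (use P in \<open>auto simp: P_def\<close>)
      have vr: "v = c + r" by (simp add: r_def)
      have "W c (x j) = W v (x j)" if "j < k" for j
      proof -
        have "W c (x j) = (\<Sum>i<k. if i = j then W v (x i) else 0)"
          unfolding c_def W.lincomb by (rule sum.cong) (use P that in \<open>auto simp: P_def\<close>)
        then show ?thesis using that by simp
      qed
      moreover have "W v y = W c y + W r y" for y using W.add[of c r y] vr by simp
      ultimately have "r \<in> U"
        using \<open>c \<in> V\<close> v seq.subspace_diff[OF V(1)] by (auto simp: U_def r_def)
      moreover have "W u c = 0" unfolding c_def W.lincomb_right using ux by simp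
      moreover have "H u c = 0"
      proof -
        have "H u (x i) = 0" if "i < k" for i
          using P ux[OF that] that u(1) by (subst H.sym) (auto simp: P_def U_def)
        then show ?thesis unfolding c_def H.lincomb_right by simp
      qed
      ultimately show ?thesis
        unfolding vr H.add_right W.add_right using u(3) by simp
    qed
    have \<mu>\<nu>: "\<mu> i \<le> \<nu>" if "i < k" for i
    proof -
      have "H u u = of_real \<nu>" using Hu[of u] u by (auto simp: U_def)
      moreover have "\<mu> i * Re (W u u) \<le> Re (H u u)"
        using P that ux u(1) unfolding P_def U_def by auto
      ultimately show ?thesis using u(2) by simp
    qed
    have "P (Suc k) (x(k := u)) (\<mu>(k := \<nu>))"
      unfolding P_def
    proof (intro conjI allI ballI impI)
      fix i assume i: "i < Suc k"
      show "(x(k := u)) i \<in> V" using i P u by (auto simp: P_def U_def less_Suc_eq)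
      fix j assume j: "j < Suc k"
      show "W ((x(k := u)) i) ((x(k := u)) j) = (if i = j then 1 else 0)"
        using i j P u(2) ux by (auto simp: P_def less_Suc_eq)
    next
      fix i v assume "i < Suc k" "v \<in> V"
      then show "H ((x(k := u)) i) v = of_real ((\<mu>(k := \<nu>)) i) * W ((x(k := u)) i) v"
        using P Hu by (auto simp: P_def less_Suc_eq)
    next
      fix j i :: nat assume "j < Suc k" "i \<le> j"
      then show "(\<mu>(k := \<nu>)) i \<le> (\<mu>(k := \<nu>)) j"
        using P \<mu>\<nu> by (auto simp: P_def less_Suc_eq)
    next
      fix i v assume i: "i < Suc k" and v: "v \<in> V" and o: "\<forall>j<i. W v ((x(k := u)) j) = 0"
      show "Re (H v v) \<ge> (\<mu>(k := \<nu>)) i * Re (W v v)"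
      proof (cases "i = k")
        case True
        then have "v \<in> U" using o v by (auto simp: U_def)
        then show ?thesis using True u by auto
      next
        case False
        then have "i < k" "\<forall>j<i. W v (x j) = 0" using i o by auto
        then show ?thesis using P v False by (auto simp: P_def)
      qed
    qed
    then show ?thesis by blast
  qed
  have "\<exists>x \<mu>. P 0 x \<mu>" by (auto simp: P_def)
  \<comment> \<open>W-orthonormal vectors in \<open>vecs m\<close> number at most m, so a longest
    family exists; were it incomplete, \<open>ext\<close> would lengthen it.\<close>
  define k where "k = (GREATEST k. \<exists>x \<mu>. P k x \<mu>)"
  have k: "\<exists>x \<mu>. P k x \<mu>" unfolding k_def
    by (rule GreatestI_nat[of _ 0 m]) (use \<open>\<exists>x \<mu>. P 0 x \<mu>\<close> bound in blast)+
  have max: "k' \<le> k" if "\<exists>x \<mu>. P k' x \<mu>" for k' unfolding k_def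
    by (rule Greatest_le_nat[of _ k' m]) (use that bound in blast)+
  from k obtain x \<mu> where P: "P k x \<mu>" by blast
  have "v = 0" if "v \<in> V" "\<And>i. i < k \<Longrightarrow> W v (x i) = 0" for v
  proof (rule ccontr)
    assume "v \<noteq> 0"
    then have "\<exists>x' \<mu>'. P (Suc k) x' \<mu>'" using that by (intro ext[OF P]) auto
    then show False using max by force
  qed
  then show ?thesis using P by (intro that[of k x \<mu>]) (auto simp: P_def)
qed


section \<open>Inertia\<close>

text \<open>A definite subspace and an oppositely semidefinite one meet only in 0, so their
  dimensions add up to at most m. The sign s lets one proof serve negative and positive
  families.\<close>

lemma card_definite_semidefinite:
  fixes s :: real
  assumes F: "hermitian_form F" and fin: "finite A" "finite B"
    and vecs: "\<And>i. i \<in> A \<Longrightarrow> u i \<in> vecs m" "\<And>i. i \<in> B \<Longrightarrow> x i \<in> vecs m"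
    and pos: "\<And>c. \<exists>i\<in>A. c i \<noteq> 0 \<Longrightarrow> s * Re (F (lincomb c u A) (lincomb c u A)) > 0"
    and nonpos: "\<And>c. s * Re (F (lincomb c x B) (lincomb c x B)) \<le> 0"
    and indep: "\<And>c i. lincomb c x B = 0 \<Longrightarrow> i \<in> B \<Longrightarrow> c i = 0"
  shows "card A + card B \<le> m"
proof (rule ccontr)
  interpret hermitian_form F by fact
  assume "\<not> card A + card B \<le> m"
  then have "m < card (A <+> B)" using fin by (simp add: card_Plus)
  moreover have "case_sum u x i \<in> vecs m" if "i \<in> A <+> B" for i
    using that vecs by auto
  ultimately obtain c where c: "\<exists>i\<in>A <+> B. c i \<noteq> 0" "lincomb c (case_sum u x) (A <+> B) = 0"
    using dependent_family[of "A <+> B" m "case_sum u x"] fin by auto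
  define a where "a = lincomb (c \<circ> Inl) u A"
  define b where "b = lincomb (c \<circ> Inr) x B"
  have ab: "a + b = 0" using c(2) fin by (simp add: lincomb_Plus a_def b_def)
  show False
  proof (cases "\<exists>i\<in>A. c (Inl i) \<noteq> 0")
    case True
    then have "s * Re (F a a) > 0" unfolding a_def by (intro pos) auto
    moreover have "F a a = F b b"
    proof -
      have "F a v = - F b v" for v using add[of a b v] ab by (simp add: add_eq_0_iff)
      moreover have "F v a = - F v b" for v using add_right[of v a b] ab by (simp add: add_eq_0_iff)
      ultimately show ?thesis by simp
    qed
    ultimately show False using nonpos[of "c \<circ> Inr"] by (simp add: b_def)
  next
    case False
    then have "a = 0" by (auto simp: a_def lincomb_def zero_fun_def fun_eq_iff)
    then have "b = 0" using ab by simp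
    then have "\<forall>i\<in>B. c (Inr i) = 0" using indep[of "c \<circ> Inr"] by (auto simp: b_def)
    then show False using c(1) False by auto
  qed
qed

section \<open>Definite splittings of a nondegenerate form\<close>

definition std_form :: "nat \<Rightarrow> (nat \<Rightarrow> complex) \<Rightarrow> (nat \<Rightarrow> complex) \<Rightarrow> complex" where
  "std_form m x v = (\<Sum>n<m. x n * cnj (v n))"

lemma hermitian_std_form: "hermitian_form (std_form m)"
proof
  show "std_form m (\<lambda>n. c * x n + y n) v = c * std_form m x v + std_form m y v" for c x y v
    by (simp add: std_form_def algebra_simps sum.distrib sum_distrib_left)
  show "std_form m y x = cnj (std_form m x y)" for x y
    by (simp add: std_form_def mult.commute)
qed (auto simp: std_form_def intro!: continuous_intros)

lemma std_form_diag: "std_form m x x = of_real (\<Sum>n<m. (cmod (x n))\<^sup>2)"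
  by (simp add: std_form_def complex_norm_square[symmetric])

lemma std_form_pos:
  assumes "x \<in> vecs m" "x \<noteq> 0" shows "Re (std_form m x x) > 0"
proof -
  obtain n where n: "x n \<noteq> 0" using \<open>x \<noteq> 0\<close> by (auto simp: fun_eq_iff)
  then have "n < m" using assms by (force simp: vecs_def not_less)
  then show ?thesis unfolding std_form_diag Re_complex_of_real using n by (intro sum_pos2[of _ n]) auto
qed

lemma subspace_vecs: "seq.subspace (vecs m)"
  by (rule subspace_intro) (auto simp: vecs_def)

lemma closed_vecs: "closed (vecs m)"
proof -
  have "vecs m = (\<Inter>n\<in>{m..}. {x. x n = 0})" by (auto simp: vecs_def)
  moreover have "closed {x::nat \<Rightarrow> complex. x n = 0}" for n
    by (intro closed_Collect_eq continuous_intros) auto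
  ultimately show ?thesis by auto
qed

text \<open>Nondegeneracy in quantitative shape: \<open>card A\<close> and \<open>card B\<close> are
  the numbers of negative and positive squares, and \<epsilon>, measured against the Euclidean form,
  bounds the perturbations that preserve all signs.\<close>

definition definite_splitting ::
    "nat \<Rightarrow> ((nat \<Rightarrow> complex) \<Rightarrow> (nat \<Rightarrow> complex) \<Rightarrow> complex) \<Rightarrow> nat set \<Rightarrow> nat set \<Rightarrow> (nat \<Rightarrow> nat \<Rightarrow> complex) \<Rightarrow> real \<Rightarrow> bool"
  where "definite_splitting m F A B u \<epsilon> \<longleftrightarrow>
    finite A \<and> finite B \<and> m \<le> card A + card B \<and> \<epsilon> > 0 \<and> (\<forall>i\<in>A \<union> B. u i \<in> vecs m) \<and>
    (\<forall>c. (\<exists>i\<in>A. c i \<noteq> 0) \<longrightarrow> lincomb c u A \<noteq> 0) \<and>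
    (\<forall>c. (\<exists>i\<in>B. c i \<noteq> 0) \<longrightarrow> lincomb c u B \<noteq> 0) \<and>
    (\<forall>c. Re (F (lincomb c u A) (lincomb c u A)) \<le> - \<epsilon> * Re (std_form m (lincomb c u A) (lincomb c u A))) \<and>
    (\<forall>c. Re (F (lincomb c u B) (lincomb c u B)) \<ge> \<epsilon> * Re (std_form m (lincomb c u B) (lincomb c u B)))"

lemma definite_splitting_perturb:
  assumes ds: "definite_splitting m F A B u \<epsilon>"
    and close: "\<And>v. v \<in> vecs m \<Longrightarrow> v \<noteq> 0 \<Longrightarrow> \<bar>Re (G v v) - Re (F v v)\<bar> < \<epsilon> * Re (std_form m v v)"
  shows "\<exists>i\<in>A. c i \<noteq> 0 \<Longrightarrow> Re (G (lincomb c u A) (lincomb c u A)) < 0"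
    and "\<exists>i\<in>B. c i \<noteq> 0 \<Longrightarrow> Re (G (lincomb c u B) (lincomb c u B)) > 0"
proof -
  have v: "lincomb c u A \<in> vecs m" "lincomb c u B \<in> vecs m"
    using ds by (auto simp: definite_splitting_def intro!: lincomb_vecs)
  have F: "Re (F (lincomb c u A) (lincomb c u A)) \<le> - \<epsilon> * Re (std_form m (lincomb c u A) (lincomb c u A))"
    "Re (F (lincomb c u B) (lincomb c u B)) \<ge> \<epsilon> * Re (std_form m (lincomb c u B) (lincomb c u B))"
    using ds unfolding definite_splitting_def by metis+
  show "Re (G (lincomb c u A) (lincomb c u A)) < 0" if "\<exists>i\<in>A. c i \<noteq> 0"
  proof -
    have "lincomb c u A \<noteq> 0" using ds that unfolding definite_splitting_def by metis
    from close[OF v(1) this] F(1) show ?thesis by linarith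
  qed
  show "Re (G (lincomb c u B) (lincomb c u B)) > 0" if "\<exists>i\<in>B. c i \<noteq> 0"
  proof -
    have "lincomb c u B \<noteq> 0" using ds that unfolding definite_splitting_def by metis
    from close[OF v(2) this] F(2) show ?thesis by linarith
  qed
qed

text \<open>Diagonalising F against the Euclidean form gives eigenvalues \<tau>, none of them 0 by
  nondegeneracy; their signs sort the vectors into A and B, and the least modulus serves as the
  gap.\<close>

lemma nondegenerate_splitting:
  assumes F: "hermitian_form F"
    and nondeg: "\<And>x. x \<in> vecs m \<Longrightarrow> (\<And>v. v \<in> vecs m \<Longrightarrow> F x v = 0) \<Longrightarrow> x = 0"
  shows "\<exists>A B u \<epsilon>. definite_splitting m F A B u \<epsilon>"
proof -
  interpret F: hermitian_form F by fact
  interpret S: hermitian_form "std_form m" by (rule hermitian_std_form)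
  obtain k :: nat and u \<tau> where u: "\<And>i. i < k \<Longrightarrow> u i \<in> vecs m"
    and orth: "\<And>i j. i < k \<Longrightarrow> j < k \<Longrightarrow> std_form m (u i) (u j) = (if i = j then 1 else 0)"
    and eig: "\<And>i v. i < k \<Longrightarrow> v \<in> vecs m \<Longrightarrow> F (u i) v = of_real (\<tau> i) * std_form m (u i) v"
    and "\<And>i j. i \<le> j \<Longrightarrow> j < k \<Longrightarrow> \<tau> i \<le> \<tau> j"
    and compl: "\<And>v. v \<in> vecs m \<Longrightarrow> (\<And>i. i < k \<Longrightarrow> std_form m v (u i) = 0) \<Longrightarrow> v = 0"
    by (rule spectral_theorem[OF F hermitian_std_form[of m] subspace_vecs[of m] closed_vecs order.refl
          std_form_pos]) blast+
  have nz: "\<tau> i \<noteq> 0" if "i < k" for i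
  proof
    assume "\<tau> i = 0"
    then have "u i = 0" using nondeg[OF u[OF that]] eig[OF that] by simp
    then show False using orth[OF that that] by simp
  qed
  \<comment> \<open>Fewer than m vectors leave a nonzero vector orthogonal to all of them, against
    completeness.\<close>
  have km: "m \<le> k"
  proof (rule ccontr)
    assume "\<not> m \<le> k"
    define \<Psi> where "\<Psi> = (\<lambda>i n. cnj (u i n)) ` {..<k}"
    have "card \<Psi> < card {..<m}" "finite \<Psi>"
      using card_image_le[of "{..<k}" "\<lambda>i n. cnj (u i n)"] \<open>\<not> m \<le> k\<close> by (auto simp: \<Psi>_def)
    then obtain c where c: "\<exists>n<m. c n \<noteq> 0" "\<And>\<psi>. \<psi> \<in> \<Psi> \<Longrightarrow> (\<Sum>n<m. c n * \<psi> n) = 0"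
      using homogeneous_system[of \<Psi> "{..<m}"] by auto
    define v where "v = (\<lambda>n. if n < m then c n else 0)"
    have "v = 0"
    proof (rule compl)
      show "v \<in> vecs m" by (auto simp: v_def vecs_def)
      show "std_form m v (u i) = 0" if "i < k" for i
        using c(2)[of "\<lambda>n. cnj (u i n)"] that by (auto simp: std_form_def v_def \<Psi>_def)
    qed
    then show False using c(1) by (auto simp: v_def fun_eq_iff split: if_splits)
  qed
  define A where "A = {i. i < k \<and> \<tau> i < 0}"
  define B where "B = {i. i < k \<and> \<tau> i > 0}"
  \<comment> \<open>The 1 keeps the minimum meaningful when k = 0.\<close>
  define \<epsilon> where "\<epsilon> = Min (insert 1 ((\<lambda>i. \<bar>\<tau> i\<bar>) ` {..<k}))"
  have fin: "finite A" "finite B" by (auto simp: A_def B_def)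
  have \<epsilon>: "\<epsilon> \<le> \<bar>\<tau> i\<bar>" if "i < k" for i using that by (auto simp: \<epsilon>_def)
  have "A \<union> B = {..<k}" using nz by (auto simp: A_def B_def) (metis linorder_neqE_linordered_idom)
  moreover have "A \<inter> B = {}" by (auto simp: A_def B_def)
  ultimately have card: "m \<le> card A + card B"
    using card_Un_disjoint[OF fin] km by simp
  have diag: "F (lincomb c u I) (lincomb c u I) = of_real (\<Sum>i\<in>I. (cmod (c i))\<^sup>2 * \<tau> i)"
      "std_form m (lincomb c u I) (lincomb c u I) = of_real (\<Sum>i\<in>I. (cmod (c i))\<^sup>2 * 1)"
    if I: "I \<subseteq> {..<k}" for c I
  proof -
    have [simp]: "finite I" using I finite_subset by blast
    show "F (lincomb c u I) (lincomb c u I) = of_real (\<Sum>i\<in>I. (cmod (c i))\<^sup>2 * \<tau> i)"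
      by (rule F.lincomb_orthogonal) (use I eig u orth in \<open>auto simp: subset_iff\<close>)
    show "std_form m (lincomb c u I) (lincomb c u I) = of_real (\<Sum>i\<in>I. (cmod (c i))\<^sup>2 * 1)"
      by (rule S.lincomb_orthogonal) (use I orth in \<open>auto simp: subset_iff\<close>)
  qed
  have AB: "A \<subseteq> {..<k}" "B \<subseteq> {..<k}" by (auto simp: A_def B_def)
  have ne: "lincomb c u I \<noteq> 0" if I: "I \<subseteq> {..<k}" and ex: "\<exists>i\<in>I. c i \<noteq> 0" for c I
  proof
    assume 0: "lincomb c u I = 0"
    obtain i where i: "i \<in> I" "c i \<noteq> 0" using ex by auto
    have "finite I" using I finite_subset by blast
    then have "(\<Sum>i\<in>I. (cmod (c i))\<^sup>2 * 1) > 0" using i by (intro sum_pos2[of _ i]) auto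
    moreover have "(\<Sum>i\<in>I. (cmod (c i))\<^sup>2 * 1) = 0"
      using diag(2)[OF I, of c] 0 by (metis S.zero(1) of_real_eq_0_iff)
    ultimately show False by simp
  qed
  have "definite_splitting m F A B u \<epsilon>"
    unfolding definite_splitting_def
  proof (intro conjI allI impI ballI fin card)
    show "\<epsilon> > 0" using nz by (auto simp: \<epsilon>_def)
    show "u i \<in> vecs m" if "i \<in> A \<union> B" for i using that u by (auto simp: A_def B_def)
    show "lincomb c u A \<noteq> 0" if "\<exists>i\<in>A. c i \<noteq> 0" for c using ne AB that by blast
    show "lincomb c u B \<noteq> 0" if "\<exists>i\<in>B. c i \<noteq> 0" for c using ne AB that by blast
    have "(cmod (c i))\<^sup>2 * \<tau> i \<le> - \<epsilon> * (cmod (c i))\<^sup>2" if "i \<in> A" for c i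
    proof -
      have "\<tau> i \<le> - \<epsilon>" using \<epsilon>[of i] that by (auto simp: A_def)
      then show ?thesis using mult_left_mono[of "\<tau> i" "-\<epsilon>" "(cmod (c i))\<^sup>2"] by (simp add: mult.commute)
    qed
    then show "Re (F (lincomb c u A) (lincomb c u A)) \<le> - \<epsilon> * Re (std_form m (lincomb c u A) (lincomb c u A))" for c
      unfolding diag[OF AB(1)] Re_complex_of_real by (simp add: sum_distrib_left sum_mono flip: sum_negf)
    have "\<epsilon> * (cmod (c i))\<^sup>2 \<le> (cmod (c i))\<^sup>2 * \<tau> i" if "i \<in> B" for c i
    proof -
      have "\<epsilon> \<le> \<tau> i" using \<epsilon>[of i] that by (auto simp: B_def)
      then show ?thesis using mult_left_mono[of "\<epsilon>" "\<tau> i" "(cmod (c i))\<^sup>2"] by (simp add: mult.commute)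
    qed
    then show "Re (F (lincomb c u B) (lincomb c u B)) \<ge> \<epsilon> * Re (std_form m (lincomb c u B) (lincomb c u B))" for c
      unfolding diag[OF AB(2)] Re_complex_of_real by (simp add: sum_distrib_left sum_mono)
  qed
  then show ?thesis by blast
qed

section \<open>Two-by-two Hermitian matrices\<close>

text \<open>The fourth property says, without square roots, that \<kappa> and p + b - \<kappa> are
  the two roots of the characteristic polynomial.\<close>

lemma hermitian_2x2_eigenvector:
  fixes p b :: real and z :: complex
  obtains \<kappa> :: real and \<alpha> \<beta> :: complex
  where "(cmod \<alpha>)\<^sup>2 + (cmod \<beta>)\<^sup>2 = 1"
    "of_real p * \<alpha> - cnj z * \<beta> = of_real \<kappa> * \<alpha>"
    "- z * \<alpha> + of_real b * \<beta> = of_real \<kappa> * \<beta>"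
    "\<kappa> * (p + b - \<kappa>) = p * b - (cmod z)\<^sup>2"
\<comment> \<open>For a diagonal matrix the vector (cnj z, p - \<kappa>) used below can
  vanish.\<close>
proof (cases "z = 0")
  case True
  then show ?thesis by (intro that[of 1 0 p]) auto
next
  case False
  define s where "s = sqrt ((p - b)\<^sup>2 + 4 * (cmod z)\<^sup>2)"
  have s: "s\<^sup>2 = (p - b)\<^sup>2 + 4 * (cmod z)\<^sup>2" by (simp add: s_def)
  define \<kappa> where "\<kappa> = (p + b + s) / 2"
  have \<kappa>: "\<kappa> * (p + b - \<kappa>) = p * b - (cmod z)\<^sup>2"
    using s by (simp add: \<kappa>_def field_simps power2_eq_square)
  define m where "m = (cmod z)\<^sup>2 + (p - \<kappa>)\<^sup>2"
  have m: "m > 0" using False by (simp add: m_def add_pos_nonneg)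
  define r where "r = 1 / sqrt m"
  have r: "r\<^sup>2 * m = 1" using m by (simp add: r_def power_divide)
  show ?thesis
  proof (rule that[of "of_real r * cnj z" "of_real (r * (p - \<kappa>))" \<kappa>, OF _ _ _ \<kappa>])
    have "(cmod (of_real r * cnj z))\<^sup>2 + (cmod (of_real (r * (p - \<kappa>))))\<^sup>2 = r\<^sup>2 * m"
      by (simp add: norm_mult power_mult_distrib m_def distrib_left flip: of_real_diff)
    then show "(cmod (of_real r * cnj z))\<^sup>2 + (cmod (of_real (r * (p - \<kappa>))))\<^sup>2 = 1" using r by simp
    have zz: "z * cnj z = of_real (p * b - \<kappa> * (p + b - \<kappa>))"
      using \<kappa> by (simp add: complex_norm_square[symmetric])
    show "of_real p * (of_real r * cnj z) - cnj z * of_real (r * (p - \<kappa>)) = of_real \<kappa> * (of_real r * cnj z)"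
      by (simp add: algebra_simps)
    have "- z * (of_real r * cnj z) = of_real (- r * (p * b - \<kappa> * (p + b - \<kappa>)))"
      using zz by (simp add: mult_ac)
    also have "\<dots> + of_real b * of_real (r * (p - \<kappa>)) = (of_real (\<kappa> * (r * (p - \<kappa>))) :: complex)"
      by (simp only: of_real_mult[symmetric] of_real_add[symmetric] of_real_eq_iff) (simp add: algebra_simps)
    finally show "- z * (of_real r * cnj z) + of_real b * of_real (r * (p - \<kappa>)) = of_real \<kappa> * of_real (r * (p - \<kappa>))"
      by simp
  qed
qed

text \<open>The nullity and the number of nonpositive eigenvalues of the matrix with rows
  \<open>(p, -cnj z)\<close> and \<open>(-z, b)\<close>.\<close>

definition nullity2 :: "real \<Rightarrow> complex \<Rightarrow> real \<Rightarrow> nat" where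
  "nullity2 p z b = (if p * b - (cmod z)\<^sup>2 \<noteq> 0 then 0 else if p = 0 \<and> b = 0 then 2 else 1)"

definition nonpos_index2 :: "real \<Rightarrow> complex \<Rightarrow> real \<Rightarrow> nat" where
  "nonpos_index2 p z b = (if p * b - (cmod z)\<^sup>2 < 0 then 1
     else if p * b - (cmod z)\<^sup>2 > 0 then (if p > 0 then 0 else 2)
     else if p + b > 0 then 1 else 2)"

lemma card_lessThan_two: "card {i. i < (2::nat) \<and> P i} = (if P 0 then 1 else 0) + (if P 1 then 1 else 0)"
proof -
  have "{i. i < (2::nat) \<and> P i} = {0, 1} \<inter> Collect P" by (auto dest: less_2_cases)
  then show ?thesis by (simp add: Int_insert_left)
qed

text \<open>Sum and product determine two numbers up to order, so their signs can be read off trace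
  and determinant. In the third equation a zero is counted both as nonnegative and as nonpositive,
  hence the nullity on the right.\<close>

lemma index2_eq:
  fixes \<kappa> :: "nat \<Rightarrow> real"
  assumes tr: "\<kappa> 0 + \<kappa> 1 = p + b" and det: "\<kappa> 0 * \<kappa> 1 = p * b - (cmod z)\<^sup>2"
  shows "card {i. i < (2::nat) \<and> \<kappa> i = 0} = nullity2 p z b"
    and "card {i. i < (2::nat) \<and> \<kappa> i \<le> 0} = nonpos_index2 p z b"
    and "card {i. i < (2::nat) \<and> \<kappa> i \<ge> 0} + nonpos_index2 p z b = 2 + nullity2 p z b"
proof -
  define d where "d = p * b - (cmod z)\<^sup>2"
  have pb: "p * b = d + (cmod z)\<^sup>2" by (simp add: d_def)
  \<comment> \<open>A singular Hermitian matrix of trace zero vanishes: here p * b is both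
    nonnegative and equal to - p * p.\<close>
  have d0: "p = 0 \<and> b = 0" if "d = 0" "p + b = 0"
  proof -
    have "b = - p" using that by simp
    moreover have "p * b \<ge> 0" using pb that by simp
    ultimately have "p * p \<le> 0" by simp
    then have "p * p = 0" using zero_le_square[of p] by linarith
    then show ?thesis using \<open>b = - p\<close> by auto
  qed
  have dpos: "(p > 0 \<and> b > 0) \<or> (p < 0 \<and> b < 0)" if "d > 0"
  proof -
    have "p * b > 0" unfolding pb using that by (simp add: add_pos_nonneg)
    then show ?thesis by (simp add: zero_less_mult_iff)
  qed
  have det': "\<kappa> 0 * \<kappa> 1 = d" using det by (simp add: d_def)
  consider (neg) "d < 0" | (pos) "d > 0" "p > 0" "b > 0" | (pos') "d > 0" "p < 0" "b < 0"
    | (C) "d = 0" "p = 0" "b = 0" | (r) "d = 0" "p + b > 0" | (l) "d = 0" "p + b < 0"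
    using dpos d0 by fastforce
  then have "card {i. i < (2::nat) \<and> \<kappa> i = 0} = nullity2 p z b \<and>
    card {i. i < (2::nat) \<and> \<kappa> i \<le> 0} = nonpos_index2 p z b \<and>
    card {i. i < (2::nat) \<and> \<kappa> i \<ge> 0} + nonpos_index2 p z b = 2 + nullity2 p z b"
  proof cases
    case neg
    then have "\<kappa> 0 * \<kappa> 1 < 0" using det' by simp
    then have "(\<kappa> 0 < 0 \<and> \<kappa> 1 > 0) \<or> (\<kappa> 0 > 0 \<and> \<kappa> 1 < 0)" by (simp add: mult_less_0_iff) blast
    then show ?thesis unfolding card_lessThan_two nullity2_def nonpos_index2_def d_def[symmetric] using neg by auto
  next
    case pos
    then have "\<kappa> 0 * \<kappa> 1 > 0" using det' by simp
    then have "\<kappa> 0 > 0 \<and> \<kappa> 1 > 0" using tr pos by (auto simp: zero_less_mult_iff)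
    then show ?thesis unfolding card_lessThan_two nullity2_def nonpos_index2_def d_def[symmetric] using pos by auto
  next
    case pos'
    then have "\<kappa> 0 * \<kappa> 1 > 0" using det' by simp
    then have "\<kappa> 0 < 0 \<and> \<kappa> 1 < 0" using tr pos' by (auto simp: zero_less_mult_iff)
    then show ?thesis unfolding card_lessThan_two nullity2_def nonpos_index2_def d_def[symmetric] using pos' by auto
  next
    case C
    then have "\<kappa> 1 = - \<kappa> 0" "\<kappa> 0 * \<kappa> 1 = 0" using tr det' by auto
    then have "\<kappa> 0 = 0 \<and> \<kappa> 1 = 0" by auto
    then show ?thesis unfolding card_lessThan_two nullity2_def nonpos_index2_def d_def[symmetric] using C by auto
  next
    case r
    then have "(\<kappa> 0 = 0 \<and> \<kappa> 1 > 0) \<or> (\<kappa> 0 > 0 \<and> \<kappa> 1 = 0)" using tr det' by auto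
    then show ?thesis unfolding card_lessThan_two nullity2_def nonpos_index2_def d_def[symmetric] using r by auto
  next
    case l
    then have "(\<kappa> 0 = 0 \<and> \<kappa> 1 < 0) \<or> (\<kappa> 0 < 0 \<and> \<kappa> 1 = 0)" using tr det' by auto
    then show ?thesis unfolding card_lessThan_two nullity2_def nonpos_index2_def d_def[symmetric] using l by auto
  qed
  then show "card {i. i < (2::nat) \<and> \<kappa> i = 0} = nullity2 p z b"
    and "card {i. i < (2::nat) \<and> \<kappa> i \<le> 0} = nonpos_index2 p z b"
    and "card {i. i < (2::nat) \<and> \<kappa> i \<ge> 0} + nonpos_index2 p z b = 2 + nullity2 p z b" by auto
qed


section \<open>The bordered pencil\<close>

text \<open>
  A sequence \<open>(y\<^sub>0, \<dots>, y\<^bsub>N+1\<^esub>)\<close> is encoded by \<open>x\<close> with \<open>x\<^sub>n = y\<^sub>n\<close> for \<open>1 \<le> n \<le> N\<close>, \<open>x\<^sub>0 = f\<^sub>0 \<Delta>y\<^sub>0\<close> and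
  \<open>x\<^bsub>N+1\<^esub> = - f\<^sub>N \<Delta>y\<^sub>N\<close>.  In these variables the problem with boundary condition \<open>(a, z, b)\<close> is
  a Hermitian matrix pencil bordered by the matrix \<open>Q\<close> with rows \<open>(p, -cnj z)\<close>, \<open>(-z, b)\<close>, where
  \<open>p = a - 1/f\<^sub>0\<close>, so that \<open>det Q = d(a, z, b)\<close>.
\<close>

lemma summation_by_parts:
  fixes g v :: "nat \<Rightarrow> complex"
  assumes "N \<ge> 1"
  shows "(\<Sum>n=1..N. - (g n - g (n - 1)) * v n) = (\<Sum>n=1..<N. g n * (v (n + 1) - v n)) + g 0 * v 1 - g N * v N"
  using assms
proof (induction N rule: dec_induct)
  case (step N)
  then have "{1..<Suc N} = insert N {1..<N}" by auto
  then show ?case using step by (simp add: algebra_simps)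
qed (simp add: algebra_simps)

locale sl_problem =
  fixes N :: nat and \<omega> :: sl_equation
  assumes N2: "N \<ge> 2" and Omega: "\<omega> \<in> Omega N"
begin

abbreviation f where "f \<equiv> coeff_f \<omega>"
abbreviation q where "q \<equiv> coeff_q \<omega>"
abbreviation w where "w \<equiv> coeff_w \<omega>"

lemma f_nonzero: "n \<le> N \<Longrightarrow> f n \<noteq> 0"
  using Omega by (auto simp: Omega_def coeff_f_def)

lemma w_pos: "1 \<le> n \<Longrightarrow> n \<le> N \<Longrightarrow> w n > 0"
  using Omega by (auto simp: Omega_def coeff_w_def)

text \<open>The terms outside the sums couple \<open>x 0\<close> with \<open>x 1\<close> and
  \<open>x (N + 1)\<close> with \<open>x N\<close>: they are the boundary terms of summation by
  parts and their mirror images. Neither \<open>f 0\<close> nor \<open>f N\<close> occurs: the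
  former is absorbed in p, the latter only relates \<open>x (N + 1)\<close> to the last entry of
  y.\<close>

definition S_form :: "(nat \<Rightarrow> complex) \<Rightarrow> (nat \<Rightarrow> complex) \<Rightarrow> complex" where
  "S_form x v = (\<Sum>n=1..<N. of_real (f n) * (x (n + 1) - x n) * cnj (v (n + 1) - v n))
     + (\<Sum>n=1..N. of_real (q n) * x n * cnj (v n))
     + x 0 * cnj (v 1) + x (N + 1) * cnj (v N) + x 1 * cnj (v 0) + x N * cnj (v (N + 1))"

definition W_form :: "(nat \<Rightarrow> complex) \<Rightarrow> (nat \<Rightarrow> complex) \<Rightarrow> complex" where
  "W_form x v = (\<Sum>n=1..N. of_real (w n) * x n * cnj (v n))"

definition Q_form :: "real \<Rightarrow> complex \<Rightarrow> real \<Rightarrow> (nat \<Rightarrow> complex) \<Rightarrow> (nat \<Rightarrow> complex) \<Rightarrow> complex" where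
  "Q_form p z b x v = (of_real p * x 0 - cnj z * x (N + 1)) * cnj (v 0)
     + (- z * x 0 + of_real b * x (N + 1)) * cnj (v (N + 1))"

definition T_form :: "(nat \<Rightarrow> complex) \<Rightarrow> (nat \<Rightarrow> complex) \<Rightarrow> complex" where
  "T_form x v = x 0 * cnj (v 0) + x (N + 1) * cnj (v (N + 1))"

definition H_form :: "real \<Rightarrow> complex \<Rightarrow> real \<Rightarrow> (nat \<Rightarrow> complex) \<Rightarrow> (nat \<Rightarrow> complex) \<Rightarrow> complex" where
  "H_form p z b x v = S_form x v + Q_form p z b x v"

definition M_form :: "real \<Rightarrow> complex \<Rightarrow> real \<Rightarrow> real \<Rightarrow> (nat \<Rightarrow> complex) \<Rightarrow> (nat \<Rightarrow> complex) \<Rightarrow> complex" where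
  "M_form p z b \<mu> x v = H_form p z b x v - of_real \<mu> * W_form x v"

lemma hermitian_W: "hermitian_form W_form"
proof
  show "W_form (\<lambda>n. c * x n + y n) v = c * W_form x v + W_form y v" for c x y v
    by (simp add: W_form_def algebra_simps sum.distrib sum_distrib_left)
  show "W_form y x = cnj (W_form x y)" for x y
    by (simp add: W_form_def mult_ac)
qed (auto simp: W_form_def intro!: continuous_intros)

lemma hermitian_T: "hermitian_form T_form"
proof
  show "T_form (\<lambda>n. c * x n + y n) v = c * T_form x v + T_form y v" for c x y v
    by (simp add: T_form_def algebra_simps)
  show "T_form y x = cnj (T_form x y)" for x y
    by (simp add: T_form_def mult_ac)
qed (auto simp: T_form_def intro!: continuous_intros)

lemma hermitian_H: "hermitian_form (H_form p z b)"
proof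
  show "H_form p z b (\<lambda>n. c * x n + y n) v = c * H_form p z b x v + H_form p z b y v" for c x y v
    unfolding H_form_def S_form_def Q_form_def
    by (simp add: sum_distrib_left sum.distrib[symmetric] algebra_simps)
  show "H_form p z b y x = cnj (H_form p z b x y)" for x y
    by (simp add: H_form_def S_form_def Q_form_def algebra_simps)
qed (auto simp: H_form_def S_form_def Q_form_def intro!: continuous_intros)

lemma hermitian_M: "hermitian_form (M_form p z b \<mu>)"
  unfolding M_form_def[abs_def] by (rule hermitian_diff[OF hermitian_H hermitian_W])

sublocale W: hermitian_form W_form by (rule hermitian_W)
sublocale T: hermitian_form T_form by (rule hermitian_T)
sublocale H: hermitian_form "H_form p z b" for p z b by (rule hermitian_H)
sublocale M: hermitian_form "M_form p z b \<mu>" for p z b \<mu> by (rule hermitian_M)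

section \<open>Weak and strong form of the boundary value problem\<close>

definition flux :: "(nat \<Rightarrow> complex) \<Rightarrow> nat \<Rightarrow> complex" where
  "flux x n = (if n = 0 then x 0 else if n = N then - x (N + 1) else of_real (f n) * (x (n + 1) - x n))"

definition residual :: "(nat \<Rightarrow> complex) \<Rightarrow> nat \<Rightarrow> complex" where
  "residual x n = - (flux x n - flux x (n - 1)) + of_real (q n) * x n"

text \<open>Summation by parts turns the symmetric form into the equation and the two boundary
  conditions, tested against v. Solving the problem thus means H = \<mu> W against all test vectors,
  which \<open>solution_form\<close> and \<open>solutionI\<close> exploit.\<close>

lemma H_form_residual:
  "H_form p z b x v = (\<Sum>n=1..N. residual x n * cnj (v n))
     + (x 1 + of_real p * x 0 - cnj z * x (N + 1)) * cnj (v 0)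
     + (x N - z * x 0 + of_real b * x (N + 1)) * cnj (v (N + 1))"
proof -
  have "(\<Sum>n=1..N. - (flux x n - flux x (n - 1)) * cnj (v n))
      = (\<Sum>n=1..<N. flux x n * (cnj (v (n + 1)) - cnj (v n))) + flux x 0 * cnj (v 1) - flux x N * cnj (v N)"
    using N2 by (intro summation_by_parts) auto
  also have "(\<Sum>n=1..<N. flux x n * (cnj (v (n + 1)) - cnj (v n)))
      = (\<Sum>n=1..<N. of_real (f n) * (x (n + 1) - x n) * cnj (v (n + 1) - v n))"
    by (intro sum.cong) (auto simp: flux_def)
  finally have "(\<Sum>n=1..N. - (flux x n - flux x (n - 1)) * cnj (v n))
      = (\<Sum>n=1..<N. of_real (f n) * (x (n + 1) - x n) * cnj (v (n + 1) - v n)) + x 0 * cnj (v 1) + x (N + 1) * cnj (v N)"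
    using N2 by (simp add: flux_def)
  moreover have "(\<Sum>n=1..N. residual x n * cnj (v n))
      = (\<Sum>n=1..N. - (flux x n - flux x (n - 1)) * cnj (v n)) + (\<Sum>n=1..N. of_real (q n) * x n * cnj (v n))"
    unfolding residual_def sum.distrib[symmetric] by (simp add: distrib_right)
  ultimately show ?thesis
    by (simp add: H_form_def S_form_def Q_form_def algebra_simps)
qed

text \<open>The parameter \<mu> is complex, so that reality of the eigenvalues is a result and not
  built in.\<close>

definition solution :: "real \<Rightarrow> complex \<Rightarrow> real \<Rightarrow> complex \<Rightarrow> (nat \<Rightarrow> complex) \<Rightarrow> bool" where
  "solution p z b \<mu> x \<longleftrightarrow> (\<forall>n\<in>{1..N}. residual x n = \<mu> * of_real (w n) * x n)
     \<and> x 1 + of_real p * x 0 - cnj z * x (N + 1) = 0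
     \<and> x N - z * x 0 + of_real b * x (N + 1) = 0"

lemma solution_form: "solution p z b \<mu> x \<Longrightarrow> H_form p z b x v = \<mu> * W_form x v"
  unfolding H_form_residual W_form_def solution_def sum_distrib_left by (simp add: mult_ac)

definition unit_vec :: "nat \<Rightarrow> nat \<Rightarrow> complex" where
  "unit_vec k = (\<lambda>n. if n = k then 1 else 0)"

lemma unit_vec_vecs: "k < m \<Longrightarrow> unit_vec k \<in> vecs m"
  by (auto simp: unit_vec_def vecs_def)

lemma sum_unit_vec:
  "(\<Sum>n=1..N. g n * cnj (unit_vec k n)) = (if k \<in> {1..N} then g k else 0)"
proof -
  have "(\<Sum>n=1..N. g n * cnj (unit_vec k n)) = (\<Sum>n=1..N. if n = k then g k else 0)"
    by (rule sum.cong) (auto simp: unit_vec_def)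
  then show ?thesis by simp
qed

lemma H_form_unit:
  "1 \<le> k \<Longrightarrow> k \<le> N \<Longrightarrow> H_form p z b x (unit_vec k) = residual x k"
  "H_form p z b x (unit_vec 0) = x 1 + of_real p * x 0 - cnj z * x (N + 1)"
  "H_form p z b x (unit_vec (N + 1)) = x N - z * x 0 + of_real b * x (N + 1)"
  unfolding H_form_residual sum_unit_vec by (auto simp: unit_vec_def)

lemma W_form_unit: "W_form x (unit_vec k) = (if k \<in> {1..N} then of_real (w k) * x k else 0)"
  unfolding W_form_def sum_unit_vec by simp

lemma solutionI:
  assumes "\<And>v. v \<in> vecs (N + 2) \<Longrightarrow> H_form p z b x v = \<mu> * W_form x v"
  shows "solution p z b \<mu> x"
  unfolding solution_def
proof (intro conjI ballI)
  show "residual x n = \<mu> * of_real (w n) * x n" if "n \<in> {1..N}" for n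
    using assms[OF unit_vec_vecs[of n]] that by (simp add: H_form_unit W_form_unit)
  show "x 1 + of_real p * x 0 - cnj z * x (N + 1) = 0"
    using assms[OF unit_vec_vecs[of 0]] by (simp add: H_form_unit W_form_unit)
  show "x N - z * x 0 + of_real b * x (N + 1) = 0"
    using assms[OF unit_vec_vecs[of "N + 1"]] by (simp add: H_form_unit(3)[simplified] W_form_unit)
qed

lemma W_form_diag: "W_form x x = of_real (\<Sum>n=1..N. w n * (cmod (x n))\<^sup>2)"
  unfolding W_form_def of_real_sum
  by (rule sum.cong) (simp_all add: complex_norm_square[symmetric] mult.assoc)

lemma W_form_zero_iff: "W_form x x = 0 \<longleftrightarrow> (\<forall>n\<in>{1..N}. x n = 0)"
proof -
  have "0 \<le> w n * (cmod (x n))\<^sup>2" if "n \<in> {1..N}" for n using w_pos[of n] that by simp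
  then have "W_form x x = 0 \<longleftrightarrow> (\<forall>n\<in>{1..N}. w n * (cmod (x n))\<^sup>2 = 0)"
    unfolding W_form_diag of_real_eq_0_iff by (intro sum_nonneg_eq_0_iff) auto
  also have "\<dots> \<longleftrightarrow> (\<forall>n\<in>{1..N}. x n = 0)" using w_pos by force
  finally show ?thesis .
qed

lemma W_form_nonneg: "Re (W_form x x) \<ge> 0"
  unfolding W_form_diag Re_complex_of_real by (intro sum_nonneg) (simp add: w_pos less_imp_le)

lemma W_form_null: "(\<And>n. n \<in> {1..N} \<Longrightarrow> x n = 0) \<Longrightarrow> W_form x v = 0" "(\<And>n. n \<in> {1..N} \<Longrightarrow> x n = 0) \<Longrightarrow> W_form v x = 0"
  by (simp_all add: W_form_def)

text \<open>If the inner entries vanish, so do the inner fluxes, and the equations at 1 and N then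
  annihilate the two border entries. Hence W, though only semidefinite, detects every nonzero
  solution.\<close>

lemma solution_zero:
  assumes "solution p z b \<mu> x" "x \<in> vecs (N + 2)" and y: "\<And>n. n \<in> {1..N} \<Longrightarrow> x n = 0"
  shows "x = 0"
proof -
  have r: "residual x n = 0" if "n \<in> {1..N}" for n using assms that by (simp add: solution_def)
  have "flux x n = 0" if "n \<in> {1..<N}" for n using y[of n] y[of "n + 1"] that by (simp add: flux_def)
  then have fl: "flux x 1 = 0" "flux x (N - 1) = 0" using N2 by auto
  have "x 0 = 0" using r[of 1] fl(1) y[of 1] N2 by (simp add: residual_def flux_def)
  moreover have "x (N + 1) = 0" using r[of N] fl(2) y[of N] N2 by (simp add: residual_def flux_def[of x N])
  ultimately have "x n = 0" for n
    using y[of n] assms(2) by (cases "n = 0"; cases "n = N + 1"; cases "n \<le> N") (auto simp: vecs_def)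
  then show ?thesis by (simp add: fun_eq_iff)
qed

text \<open>An orthonormal eigenbasis of Q, carried by the entries 0 and N + 1. Trace and
  determinant are recorded because \<open>index2_eq\<close> obtains the signs of \<kappa> from
  them.\<close>

definition diagonalises :: "real \<Rightarrow> complex \<Rightarrow> real \<Rightarrow> (nat \<Rightarrow> nat \<Rightarrow> complex) \<Rightarrow> (nat \<Rightarrow> real) \<Rightarrow> bool" where
  "diagonalises p z b e \<kappa> \<longleftrightarrow>
     (\<forall>i. e i \<in> vecs (N + 2) \<and> (\<forall>n\<in>{1..N}. e i n = 0)) \<and>
     (\<forall>i<2. \<forall>v. Q_form p z b (e i) v = of_real (\<kappa> i) * T_form (e i) v) \<and>
     (\<forall>i<2. \<forall>j<2. T_form (e i) (e j) = (if i = j then 1 else 0)) \<and>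
     (\<forall>x. \<forall>n\<in>{0, N + 1}. x n = (\<Sum>i<2. T_form x (e i) * e i n)) \<and>
     \<kappa> 0 + \<kappa> 1 = p + b \<and> \<kappa> 0 * \<kappa> 1 = p * b - (cmod z)\<^sup>2"

lemma diagonalisesD:
  assumes "diagonalises p z b e \<kappa>"
  shows "e i \<in> vecs (N + 2)" "n \<in> {1..N} \<Longrightarrow> e i n = 0"
    "i < 2 \<Longrightarrow> Q_form p z b (e i) v = of_real (\<kappa> i) * T_form (e i) v"
    "i < 2 \<Longrightarrow> j < 2 \<Longrightarrow> T_form (e i) (e j) = (if i = j then 1 else 0)"
    "m \<in> {0, N + 1} \<Longrightarrow> x m = (\<Sum>i<2. T_form x (e i) * e i m)"
    "\<kappa> 0 + \<kappa> 1 = p + b" "\<kappa> 0 * \<kappa> 1 = p * b - (cmod z)\<^sup>2"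
proof -
  note * = assms[unfolded diagonalises_def]
  note **[rule_format] = *[THEN conjunct1] *[THEN conjunct2, THEN conjunct1]
    *[THEN conjunct2, THEN conjunct2, THEN conjunct1]
    *[THEN conjunct2, THEN conjunct2, THEN conjunct2, THEN conjunct1]
  show "e i \<in> vecs (N + 2)" using **(1) by blast
  show "n \<in> {1..N} \<Longrightarrow> e i n = 0" using **(1) by blast
  show "i < 2 \<Longrightarrow> Q_form p z b (e i) v = of_real (\<kappa> i) * T_form (e i) v" by (rule **(2))
  show "i < 2 \<Longrightarrow> j < 2 \<Longrightarrow> T_form (e i) (e j) = (if i = j then 1 else 0)" by (rule **(3))
  show "m \<in> {0, N + 1} \<Longrightarrow> x m = (\<Sum>i<2. T_form x (e i) * e i m)" by (rule **(4))
  show "\<kappa> 0 + \<kappa> 1 = p + b" "\<kappa> 0 * \<kappa> 1 = p * b - (cmod z)\<^sup>2"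
    using *[THEN conjunct2, THEN conjunct2, THEN conjunct2, THEN conjunct2] by (rule conjunct1 conjunct2)+
qed

lemma diagonalisation_exists: "\<exists>e \<kappa>. diagonalises p z b e \<kappa>"
proof -
  obtain \<kappa>0 \<alpha> \<beta> where 1: "(cmod \<alpha>)\<^sup>2 + (cmod \<beta>)\<^sup>2 = 1"
    "of_real p * \<alpha> - cnj z * \<beta> = of_real \<kappa>0 * \<alpha>"
    "- z * \<alpha> + of_real b * \<beta> = of_real \<kappa>0 * \<beta>"
    "\<kappa>0 * (p + b - \<kappa>0) = p * b - (cmod z)\<^sup>2"
    by (rule hermitian_2x2_eigenvector)
  have ab: "\<alpha> * cnj \<alpha> + \<beta> * cnj \<beta> = 1" "cnj \<alpha> * \<alpha> + cnj \<beta> * \<beta> = 1"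
    using 1(1) by (simp_all add: complex_norm_square[symmetric] mult.commute[of "cnj _"]) (metis of_real_1 of_real_add of_real_power)+
  define \<kappa> where "\<kappa> = (\<lambda>i::nat. if i = 0 then \<kappa>0 else p + b - \<kappa>0)"
  define e where "e = (\<lambda>i n. if n = 0 then (if i = (0::nat) then \<alpha> else - cnj \<beta>)
     else if n = N + 1 then (if i = 0 then \<beta> else cnj \<alpha>) else 0)"
  \<comment> \<open>The second eigenvector is (- cnj \<beta>, cnj \<alpha>); its two equations
    follow from those of the first by conjugation.\<close>
  have 2: "of_real p * (- cnj \<beta>) - cnj z * cnj \<alpha> = of_real (p + b - \<kappa>0) * (- cnj \<beta>)"
    using arg_cong[OF 1(3), of cnj] by (simp add: algebra_simps)
  have 3: "- z * (- cnj \<beta>) + of_real b * cnj \<alpha> = of_real (p + b - \<kappa>0) * cnj \<alpha>"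
    using arg_cong[OF 1(2), of cnj] by (simp add: algebra_simps)
  have "diagonalises p z b e \<kappa>"
    unfolding diagonalises_def
  proof (intro conjI allI ballI impI)
    show "e i \<in> vecs (N + 2)" for i by (auto simp: e_def vecs_def)
    show "e i n = 0" if "n \<in> {1..N}" for i n using that by (auto simp: e_def)
    show "Q_form p z b (e i) v = of_real (\<kappa> i) * T_form (e i) v" if "i < 2" for i v
    proof (cases "i = 0")
      case True
      have "Q_form p z b (e i) v = (of_real p * \<alpha> - cnj z * \<beta>) * cnj (v 0) + (- z * \<alpha> + of_real b * \<beta>) * cnj (v (N + 1))"
        using True by (simp add: Q_form_def e_def)
      then show ?thesis unfolding 1 using True by (simp add: T_form_def e_def \<kappa>_def algebra_simps)
    next
      case False
      have "Q_form p z b (e i) v = (of_real p * (- cnj \<beta>) - cnj z * cnj \<alpha>) * cnj (v 0)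
          + (- z * (- cnj \<beta>) + of_real b * cnj \<alpha>) * cnj (v (N + 1))"
        using False by (simp add: Q_form_def e_def)
      then show ?thesis unfolding 2 3 using False by (simp add: T_form_def e_def \<kappa>_def algebra_simps)
    qed
    show "T_form (e i) (e j) = (if i = j then 1 else 0)" if "i < 2" "j < 2" for i j
      using that ab by (auto simp: T_form_def e_def mult_ac add_ac dest!: less_2_cases)
    show "x n = (\<Sum>i<2. T_form x (e i) * e i n)" if "n \<in> {0, N + 1}" for x n
    proof -
      have "(\<Sum>i<2. T_form x (e i) * e i 0) = x 0 * (\<alpha> * cnj \<alpha> + \<beta> * cnj \<beta>)"
        by (simp add: numeral_2_eq_2 T_form_def e_def algebra_simps)
      moreover have "(\<Sum>i<2. T_form x (e i) * e i (N + 1)) = x (N + 1) * (\<alpha> * cnj \<alpha> + \<beta> * cnj \<beta>)"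
        by (simp add: numeral_2_eq_2 T_form_def e_def algebra_simps)
      ultimately show ?thesis using that ab by auto
    qed
    show "\<kappa> 0 + \<kappa> 1 = p + b" "\<kappa> 0 * \<kappa> 1 = p * b - (cmod z)\<^sup>2"
      using 1(4) by (simp_all add: \<kappa>_def)
  qed
  then show ?thesis by blast
qed

text \<open>Completeness is demanded for every complex \<nu>; together with the orthogonality of
  solutions for different parameters this makes all eigenvalues real.\<close>

definition eigensystem :: "real \<Rightarrow> complex \<Rightarrow> real \<Rightarrow> nat \<Rightarrow> (nat \<Rightarrow> nat \<Rightarrow> complex) \<Rightarrow> (nat \<Rightarrow> real) \<Rightarrow> bool" where
  "eigensystem p z b k x \<mu> \<longleftrightarrow>
     (\<forall>i<k. x i \<in> vecs (N + 2) \<and> solution p z b (of_real (\<mu> i)) (x i)) \<and>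
     (\<forall>i<k. \<forall>j<k. W_form (x i) (x j) = (if i = j then 1 else 0)) \<and>
     (\<forall>j<k. \<forall>i\<le>j. \<mu> i \<le> \<mu> j) \<and>
     (\<forall>\<nu> v. solution p z b \<nu> v \<longrightarrow> v \<in> vecs (N + 2) \<longrightarrow> (\<forall>i<k. W_form v (x i) = 0) \<longrightarrow> v = 0)"

lemma eigensystemD:
  assumes "eigensystem p z b k x \<mu>"
  shows "i < k \<Longrightarrow> x i \<in> vecs (N + 2)" "i < k \<Longrightarrow> solution p z b (of_real (\<mu> i)) (x i)"
    "i < k \<Longrightarrow> j < k \<Longrightarrow> W_form (x i) (x j) = (if i = j then 1 else 0)"
    "i \<le> j \<Longrightarrow> j < k \<Longrightarrow> \<mu> i \<le> \<mu> j"
    "solution p z b \<nu> v \<Longrightarrow> v \<in> vecs (N + 2) \<Longrightarrow> (\<And>i. i < k \<Longrightarrow> W_form v (x i) = 0) \<Longrightarrow> v = 0"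
  using assms by (auto simp: eigensystem_def)

text \<open>The spectral theorem is applied on the space of those \<open>x\<close> which satisfy the boundary condition
  and whose outer part is orthogonal to the kernel of \<open>Q\<close>: there the weight form is definite.  The
  components along the kernel are restored afterwards.\<close>

lemma eigensystem_exists:
  obtains k x \<mu> where "eigensystem p z b k x \<mu>" "N \<le> k + nullity2 p z b"
proof -
  obtain e \<kappa> where "diagonalises p z b e \<kappa>" using diagonalisation_exists by blast
  note ev = diagonalisesD(1)[OF this] and e0 = diagonalisesD(2)[OF this] and eQ = diagonalisesD(3)[OF this]
    and eT = diagonalisesD(4)[OF this] and edec = diagonalisesD(5)[OF this]
    and tr = diagonalisesD(6)[OF this] and det = diagonalisesD(7)[OF this]
  define r0 where "r0 = (\<lambda>x. H_form p z b x (unit_vec 0))"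
  define r1 where "r1 = (\<lambda>x. H_form p z b x (unit_vec (N + 1)))"
  define V where "V = {v \<in> vecs (N + 2). r0 v = 0 \<and> r1 v = 0 \<and> (\<forall>i\<in>{i. i < 2 \<and> \<kappa> i = 0}. T_form v (e i) = 0)}"
  have Qrows: "Q_form p z b x v = (of_real p * x 0 - cnj z * x (N + 1)) * cnj (v 0)
     + (- z * x 0 + of_real b * x (N + 1)) * cnj (v (N + 1))" for x v by (simp add: Q_form_def)
  have Vsub: "seq.subspace V"
    by (rule subspace_intro)
       (auto simp: V_def r0_def r1_def H.lin T.lin subspace_lin[OF subspace_vecs] seq.subspace_0[OF subspace_vecs])
  have Vclosed: "closed V"
  proof -
    have "V = vecs (N + 2) \<inter> {v. r0 v = 0} \<inter> {v. r1 v = 0} \<inter> (\<Inter>i\<in>{i. i < 2 \<and> \<kappa> i = 0}. {v. T_form v (e i) = 0})"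
      by (auto simp: V_def)
    moreover have "closed {v. r0 v = 0}" "closed {v. r1 v = 0}" "closed {v. T_form v (e i) = 0}" for i
      unfolding r0_def r1_def by (intro closed_Collect_eq H.cont T.cont continuous_on_const)+
    ultimately show ?thesis by (metis (no_types, lifting) closed_vecs closed_Int closed_INT)
  qed
  \<comment> \<open>With \<open>x 1 = 0\<close> and \<open>x N = 0\<close> the boundary conditions
    say that the border part lies in the kernel of Q, so it is orthogonal to the eigenvectors with
    \<open>\<kappa> i \<noteq> 0\<close>.\<close>
  have ker: "T_form x (e i) = 0" if "i < 2" "\<kappa> i \<noteq> 0" "x N = 0" "x 1 = 0" "r0 x = 0" "r1 x = 0" for x i
  proof -
    have "Q_form p z b x (e i) = 0" using that by (simp add: Qrows r0_def r1_def H_form_unit(2) H_form_unit(3)[simplified])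
    moreover have "Q_form p z b x (e i) = cnj (Q_form p z b (e i) x)"
      by (simp add: Qrows algebra_simps)
    moreover have "cnj (Q_form p z b (e i) x) = of_real (\<kappa> i) * T_form x (e i)"
      using eQ[OF that(1), of x] by (simp add: T.sym[of x "e i"])
    ultimately show ?thesis using that by simp
  qed
  have Wpos: "Re (W_form x x) > 0" if "x \<in> V" "x \<noteq> 0" for x
  proof (rule ccontr)
    assume "\<not> Re (W_form x x) > 0"
    then have "W_form x x = 0" using W_form_nonneg[of x] by (subst W.diag_real) simp
    then have y: "x n = 0" if "n \<in> {1..N}" for n using that W_form_zero_iff by auto
    have "T_form x (e i) = 0" if "i < 2" for i
      using that \<open>x \<in> V\<close> ker[of i x] y N2 by (cases "\<kappa> i = 0") (auto simp: V_def)
    then have "x 0 = 0" "x (N + 1) = 0" using edec[of _ x] by auto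
    then have "x n = 0" for n
      using y[of n] that by (cases "n = 0"; cases "n = N + 1"; cases "n \<le> N") (auto simp: vecs_def V_def)
    then show False using \<open>x \<noteq> 0\<close> by (simp add: fun_eq_iff)
  qed
  obtain k :: nat and x \<mu> where xV: "\<And>i. i < k \<Longrightarrow> x i \<in> V"
    and orth: "\<And>i j. i < k \<Longrightarrow> j < k \<Longrightarrow> W_form (x i) (x j) = (if i = j then 1 else 0)"
    and eig: "\<And>i v. i < k \<Longrightarrow> v \<in> V \<Longrightarrow> H_form p z b (x i) v = of_real (\<mu> i) * W_form (x i) v"
    and mono: "\<And>i j. i \<le> j \<Longrightarrow> j < k \<Longrightarrow> \<mu> i \<le> \<mu> j"
    and compl: "\<And>v. v \<in> V \<Longrightarrow> (\<And>i. i < k \<Longrightarrow> W_form v (x i) = 0) \<Longrightarrow> v = 0"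
    by (rule spectral_theorem[OF hermitian_H[of p z b] hermitian_W Vsub Vclosed _ Wpos, of "N + 2"])
       (auto simp: V_def)
  define Z where "Z = {i. i < 2 \<and> \<kappa> i = 0}"
  have cardZ: "card Z = nullity2 p z b" unfolding Z_def by (rule index2_eq(1)[OF tr det])
  have "finite Z" by (simp add: Z_def)
  \<comment> \<open>V is cut out of \<complex>^(N + 2) by two boundary conditions and
    \<open>card Z\<close> orthogonality conditions; W-orthogonality to the k vectors adds k more. By
    completeness only 0 satisfies them all, so there are at least N + 2 conditions.\<close>
  have dim: "N \<le> k + card Z"
  proof (rule ccontr)
    assume less: "\<not> N \<le> k + card Z"
    define \<Psi> where "\<Psi> = {\<lambda>n. r0 (unit_vec n), \<lambda>n. r1 (unit_vec n)}
      \<union> (\<lambda>i n. T_form (unit_vec n) (e i)) ` Z \<union> (\<lambda>i n. W_form (unit_vec n) (x i)) ` {..<k}"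
    have "card \<Psi> \<le> 2 + card Z + k"
    proof -
      have "card {\<lambda>n. r0 (unit_vec n), \<lambda>n. r1 (unit_vec n)} \<le> 2"
        by (metis card_2_iff card.insert_remove card_insert_le_m1 numeral_2_eq_2 card.empty le_SucI diff_Suc_1 finite.emptyI
            card_insert_if order_refl finite.insertI empty_iff)
      moreover have "card ((\<lambda>i n. T_form (unit_vec n) (e i)) ` Z) \<le> card Z"
        by (rule card_image_le) fact
      moreover have "card ((\<lambda>i n. W_form (unit_vec n) (x i)) ` {..<k}) \<le> k"
        using card_image_le[of "{..<k}"] by auto
      ultimately show ?thesis unfolding \<Psi>_def
        by (intro order.trans[OF card_Un_le] add_mono) auto
    qed
    then have "card \<Psi> < card {..<N + 2}" using less by simp
    moreover have "finite \<Psi>" using \<open>finite Z\<close> by (simp add: \<Psi>_def)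
    ultimately obtain c where c: "\<exists>n<N + 2. c n \<noteq> 0" "\<And>\<psi>. \<psi> \<in> \<Psi> \<Longrightarrow> (\<Sum>n<N + 2. c n * \<psi> n) = 0"
      using homogeneous_system[of \<Psi> "{..<N + 2}"] by auto
    define v where "v = lincomb c unit_vec {..<N + 2}"
    have vv: "v \<in> vecs (N + 2)" unfolding v_def by (rule lincomb_vecs) (auto intro: unit_vec_vecs)
    have "r0 v = 0" unfolding v_def r0_def H.lincomb using c(2)[of "\<lambda>n. r0 (unit_vec n)"] by (simp add: \<Psi>_def r0_def)
    moreover have "r1 v = 0" unfolding v_def r1_def H.lincomb using c(2)[of "\<lambda>n. r1 (unit_vec n)"] by (simp add: \<Psi>_def r1_def)
    moreover have "T_form v (e i) = 0" if "i \<in> Z" for i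
      unfolding v_def T.lincomb using c(2)[of "\<lambda>n. T_form (unit_vec n) (e i)"] that by (simp add: \<Psi>_def)
    ultimately have "v \<in> V" using vv by (auto simp: V_def Z_def)
    moreover have "W_form v (x i) = 0" if "i < k" for i
      unfolding v_def W.lincomb using c(2)[of "\<lambda>n. W_form (unit_vec n) (x i)"] that by (simp add: \<Psi>_def)
    ultimately have "v = 0" by (rule compl)
    have "v n = c n" if "n < N + 2" for n
    proof -
      have "v n = (\<Sum>i<N + 2. if i = n then c i else 0)"
        unfolding v_def lincomb_def by (rule sum.cong) (auto simp: unit_vec_def)
      then show ?thesis using that by simp
    qed
    then show False using c(1) \<open>v = 0\<close> by auto
  qed
  have rows: "of_real p * e i 0 - cnj z * e i (N + 1) = of_real (\<kappa> i) * e i 0"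
      "- z * e i 0 + of_real b * e i (N + 1) = of_real (\<kappa> i) * e i (N + 1)" if "i < 2" for i
    using eQ[OF that, of "unit_vec 0"] eQ[OF that, of "unit_vec (N + 1)"]
    by (auto simp: Q_form_def T_form_def unit_vec_def)
  have r0_eq: "r0 v = v 1 + (of_real p * v 0 - cnj z * v (N + 1))"
    and r1_eq: "r1 v = v N + (- z * v 0 + of_real b * v (N + 1))" for v
    by (simp_all add: r0_def r1_def H_form_unit(2) H_form_unit(3)[simplified])
  \<comment> \<open>The defect of the equation. Only test vectors from V are available, so it may
    survive at 1 and N, where the unit vectors violate the boundary conditions.\<close>
  define \<rho> where "\<rho> = (\<lambda>i n. residual (x i) n - of_real (\<mu> i * w n) * x i n)"
  have \<rho>: "(\<Sum>n=1..N. \<rho> i n * cnj (v n)) = 0" if "i < k" "v \<in> V" for i v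
  proof -
    have "H_form p z b (x i) v = (\<Sum>n=1..N. residual (x i) n * cnj (v n))"
      using xV[OF that(1)] unfolding H_form_residual
      by (simp add: V_def r0_def r1_def H_form_unit(2) H_form_unit(3)[simplified])
    moreover have "(\<Sum>n=1..N. \<rho> i n * cnj (v n))
        = (\<Sum>n=1..N. residual (x i) n * cnj (v n)) - of_real (\<mu> i) * W_form (x i) v"
      unfolding \<rho>_def W_form_def sum_distrib_left sum_subtractf[symmetric]
      by (rule sum.cong) (simp_all add: algebra_simps)
    ultimately show ?thesis using eig[OF that] by simp
  qed
  have \<rho>_inner: "\<rho> i n = 0" if "i < k" "1 < n" "n < N" for i n
  proof -
    have "unit_vec n \<in> V" using that by (auto simp: V_def r0_eq r1_eq T_form_def unit_vec_def vecs_def)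
    from \<rho>[OF that(1) this, unfolded sum_unit_vec] show ?thesis using that by simp
  qed
  \<comment> \<open>The defect at 1 and N, moved to the border: subtracting t shifts the fluxes at 0
    and N so as to cancel it. For the boundary conditions to persist, t has to lie in the kernel of
    Q.\<close>
  define t where "t = (\<lambda>i n. if n = 0 then \<rho> i 1 else if n = N + 1 then \<rho> i N else 0)"
  have t_orth: "T_form (t i) (e j) = 0" if i: "i < k" and j: "j < 2" "\<kappa> j \<noteq> 0" for i j
  proof -
    \<comment> \<open>A test vector with \<open>e j\<close> at the inner ends and
      \<open>- e j / \<kappa> j\<close> at the border: Q maps the border part to minus the inner
      ends, so both boundary conditions hold.\<close>
    define v where "v = (\<lambda>n. if n = 1 then e j 0 else if n = N then e j (N + 1) else - (1 / of_real (\<kappa> j)) * e j n)"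
    have "T_form v (e l) = - (1 / of_real (\<kappa> j)) * T_form (e j) (e l)" for l
      using N2 by (simp add: v_def T_form_def algebra_simps)
    then have "T_form v (e l) = 0" if "l < 2" "\<kappa> l = 0" for l
      using eT[OF j(1) that(1)] that j by auto
    moreover have "r0 v = 0"
    proof -
      have "r0 v = e j 0 - (1 / of_real (\<kappa> j)) * (of_real p * e j 0 - cnj z * e j (N + 1))"
        using N2 by (simp add: r0_eq v_def algebra_simps)
      then show ?thesis unfolding rows[OF j(1)] using j by simp
    qed
    moreover have "r1 v = 0"
    proof -
      have "r1 v = e j (N + 1) - (1 / of_real (\<kappa> j)) * (- z * e j 0 + of_real b * e j (N + 1))"
        using N2 by (simp add: r1_eq v_def algebra_simps)
      then show ?thesis unfolding rows[OF j(1)] using j by simp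
    qed
    moreover have "v \<in> vecs (N + 2)" using ev[of j] by (auto simp: v_def vecs_def)
    ultimately have "v \<in> V" by (auto simp: V_def)
    then have "0 = (\<Sum>n=1..N. \<rho> i n * cnj (v n))" using \<rho>[OF i] by simp
    also have "\<dots> = (\<Sum>n\<in>{1, N}. \<rho> i n * cnj (v n))"
    proof (rule sum.mono_neutral_right)
      show "\<forall>n\<in>{1..N} - {1, N}. \<rho> i n * cnj (v n) = 0" using \<rho>_inner[OF i] by auto
    qed (use N2 in auto)
    also have "\<dots> = T_form (t i) (e j)" using N2 by (simp add: v_def T_form_def t_def)
    finally show ?thesis by simp
  qed
  have t_ker: "of_real p * t i 0 - cnj z * t i (N + 1) = 0" "- z * t i 0 + of_real b * t i (N + 1) = 0" if "i < k" for i
  proof -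
    have zero: "T_form (t i) (e j) * of_real (\<kappa> j) = 0" if "j < 2" for j
      using t_orth[OF \<open>i < k\<close> that] by auto
    have t0: "t i 0 = (\<Sum>j<2. T_form (t i) (e j) * e j 0)"
      and t1: "t i (N + 1) = (\<Sum>j<2. T_form (t i) (e j) * e j (N + 1))" by (rule edec, simp)+
    have "of_real p * t i 0 - cnj z * t i (N + 1)
        = (\<Sum>j<2. T_form (t i) (e j) * (of_real p * e j 0 - cnj z * e j (N + 1)))"
      unfolding t0 t1 sum_distrib_left sum_subtractf[symmetric]
      by (rule sum.cong) (simp_all add: algebra_simps)
    also have "\<dots> = (\<Sum>j<(2::nat). 0)"
      by (rule sum.cong) (use rows zero in \<open>simp_all add: mult.assoc[symmetric]\<close>)
    finally show "of_real p * t i 0 - cnj z * t i (N + 1) = 0" by simp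
    have "- z * t i 0 + of_real b * t i (N + 1)
        = (\<Sum>j<2. T_form (t i) (e j) * (- z * e j 0 + of_real b * e j (N + 1)))"
      unfolding t0 t1 sum_distrib_left sum.distrib[symmetric]
      by (rule sum.cong) (simp_all add: algebra_simps)
    also have "\<dots> = (\<Sum>j<(2::nat). 0)"
      by (rule sum.cong) (use rows zero in \<open>simp_all add: mult.assoc[symmetric]\<close>)
    finally show "- z * t i 0 + of_real b * t i (N + 1) = 0" by simp
  qed
  define x' where "x' = (\<lambda>i n. x i n - t i n)"
  have x'_inner: "x' i n = x i n" if "n \<in> {1..N}" for i n using that by (auto simp: x'_def t_def)
  have W': "W_form (x' i) v = W_form (x i) v" "W_form v (x' i) = W_form v (x i)" for i v
    unfolding W_form_def by (auto intro!: sum.cong simp: x'_inner)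
  have sol: "solution p z b (of_real (\<mu> i)) (x' i)" if i: "i < k" for i
    unfolding solution_def
  proof (intro conjI ballI)
    fix n assume n: "n \<in> {1..N}"
    have flux: "flux (x' i) m = (if m = 0 then flux (x i) 0 - \<rho> i 1
        else if m = N then flux (x i) N + \<rho> i N else flux (x i) m)" if "m \<le> N" for m
      using N2 that x'_inner[of m i] x'_inner[of "m + 1" i] by (auto simp: flux_def x'_def t_def)
    have "residual (x' i) n = residual (x i) n - \<rho> i n"
    proof (cases "n = 1 \<or> n = N")
      case True
      then show ?thesis using flux[of n] flux[of "n - 1"] n N2 x'_inner[OF n] by (auto simp: residual_def)
    next
      case False
      then show ?thesis using flux[of n] flux[of "n - 1"] n N2 x'_inner[OF n] \<rho>_inner[OF i, of n]
        by (auto simp: residual_def)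
    qed
    then show "residual (x' i) n = of_real (\<mu> i) * of_real (w n) * x' i n"
      using x'_inner[OF n] by (simp add: \<rho>_def)
  next
    have b: "r0 (x i) = 0" "r1 (x i) = 0" using xV[OF i] by (auto simp: V_def)
    show "x' i 1 + of_real p * x' i 0 - cnj z * x' i (N + 1) = 0"
      using b(1) t_ker(1)[OF i] x'_inner[of 1 i] N2 unfolding r0_eq by (simp add: x'_def algebra_simps)
    show "x' i N - z * x' i 0 + of_real b * x' i (N + 1) = 0"
      using b(2) t_ker(2)[OF i] x'_inner[of N i] N2 unfolding r1_eq by (simp add: x'_def algebra_simps)
  qed
  have "eigensystem p z b k x' \<mu>"
    unfolding eigensystem_def
  proof (intro conjI allI impI)
    fix i assume "i < k"
    then show "x' i \<in> vecs (N + 2)" using xV[of i] by (auto simp: x'_def t_def V_def vecs_def)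
  next
    fix \<nu> v assume s: "solution p z b \<nu> v" and v: "v \<in> vecs (N + 2)" and o: "\<forall>i<k. W_form v (x' i) = 0"
    \<comment> \<open>The kernel components of v are removed in order to return to V; the inner
      entries, which alone matter for W, stay the same.\<close>
    define c where "c = lincomb (\<lambda>i. T_form v (e i)) e Z"
    define v' where "v' = (\<lambda>n. (-1) * c n + v n)"
    have Zlt: "i < 2" "\<kappa> i = 0" if "i \<in> Z" for i using that by (auto simp: Z_def)
    have c0: "c n = 0" if "n \<in> {1..N}" for n using e0[OF that] by (simp add: c_def lincomb_def)
    have "r0 v = 0" "r1 v = 0" using s by (auto simp: solution_def r0_eq r1_eq algebra_simps)
    moreover have "r0 c = 0" "r1 c = 0"
    proof -
      have "r0 (e i) = 0" "r1 (e i) = 0" if "i \<in> Z" for i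
        using rows[OF Zlt(1)[OF that]] Zlt(2)[OF that] e0[of 1 i] e0[of N i] N2 by (auto simp: r0_eq r1_eq)
      then show "r0 c = 0" "r1 c = 0" unfolding c_def r0_def r1_def H.lincomb by auto
    qed
    ultimately have "r0 v' = 0" "r1 v' = 0" unfolding v'_def r0_def r1_def H.lin by auto
    moreover have "T_form v' (e j) = 0" if "j \<in> Z" for j
    proof -
      have "T_form c (e j) = (\<Sum>i\<in>Z. if i = j then T_form v (e j) else 0)"
        unfolding c_def T.lincomb by (rule sum.cong) (use eT Zlt that in auto)
      then have "T_form c (e j) = T_form v (e j)" using that \<open>finite Z\<close> by simp
      then show ?thesis unfolding v'_def T.lin by simp
    qed
    moreover have "c \<in> vecs (N + 2)" unfolding c_def by (rule lincomb_vecs) (rule ev)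
    then have "v' \<in> vecs (N + 2)" unfolding v'_def using v by (intro subspace_lin[OF subspace_vecs])
    ultimately have "v' \<in> V" by (auto simp: V_def Z_def)
    moreover have "W_form v' (x i) = 0" if "i < k" for i
      unfolding v'_def W.lin using W_form_null(1)[of c "x i"] c0 o that by (simp add: W')
    ultimately have "v' = 0" by (rule compl)
    then have "v' n = 0" for n by simp
    then have "v n = 0" if "n \<in> {1..N}" for n
      using c0[OF that] by (simp add: v'_def)
    then show "v = 0" using solution_zero[OF s v] by blast
  qed (use mono sol orth in \<open>auto simp: W'\<close>)
  then show ?thesis using dim by (intro that) (auto simp: cardZ)
qed

section \<open>Counting eigenvalues\<close>

lemma eigensystem_orthogonal:
  assumes "eigensystem p z b k x \<mu>" "solution p z b \<nu> v" "i < k" "\<nu> \<noteq> of_real (\<mu> i)"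
  shows "W_form v (x i) = 0"
proof -
  have "solution p z b (of_real (\<mu> i)) (x i)" using assms(1,3) by (rule eigensystemD)
  then have "H_form p z b (x i) v = of_real (\<mu> i) * W_form (x i) v" by (rule solution_form)
  then have "cnj (H_form p z b (x i) v) = of_real (\<mu> i) * cnj (W_form (x i) v)" by simp
  then have "H_form p z b v (x i) = of_real (\<mu> i) * W_form v (x i)"
    by (metis H.sym W.sym)
  moreover have "H_form p z b v (x i) = \<nu> * W_form v (x i)" using assms(2) by (rule solution_form)
  ultimately show ?thesis using assms(4) by simp
qed

lemma eigensystem_spectrum:
  assumes "eigensystem p z b k x \<mu>" "solution p z b \<nu> v" "v \<in> vecs (N + 2)" "v \<noteq> 0"
  shows "\<exists>i<k. \<nu> = of_real (\<mu> i)"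
  using eigensystem_orthogonal[OF assms(1,2)] eigensystemD(5)[OF assms(1-3)] assms(4) by blast

lemma card_Plus_Collect:
  assumes "finite A" "finite B"
  shows "card {i \<in> A <+> B. P i} = card {i \<in> A. P (Inl i)} + card {i \<in> B. P (Inr i)}"
proof -
  have "{i \<in> A <+> B. P i} = {i \<in> A. P (Inl i)} <+> {i \<in> B. P (Inr i)}" by auto
  then show ?thesis using assms by (simp add: card_Plus)
qed

text \<open>W does not see border vectors, and S vanishes between them; hence eigenfunctions and
  eigenvectors of Q form an M-orthogonal family with diagonal entries \<open>\<mu> i - l\<close> and
  \<open>\<kappa> i\<close>. Its members of sign opposite to A span a semidefinite subspace of known
  dimension.\<close>

lemma definite_family_bound:
  fixes s :: real
  assumes es: "eigensystem p z b k x \<mu>" and dg: "diagonalises p z b e \<kappa>"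
    and A: "finite A" "\<And>i. i \<in> A \<Longrightarrow> u i \<in> vecs (N + 2)"
    and pos: "\<And>c. \<exists>i\<in>A. c i \<noteq> 0 \<Longrightarrow> s * Re (M_form p z b l (lincomb c u A) (lincomb c u A)) > 0"
  shows "card A + card {i. i < k \<and> s * (\<mu> i - l) \<le> 0} + card {i. i < (2::nat) \<and> s * \<kappa> i \<le> 0} \<le> N + 2"
proof -
  note ev = diagonalisesD(1)[OF dg] and e0 = diagonalisesD(2)[OF dg] and eQ = diagonalisesD(3)[OF dg]
    and eT = diagonalisesD(4)[OF dg]
  note xv = eigensystemD(1)[OF es] and sol = eigensystemD(2)[OF es] and orth = eigensystemD(3)[OF es]
  define X where "X = case_sum x e"
  define \<theta> where "\<theta> = case_sum (\<lambda>i. \<mu> i - l) \<kappa>"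
  define B where "B = {i \<in> {..<k} <+> {..<2}. s * \<theta> i \<le> 0}"
  have [simp]: "finite B" by (simp add: B_def)
  have Mx: "M_form p z b l (x i) v = of_real (\<mu> i - l) * W_form (x i) v" if "i < k" for i v
    using solution_form[OF sol[OF that], of v] by (simp add: M_form_def algebra_simps)
  have We: "W_form (e j) v = 0" "W_form v (e j) = 0" for v j
    using W_form_null[of "e j" v] e0 by auto
  have Me: "M_form p z b l (e i) (e j) = (if i = j then of_real (\<kappa> i) else 0)" if "i < 2" "j < 2" for i j
  proof -
    have "S_form (e i) (e j) = 0" using N2 e0 by (simp add: S_form_def)
    then show ?thesis using eQ[OF that(1)] eT[OF that] by (simp add: M_form_def H_form_def We)
  qed
  have off: "M_form p z b l (X i) (X j) = 0" if "i \<in> B" "j \<in> B" "i \<noteq> j" for i j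
  proof -
    have "M_form p z b l (e j) (x i) = 0" if "i < k" for i j
      by (subst M.sym) (simp add: Mx[OF that] We)
    then show ?thesis using that by (auto simp: B_def X_def Mx Me We orth split: if_splits)
  qed
  have diag: "M_form p z b l (X i) (X i) = of_real (\<theta> i)" if "i \<in> B" for i
    using that by (auto simp: B_def X_def \<theta>_def Mx Me orth)
  have "card A + card B \<le> N + 2"
  proof (rule card_definite_semidefinite[OF hermitian_M[of p z b l] A(1) \<open>finite B\<close> A(2) _ pos])
    show "X i \<in> vecs (N + 2)" if "i \<in> B" for i using that xv ev by (auto simp: B_def X_def)
    show "s * Re (M_form p z b l (lincomb c X B) (lincomb c X B)) \<le> 0" for c
    proof -
      have "s * Re (M_form p z b l (lincomb c X B) (lincomb c X B)) = (\<Sum>i\<in>B. (cmod (c i))\<^sup>2 * (s * \<theta> i))"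
        by (subst M.lincomb_orthogonal[where \<theta>=\<theta>]) (use off diag in \<open>auto simp: sum_distrib_left mult_ac\<close>)
      also have "\<dots> \<le> 0" by (rule sum_nonpos) (auto simp: B_def mult_nonneg_nonpos)
      finally show ?thesis .
    qed
    show "c i = 0" if 0: "lincomb c X B = 0" and i: "i \<in> B" for c i
    proof -
      \<comment> \<open>W isolates the coefficients of the eigenfunctions. Only when these are known
        to vanish does T isolate the others, since eigenfunctions have border entries too.\<close>
      have inl: "c (Inl j) = 0" if j: "Inl j \<in> B" for j
      proof -
        have "0 = W_form (lincomb c X B) (X (Inl j))" using 0 by simp
        also have "\<dots> = (\<Sum>i\<in>B. if i = Inl j then c i else 0)"
          unfolding W.lincomb
        proof (rule sum.cong[OF refl])
          fix i assume "i \<in> B"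
          then show "c i * W_form (X i) (X (Inl j)) = (if i = Inl j then c i else 0)"
            using j by (auto simp: B_def X_def We orth)
        qed
        also have "\<dots> = c (Inl j)" using j by simp
        finally show ?thesis by simp
      qed
      have inr: "c (Inr j) = 0" if j: "Inr j \<in> B" for j
      proof -
        have "0 = T_form (lincomb c X B) (X (Inr j))" using 0 by simp
        also have "\<dots> = (\<Sum>i\<in>B. if i = Inr j then c i else 0)"
          unfolding T.lincomb
        proof (rule sum.cong[OF refl])
          fix i assume "i \<in> B"
          then show "c i * T_form (X i) (X (Inr j)) = (if i = Inr j then c i else 0)"
            using j inl by (auto simp: B_def X_def eT)
        qed
        also have "\<dots> = c (Inr j)" using j by simp
        finally show ?thesis by simp
      qed
      show ?thesis using inl inr i by (cases i) auto
    qed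
  qed
  moreover have "card B = card {i. i < k \<and> s * (\<mu> i - l) \<le> 0} + card {i. i < (2::nat) \<and> s * \<kappa> i \<le> 0}"
    unfolding B_def by (subst card_Plus_Collect) (auto simp: \<theta>_def)
  ultimately show ?thesis by simp
qed

text \<open>The case s = -1. The nullity enters when the number of nonnegative \<kappa> is expressed
  by that of the nonpositive ones.\<close>

lemma negative_family_bound:
  assumes es: "eigensystem p z b k x \<mu>"
    and A: "finite A" "\<And>i. i \<in> A \<Longrightarrow> u i \<in> vecs (N + 2)"
    and neg: "\<And>c. \<exists>i\<in>A. c i \<noteq> 0 \<Longrightarrow> Re (M_form p z b l (lincomb c u A) (lincomb c u A)) < 0"
  shows "card A + card {i. i < k \<and> \<mu> i \<ge> l} + 2 + nullity2 p z b \<le> N + 2 + nonpos_index2 p z b"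
proof -
  obtain e \<kappa> where dg: "diagonalises p z b e \<kappa>" using diagonalisation_exists by blast
  have "card {i. i < (2::nat) \<and> \<kappa> i \<ge> 0} + nonpos_index2 p z b = 2 + nullity2 p z b"
    by (rule index2_eq(3)[OF diagonalisesD(6,7)[OF dg]])
  moreover have "card A + card {i. i < k \<and> (-1) * (\<mu> i - l) \<le> 0} + card {i. i < (2::nat) \<and> (-1) * \<kappa> i \<le> 0} \<le> N + 2"
    by (rule definite_family_bound[OF es dg A]) (use neg in auto)
  ultimately show ?thesis by simp
qed

lemma positive_family_bound:
  assumes es: "eigensystem p z b k x \<mu>"
    and A: "finite A" "\<And>i. i \<in> A \<Longrightarrow> u i \<in> vecs (N + 2)"
    and pos: "\<And>c. \<exists>i\<in>A. c i \<noteq> 0 \<Longrightarrow> Re (M_form p z b l (lincomb c u A) (lincomb c u A)) > 0"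
  shows "card A + card {i. i < k \<and> \<mu> i \<le> l} + nonpos_index2 p z b \<le> N + 2"
proof -
  obtain e \<kappa> where dg: "diagonalises p z b e \<kappa>" using diagonalisation_exists by blast
  have "card {i. i < (2::nat) \<and> \<kappa> i \<le> 0} = nonpos_index2 p z b"
    by (rule index2_eq(2)[OF diagonalisesD(6,7)[OF dg]])
  moreover have "card A + card {i. i < k \<and> 1 * (\<mu> i - l) \<le> 0} + card {i. i < (2::nat) \<and> 1 * \<kappa> i \<le> 0} \<le> N + 2"
    by (rule definite_family_bound[OF es dg A]) (use pos in auto)
  ultimately show ?thesis by simp
qed

text \<open>Added up, the bounds for A and B give \<open>card A + card B + k + card {i. i < k \<and>
  \<mu> i = l} + 2 + nullity2 p z b \<le> 2 * N + 4\<close>, while \<open>card A + card B\<close> is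
  at least N + 2 and k plus the nullity at least N. So equality holds throughout, which yields the
  size, the absence of the eigenvalue l and the count at once.\<close>

lemma inertia_count:
  assumes es: "eigensystem p z b k x \<mu>" "N \<le> k + nullity2 p z b"
    and ds: "definite_splitting (N + 2) F A B u \<epsilon>"
    and close: "\<And>v. v \<in> vecs (N + 2) \<Longrightarrow> v \<noteq> 0 \<Longrightarrow>
      \<bar>Re (M_form p z b l v v) - Re (F v v)\<bar> < \<epsilon> * Re (std_form (N + 2) v v)"
  shows "k + nullity2 p z b = N" "\<And>i. i < k \<Longrightarrow> \<mu> i \<noteq> l"
    "card A = card {i. i < k \<and> \<mu> i < l} + nonpos_index2 p z b"
proof -
  have u: "u i \<in> vecs (N + 2)" if "i \<in> A \<union> B" for i using that ds by (auto simp: definite_splitting_def)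
  have fin: "finite A" "finite B" and card: "N + 2 \<le> card A + card B"
    using ds by (auto simp: definite_splitting_def)
  have A: "card A + card {i. i < k \<and> \<mu> i \<ge> l} + 2 + nullity2 p z b \<le> N + 2 + nonpos_index2 p z b"
    by (rule negative_family_bound[OF es(1) fin(1) _ definite_splitting_perturb(1)[where G="M_form p z b l", OF ds close]])
       (use u in auto)
  have B: "card B + card {i. i < k \<and> \<mu> i \<le> l} + nonpos_index2 p z b \<le> N + 2"
    by (rule positive_family_bound[OF es(1) fin(2) _ definite_splitting_perturb(2)[where G="M_form p z b l", OF ds close]])
       (use u in auto)
  have "card ({i. i < k \<and> \<mu> i < l} \<union> {i. i < k \<and> \<mu> i = l}) = card {i. i < k \<and> \<mu> i < l} + card {i. i < k \<and> \<mu> i = l}"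
    by (rule card_Un_disjoint) auto
  moreover have "{i. i < k \<and> \<mu> i < l} \<union> {i. i < k \<and> \<mu> i = l} = {i. i < k \<and> \<mu> i \<le> l}" by auto
  moreover have "card ({i. i < k \<and> \<mu> i < l} \<union> {i. i < k \<and> \<mu> i \<ge> l}) = card {i. i < k \<and> \<mu> i < l} + card {i. i < k \<and> \<mu> i \<ge> l}"
    by (rule card_Un_disjoint) auto
  moreover have "{i. i < k \<and> \<mu> i < l} \<union> {i. i < k \<and> \<mu> i \<ge> l} = {..<k}" by auto
  ultimately have c: "card {i. i < k \<and> \<mu> i \<le> l} = card {i. i < k \<and> \<mu> i < l} + card {i. i < k \<and> \<mu> i = l}"
      "k = card {i. i < k \<and> \<mu> i < l} + card {i. i < k \<and> \<mu> i \<ge> l}" by simp_all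
  show "k + nullity2 p z b = N" using A B c card es(2) by linarith
  show "card A = card {i. i < k \<and> \<mu> i < l} + nonpos_index2 p z b" using A B c card es(2) by linarith
  have "card {i. i < k \<and> \<mu> i = l} = 0" using A B c card es(2) by linarith
  then show "\<mu> i \<noteq> l" if "i < k" for i using that by auto
qed

text \<open>A vector in the radical of the form at level l is a solution for l, so off the spectrum
  the form is nondegenerate.\<close>

lemma eigensystem_splitting:
  assumes es: "eigensystem p z b k x \<mu>" and l: "\<And>i. i < k \<Longrightarrow> \<mu> i \<noteq> l"
  obtains A B u \<epsilon> where "definite_splitting (N + 2) (M_form p z b l) A B u \<epsilon>"
proof -
  have nondeg: "v = 0" if v: "v \<in> vecs (N + 2)" and null: "\<And>y. y \<in> vecs (N + 2) \<Longrightarrow> M_form p z b l v y = 0" for v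
  proof (rule ccontr)
    assume "v \<noteq> 0"
    have "solution p z b (of_real l) v"
      by (rule solutionI) (use null in \<open>simp add: M_form_def\<close>)
    then have "\<exists>i<k. (of_real l :: complex) = of_real (\<mu> i)"
      by (rule eigensystem_spectrum[OF es _ v \<open>v \<noteq> 0\<close>])
    then show False using l by auto
  qed
  show ?thesis
    using nondegenerate_splitting[OF hermitian_M nondeg] that by blast
qed

lemma eigensystem_size:
  assumes es: "eigensystem p z b k x \<mu>" "N \<le> k + nullity2 p z b"
  shows "k + nullity2 p z b = N"
proof -
  have "finite (\<mu> ` {..<k})" by simp
  then obtain l where "l \<notin> \<mu> ` {..<k}" using ex_new_if_finite infinite_UNIV_char_0 by blast
  then have l: "\<mu> i \<noteq> l" if "i < k" for i using that by auto
  obtain A B u \<epsilon> where ds: "definite_splitting (N + 2) (M_form p z b l) A B u \<epsilon>"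
    by (rule eigensystem_splitting[OF es(1) l])
  show ?thesis
    by (rule inertia_count(1)[where l=l, OF es ds])
       (use ds std_form_pos in \<open>auto simp: definite_splitting_def\<close>)
qed

section \<open>Dependence of the count on Q\<close>

lemma Q_form_diff_bound:
  "\<bar>Re (Q_form p z b x x) - Re (Q_form p' z' b' x x)\<bar>
    \<le> (\<bar>p - p'\<bar> + 2 * cmod (z - z') + \<bar>b - b'\<bar>) * Re (std_form (N + 2) x x)"
proof -
  define S where "S = (\<Sum>n<N + 2. (cmod (x n))\<^sup>2)"
  define \<xi> \<eta> where "\<xi> = x 0" and "\<eta> = x (N + 1)"
  have sub: "(\<Sum>n\<in>{0, N + 1}. (cmod (x n))\<^sup>2) \<le> S"
    unfolding S_def by (rule sum_mono2) auto
  then have S: "(cmod \<xi>)\<^sup>2 + (cmod \<eta>)\<^sup>2 \<le> S" by (simp add: \<xi>_def \<eta>_def)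
  then have S1: "(cmod \<xi>)\<^sup>2 \<le> S" "(cmod \<eta>)\<^sup>2 \<le> S" using zero_le_power2[of "cmod \<xi>"] zero_le_power2[of "cmod \<eta>"] by linarith+
  have cross: "cmod \<xi> * cmod \<eta> \<le> S"
  proof -
    have "2 * (cmod \<xi> * cmod \<eta>) \<le> (cmod \<xi>)\<^sup>2 + (cmod \<eta>)\<^sup>2"
      using sum_squares_bound[of "cmod \<xi>" "cmod \<eta>"] by simp
    then show ?thesis using S zero_le_mult_iff[of "cmod \<xi>" "cmod \<eta>"] norm_ge_zero by (smt (verit))
  qed
  have "Q_form p z b x x - Q_form p' z' b' x x
      = of_real (p - p') * (\<xi> * cnj \<xi>) + of_real (b - b') * (\<eta> * cnj \<eta>)
        - (cnj (z - z') * \<eta> * cnj \<xi> + (z - z') * \<xi> * cnj \<eta>)"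
    by (simp add: Q_form_def \<xi>_def \<eta>_def algebra_simps)
  then have "Re (Q_form p z b x x) - Re (Q_form p' z' b' x x)
      = Re (of_real (p - p') * (\<xi> * cnj \<xi>) + of_real (b - b') * (\<eta> * cnj \<eta>)
        - (cnj (z - z') * \<eta> * cnj \<xi> + (z - z') * \<xi> * cnj \<eta>))"
    by (metis minus_complex.sel(1))
  also have "\<bar>\<dots>\<bar> \<le> cmod (of_real (p - p') * (\<xi> * cnj \<xi>) + of_real (b - b') * (\<eta> * cnj \<eta>)
        - (cnj (z - z') * \<eta> * cnj \<xi> + (z - z') * \<xi> * cnj \<eta>))"
    by (rule abs_Re_le_cmod)
  also have "\<dots> \<le> cmod (of_real (p - p') * (\<xi> * cnj \<xi>)) + cmod (of_real (b - b') * (\<eta> * cnj \<eta>))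
      + (cmod (cnj (z - z') * \<eta> * cnj \<xi>) + cmod ((z - z') * \<xi> * cnj \<eta>))"
    by (intro order.trans[OF norm_triangle_ineq4] add_mono norm_triangle_ineq)
  also have "\<dots> = \<bar>p - p'\<bar> * (cmod \<xi>)\<^sup>2 + \<bar>b - b'\<bar> * (cmod \<eta>)\<^sup>2 + 2 * (cmod (z - z') * (cmod \<xi> * cmod \<eta>))"
    by (simp add: norm_mult power2_eq_square del: of_real_diff complex_cnj_diff)
  also have "\<dots> \<le> \<bar>p - p'\<bar> * S + \<bar>b - b'\<bar> * S + 2 * (cmod (z - z') * S)"
    using S1 cross by (intro add_mono mult_left_mono) auto
  finally show ?thesis by (simp add: std_form_diag S_def algebra_simps)
qed

text \<open>One and the same negative family A computes the sum for every nearby Q. The pencil moves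
  only slightly, even where the determinant of Q vanishes or changes sign and the number of
  eigenvalues jumps.\<close>

lemma eigenvalue_count_local:
  assumes es: "eigensystem p z b k x \<mu>" "N \<le> k + nullity2 p z b" and l: "\<And>i. i < k \<Longrightarrow> \<mu> i \<noteq> l"
  shows "\<exists>\<delta>>0. \<forall>p' z' b' k' x' \<mu>'. eigensystem p' z' b' k' x' \<mu>' \<longrightarrow> N \<le> k' + nullity2 p' z' b' \<longrightarrow>
      \<bar>p' - p\<bar> < \<delta> \<longrightarrow> cmod (z' - z) < \<delta> \<longrightarrow> \<bar>b' - b\<bar> < \<delta> \<longrightarrow>
      card {i. i < k' \<and> \<mu>' i < l} + nonpos_index2 p' z' b' = card {i. i < k \<and> \<mu> i < l} + nonpos_index2 p z b"
proof -
  obtain A B u \<epsilon> where ds: "definite_splitting (N + 2) (M_form p z b l) A B u \<epsilon>"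
    by (rule eigensystem_splitting[OF es(1) l])
  then have "\<epsilon> > 0" by (simp add: definite_splitting_def)
  \<comment> \<open>The quarter accounts for the coefficients 1 + 2 + 1 in
    \<open>Q_form_diff_bound\<close>.\<close>
  have count: "card A = card {i. i < k' \<and> \<mu>' i < l} + nonpos_index2 p' z' b'"
    if es': "eigensystem p' z' b' k' x' \<mu>'" "N \<le> k' + nullity2 p' z' b'"
      and close: "\<bar>p' - p\<bar> < \<epsilon> / 4" "cmod (z' - z) < \<epsilon> / 4" "\<bar>b' - b\<bar> < \<epsilon> / 4" for p' z' b' k' x' \<mu>'
  proof -
    have diff: "\<bar>Re (M_form p' z' b' l v v) - Re (M_form p z b l v v)\<bar> < \<epsilon> * Re (std_form (N + 2) v v)"
      if "v \<in> vecs (N + 2)" "v \<noteq> 0" for v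
    proof -
      have "\<bar>Re (M_form p' z' b' l v v) - Re (M_form p z b l v v)\<bar>
          \<le> (\<bar>p' - p\<bar> + 2 * cmod (z' - z) + \<bar>b' - b\<bar>) * Re (std_form (N + 2) v v)"
        using Q_form_diff_bound[of p' z' b' v p z b] by (simp add: M_form_def H_form_def)
      also have "\<dots> < \<epsilon> * Re (std_form (N + 2) v v)"
        using close std_form_pos[OF that] by (intro mult_strict_right_mono) auto
      finally show ?thesis .
    qed
    show ?thesis by (rule inertia_count(3)[OF es' ds diff])
  qed
  have "card A = card {i. i < k \<and> \<mu> i < l} + nonpos_index2 p z b"
    by (rule count[OF es]) (use \<open>\<epsilon> > 0\<close> in auto)
  then show ?thesis
    using count \<open>\<epsilon> > 0\<close> by (intro exI[of _ "\<epsilon> / 4"] conjI allI impI) simp_all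
qed

text \<open>Raising p and b raises the form, so a family negative for the larger matrix is negative
  for the smaller one. Its size is exact for the former and subject to
  \<open>negative_family_bound\<close> for the latter.\<close>

lemma eigenvalue_count_mono:
  assumes es: "eigensystem p z b k x \<mu>" "N \<le> k + nullity2 p z b"
    and es': "eigensystem p' z b' k' x' \<mu>'" "N \<le> k' + nullity2 p' z b'"
    and le: "p \<le> p'" "b \<le> b'" and l: "\<And>i. i < k' \<Longrightarrow> \<mu>' i \<noteq> l"
  shows "card {i. i < k' \<and> \<mu>' i < l} + nonpos_index2 p' z b' \<le> card {i. i < k \<and> \<mu> i < l} + nonpos_index2 p z b"
proof -
  obtain A B u \<epsilon> where ds: "definite_splitting (N + 2) (M_form p' z b' l) A B u \<epsilon>"
    by (rule eigensystem_splitting[OF es'(1) l])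
  have close: "\<bar>Re (M_form p' z b' l v v) - Re (M_form p' z b' l v v)\<bar> < \<epsilon> * Re (std_form (N + 2) v v)"
    if "v \<in> vecs (N + 2)" "v \<noteq> 0" for v
    using ds std_form_pos[OF that] by (simp add: definite_splitting_def)
  have neg: "Re (M_form p' z b' l (lincomb c u A) (lincomb c u A)) < 0" if "\<exists>i\<in>A. c i \<noteq> 0" for c
    by (rule definite_splitting_perturb(1)[where G="M_form p' z b' l", OF ds close]) (use that in auto)
  have A: "finite A" "\<And>i. i \<in> A \<Longrightarrow> u i \<in> vecs (N + 2)"
    using ds by (auto simp: definite_splitting_def)
  have "card A = card {i. i < k' \<and> \<mu>' i < l} + nonpos_index2 p' z b'"
    by (rule inertia_count(3)[OF es' ds close])
  moreover have "card A + card {i. i < k \<and> \<mu> i \<ge> l} + 2 + nullity2 p z b \<le> N + 2 + nonpos_index2 p z b"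
  proof (rule negative_family_bound[OF es(1) A])
    show "Re (M_form p z b l (lincomb c u A) (lincomb c u A)) < 0" if "\<exists>i\<in>A. c i \<noteq> 0" for c
    proof -
      define v where "v = lincomb c u A"
      have "M_form p' z b' l v v - M_form p z b l v v = of_real (p' - p) * (v 0 * cnj (v 0)) + of_real (b' - b) * (v (N + 1) * cnj (v (N + 1)))"
        by (simp add: M_form_def H_form_def Q_form_def algebra_simps)
      also have "\<dots> = of_real ((p' - p) * (cmod (v 0))\<^sup>2 + (b' - b) * (cmod (v (N + 1)))\<^sup>2)"
        by (simp add: complex_norm_square[symmetric])
      finally have "Re (M_form p' z b' l v v) - Re (M_form p z b l v v) = (p' - p) * (cmod (v 0))\<^sup>2 + (b' - b) * (cmod (v (N + 1)))\<^sup>2"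
        by (metis Re_complex_of_real minus_complex.sel(1))
      also have "\<dots> \<ge> 0" using le by simp
      finally show ?thesis using neg[OF that] by (simp add: v_def)
    qed
  qed
  moreover have "k = card {i. i < k \<and> \<mu> i < l} + card {i. i < k \<and> \<mu> i \<ge> l}"
  proof -
    have "card ({i. i < k \<and> \<mu> i < l} \<union> {i. i < k \<and> \<mu> i \<ge> l}) = card {i. i < k \<and> \<mu> i < l} + card {i. i < k \<and> \<mu> i \<ge> l}"
      by (rule card_Un_disjoint) auto
    moreover have "{i. i < k \<and> \<mu> i < l} \<union> {i. i < k \<and> \<mu> i \<ge> l} = {..<k}" by auto
    ultimately show ?thesis by simp
  qed
  ultimately show ?thesis using es(2) by linarith
qed

end

section \<open>Boundary conditions in the chart\<close>

lemma vector_4 [simp]: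
  "(vector [a, b, c, d] :: 'a::zero^4) $ 1 = a" "(vector [a, b, c, d] :: 'a^4) $ 2 = b"
  "(vector [a, b, c, d] :: 'a^4) $ 3 = c" "(vector [a, b, c, d] :: 'a^4) $ 4 = d"
  unfolding vector_def by simp_all

lemma blocks_mult:
  "left_block (T ** M) *v a + right_block (T ** M) *v c = T *v (left_block M *v a + right_block M *v c)"
  by (simp add: vec_eq_iff forall_2 left_block_def right_block_def matrix_matrix_mult_def
      matrix_vector_mult_def sum_2 algebra_simps)

lemma bc_class_self: "M \<in> bc_class M"
  unfolding bc_class_def by (auto simp: invertible_def intro!: exI[of _ "mat 1"])

lemma satisfies_bc_class:
  "satisfies_bc N \<omega> (bc_class M) y \<longleftrightarrow>
     left_block M *v vector [y 0, of_real (coeff_f \<omega> 0) * fdiff y 0]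
     + right_block M *v vector [y N, of_real (coeff_f \<omega> N) * fdiff y N] = 0"
proof
  assume "satisfies_bc N \<omega> (bc_class M) y"
  then show "left_block M *v vector [y 0, of_real (coeff_f \<omega> 0) * fdiff y 0]
     + right_block M *v vector [y N, of_real (coeff_f \<omega> N) * fdiff y N] = 0"
    using bc_class_self[of M] unfolding satisfies_bc_def by blast
next
  assume "left_block M *v vector [y 0, of_real (coeff_f \<omega> 0) * fdiff y 0]
     + right_block M *v vector [y N, of_real (coeff_f \<omega> N) * fdiff y N] = 0"
  then show "satisfies_bc N \<omega> (bc_class M) y"
    unfolding satisfies_bc_def bc_class_def by (auto simp: blocks_mult)
qed

lemma satisfies_bc13:
  "satisfies_bc N \<omega> (bc13 a z b) y \<longleftrightarrow>
     y 0 + of_real a * (of_real (coeff_f \<omega> 0) * fdiff y 0) + cnj z * (of_real (coeff_f \<omega> N) * fdiff y N) = 0 \<and>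
     z * (of_real (coeff_f \<omega> 0) * fdiff y 0) - y N + of_real b * (of_real (coeff_f \<omega> N) * fdiff y N) = 0"
  unfolding bc13_def satisfies_bc_class
  by (simp add: vec_eq_iff forall_2 left_block_def right_block_def matrix_vector_mult_def sum_2 algebra_simps)

lemma bc_class_mult:
  assumes "invertible (S :: complex^2^2)"
  shows "bc_class (S ** M) = bc_class M"
proof -
  have sub: "bc_class (S ** M) \<subseteq> bc_class M" if "invertible S" for S :: "complex^2^2" and M
    unfolding bc_class_def using invertible_mult[OF _ that] by (auto simp: matrix_mul_assoc)
  obtain S' where S': "S' ** S = mat 1" "S ** S' = mat 1" using assms by (auto simp: invertible_def)
  then have "invertible S'" by (auto simp: invertible_def)
  then have "bc_class (S' ** (S ** M)) \<subseteq> bc_class (S ** M)" by (rule sub)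
  then show ?thesis using sub[OF assms, of M] S' by (simp add: matrix_mul_assoc)
qed

lemma bcC_eq: "bcC \<omega> = bc13 (1 / coeff_f \<omega> 0) 0 0"
proof -
  let ?S = "vector [vector [1, 0], vector [0, -1]] :: complex^2^2"
  have "?S ** ?S = mat 1"
    by (simp add: vec_eq_iff forall_2 matrix_matrix_mult_def sum_2 mat_def)
  then have "invertible ?S" by (auto simp: invertible_def)
  moreover have "?S ** vector [vector [1, of_real (1 / coeff_f \<omega> 0), 0, 0], vector [0, 0, 1, 0]]
      = (vector [vector [1, of_real (1 / coeff_f \<omega> 0), 0, cnj 0], vector [0, 0, -1, of_real 0]] :: complex^4^2)"
    by (simp add: vec_eq_iff forall_2 forall_4 matrix_matrix_mult_def sum_2)
  ultimately show ?thesis unfolding bcC_def bc13_def by (metis bc_class_mult)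
qed


section \<open>Eigenvalue lists\<close>

lemma eigenvalue_list_unique:
  assumes "eigenvalue_list N \<omega> \<A> xs" "eigenvalue_list N \<omega> \<A> ys"
  shows "xs = ys"
proof -
  have "of_real ` set xs = (of_real ` set ys :: complex set)" using assms by (simp add: eigenvalue_list_def)
  then have s: "set xs = set ys" by (simp add: inj_image_eq_iff inj_on_def)
  have "count (mset xs) x = count (mset ys) x" for x
  proof (cases "x \<in> set xs")
    case True
    then show ?thesis using assms s by (simp add: eigenvalue_list_def)
  next
    case False
    then show ?thesis using s by (metis count_eq_zero_iff set_mset_mset)
  qed
  then have "mset xs = mset ys" by (rule multiset_eqI)
  then show ?thesis using assms by (metis eigenvalue_list_def properties_for_sort)
qed

lemma nth_eigenvalue_eq:
  "eigenvalue_list N \<omega> \<A> xs \<Longrightarrow> nth_eigenvalue N \<omega> n \<A> = xs ! n"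
  unfolding nth_eigenvalue_def by (metis (mono_tags, lifting) eigenvalue_list_unique the_equality)

lemma nth_defined_iff:
  "eigenvalue_list N \<omega> \<A> xs \<Longrightarrow> nth_defined N \<omega> n \<A> \<longleftrightarrow> n < length xs"
  unfolding nth_defined_def by (metis eigenvalue_list_unique)

context sl_problem
begin

text \<open>The minus sign at N + 1 gives the coupling of \<open>x N\<close> and
  \<open>x (N + 1)\<close> the same sign in the equation at N and in the second boundary row, as a
  Hermitian pencil requires.\<close>

definition encode :: "(nat \<Rightarrow> complex) \<Rightarrow> nat \<Rightarrow> complex" where
  "encode y n = (if n = 0 then of_real (f 0) * fdiff y 0 else if n \<le> N then y n
     else if n = N + 1 then - of_real (f N) * fdiff y N else 0)"

definition decode :: "(nat \<Rightarrow> complex) \<Rightarrow> nat \<Rightarrow> complex" where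
  "decode x n = (if n = 0 then x 1 - x 0 / of_real (f 0) else if n \<le> N then x n
     else if n = N + 1 then x N - x (N + 1) / of_real (f N) else 0)"

lemma encode_vecs: "encode y \<in> vecs (N + 2)"
  by (auto simp: encode_def vecs_def)

lemma encode_decode: "x \<in> vecs (N + 2) \<Longrightarrow> encode (decode x) = x"
  using N2 f_nonzero[of 0] f_nonzero[of N]
  by (auto simp: encode_def decode_def vecs_def fun_eq_iff fdiff_def)

lemma decode_encode: "(\<And>n. n > N + 1 \<Longrightarrow> y n = 0) \<Longrightarrow> decode (encode y) = y"
  using N2 f_nonzero[of 0] f_nonzero[of N]
  by (auto simp: encode_def decode_def fun_eq_iff fdiff_def)

lemma decode_lincomb: "decode (lincomb c u I) = lincomb c (\<lambda>i. decode (u i)) I"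
proof -
  have "decode (lincomb c u I) n = (\<Sum>i\<in>I. c i * decode (u i) n)" for n
    by (simp add: decode_def lincomb_def sum_divide_distrib sum_subtractf right_diff_distrib)
  then show ?thesis by (simp add: lincomb_def fun_eq_iff)
qed

text \<open>Since \<open>y 0 = y 1 - x 0 / f 0\<close> for the encoding x of y, the first boundary
  row, rewritten for \<open>y 1\<close>, has a - 1 / f 0 in place of a. This is the origin of the
  shift in d.\<close>

lemma sol_space_iff:
  "y \<in> sol_space N \<omega> (bc13 a z b) \<nu> \<longleftrightarrow>
     (\<forall>n>N + 1. y n = 0) \<and> solution (a - 1 / f 0) z b \<nu> (encode y)"
proof -
  have flux: "flux (encode y) n = of_real (f n) * fdiff y n" if "n \<le> N" for n
    using that N2 by (auto simp: flux_def encode_def fdiff_def)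
  have "residual (encode y) n = - bdiff (\<lambda>k. of_real (f k) * fdiff y k) n + of_real (q n) * y n"
    if "n \<in> {1..N}" for n
  proof -
    have "n - 1 \<le> N" "n \<le> N" "n \<noteq> 0" using that by auto
    then show ?thesis by (simp add: residual_def bdiff_def encode_def flux)
  qed
  moreover have "encode y n = y n" if "n \<in> {1..N}" for n using that by (simp add: encode_def)
  ultimately have "solves_equation N \<omega> \<nu> y \<longleftrightarrow> (\<forall>n\<in>{1..N}. residual (encode y) n = \<nu> * of_real (w n) * encode y n)"
    by (simp add: solves_equation_def)
  moreover have "satisfies_bc N \<omega> (bc13 a z b) y \<longleftrightarrow>
      encode y 1 + of_real (a - 1 / f 0) * encode y 0 - cnj z * encode y (N + 1) = 0
      \<and> encode y N - z * encode y 0 + of_real b * encode y (N + 1) = 0"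
  proof -
    have "of_real (f 0) \<noteq> (0::complex)" using f_nonzero[of 0] by simp
    then have 1: "y 0 = y 1 - (1 / of_real (f 0)) * (of_real (f 0) * fdiff y 0)" by (simp add: fdiff_def)
    have "y 0 + of_real a * (of_real (f 0) * fdiff y 0) + cnj z * (of_real (f N) * fdiff y N)
        = encode y 1 + of_real (a - 1 / f 0) * encode y 0 - cnj z * encode y (N + 1)"
      using N2 by (subst 1) (simp add: encode_def algebra_simps)
    moreover have "z * (of_real (f 0) * fdiff y 0) - y N + of_real b * (of_real (f N) * fdiff y N)
        = - (encode y N - z * encode y 0 + of_real b * encode y (N + 1))"
      using N2 by (simp add: encode_def)
    ultimately show ?thesis unfolding satisfies_bc13 by (simp only: neg_equal_0_iff_equal)
  qed
  ultimately show ?thesis by (auto simp: sol_space_def solution_def)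
qed

lemma decode_sol_space:
  assumes "x \<in> vecs (N + 2)" "solution (a - 1 / f 0) z b \<nu> x"
  shows "decode x \<in> sol_space N \<omega> (bc13 a z b) \<nu>"
  unfolding sol_space_iff encode_decode[OF assms(1)] using assms(2) by (simp add: decode_def)

lemma solution_lincomb:
  assumes "\<And>i. i \<in> I \<Longrightarrow> solution p z b \<nu> (u i)"
  shows "solution p z b \<nu> (lincomb c u I)"
proof (rule solutionI)
  fix v
  show "H_form p z b (lincomb c u I) v = \<nu> * W_form (lincomb c u I) v"
    unfolding H.lincomb W.lincomb sum_distrib_left
    by (rule sum.cong) (use solution_form[OF assms] in \<open>auto simp: mult_ac\<close>)
qed

lemma is_eigenvalue_iff:
  assumes es: "eigensystem (a - 1 / f 0) z b k x \<mu>"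
  shows "is_eigenvalue N \<omega> (bc13 a z b) \<nu> \<longleftrightarrow> (\<exists>i<k. \<nu> = of_real (\<mu> i))"
proof
  assume "is_eigenvalue N \<omega> (bc13 a z b) \<nu>"
  then obtain y where y: "y \<in> sol_space N \<omega> (bc13 a z b) \<nu>" "y \<noteq> 0" by (auto simp: is_eigenvalue_def)
  have y_eq: "decode (encode y) = y" using y by (intro decode_encode) (auto simp: sol_space_def)
  have "encode y \<noteq> 0"
  proof
    assume "encode y = 0"
    then have "y = decode 0" using y_eq by simp
    also have "\<dots> = 0" by (simp add: decode_def fun_eq_iff)
    finally show False using y by simp
  qed
  then show "\<exists>i<k. \<nu> = of_real (\<mu> i)"
    using y(1) by (intro eigensystem_spectrum[OF es _ encode_vecs[of y]]) (auto simp: sol_space_iff)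
next
  assume "\<exists>i<k. \<nu> = of_real (\<mu> i)"
  then obtain i where i: "i < k" "\<nu> = of_real (\<mu> i)" by auto
  have "decode (x i) \<noteq> 0"
  proof
    assume "decode (x i) = 0"
    moreover have "decode (x i) n = x i n" if "n \<in> {1..N}" for n using that by (simp add: decode_def)
    ultimately have "W_form (x i) (x i) = 0" unfolding W_form_zero_iff by simp
    then show False using eigensystemD(3)[OF es i(1) i(1)] by simp
  qed
  then show "is_eigenvalue N \<omega> (bc13 a z b) \<nu>"
    unfolding is_eigenvalue_def using eigensystemD(1,2)[OF es i(1)] i(2)
    by (intro bexI[of _ "decode (x i)"] decode_sol_space) auto
qed

text \<open>The decoded eigenfunctions for l form a basis. They span because a solution minus its
  W-projection onto them is W-orthogonal to all eigenfunctions, for other eigenvalues by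
  \<open>eigensystem_orthogonal\<close>, and so vanishes by completeness.\<close>

lemma multiplicity_eigensystem:
  assumes es: "eigensystem (a - 1 / f 0) z b k x \<mu>"
  shows "multiplicity_eig N \<omega> (bc13 a z b) (of_real l) = card {i. i < k \<and> \<mu> i = l}"
proof -
  define I where "I = {i. i < k \<and> \<mu> i = l}"
  define d where "d = (\<lambda>i. decode (x i))"
  have [simp]: "finite I" by (simp add: I_def)
  have Wd: "W_form (d i) v = W_form (x i) v" for i v
    unfolding W_form_def by (rule sum.cong) (auto simp: d_def decode_def)
  have Wlin: "W_form (lincomb c d J) (x j) = c j" if "finite J" "J \<subseteq> I" "j \<in> J" for c J j
  proof -
    have "W_form (lincomb c d J) (x j) = (\<Sum>i\<in>J. if i = j then c j else 0)"
      unfolding W.lincomb Wd by (rule sum.cong) (use eigensystemD(3)[OF es] that in \<open>auto simp: I_def subset_iff\<close>)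
    then show ?thesis using that by simp
  qed
  \<comment> \<open>Dimension is a matter of the set of vectors, so no two of them may
    coincide.\<close>
  have inj: "inj_on d I"
  proof (rule inj_onI, rule ccontr)
    fix i j assume ij: "i \<in> I" "j \<in> I" "d i = d j" "i \<noteq> j"
    then have "W_form (x i) (x j) = W_form (x j) (x j)" by (metis Wd)
    then show False using ij eigensystemD(3)[OF es] by (auto simp: I_def)
  qed
  have "seq.dim (sol_space N \<omega> (bc13 a z b) (of_real l)) = card I"
  proof (rule seq.dim_unique[of "d ` I"])
    show "d ` I \<subseteq> sol_space N \<omega> (bc13 a z b) (of_real l)"
      unfolding d_def using eigensystemD(1,2)[OF es] by (auto simp: I_def intro!: decode_sol_space)
    show "card (d ` I) = card I" by (rule card_image[OF inj])
    show "sol_space N \<omega> (bc13 a z b) (of_real l) \<subseteq> seq.span (d ` I)"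
    proof
      fix y assume y: "y \<in> sol_space N \<omega> (bc13 a z b) (of_real l)"
      define v where "v = encode y"
      have sol: "solution (a - 1 / f 0) z b (of_real l) v" using y by (simp add: v_def sol_space_iff)
      define c where "c = (\<lambda>i. W_form v (x i))"
      define r where "r = (\<lambda>n. (-1) * lincomb c x I n + v n)"
      have "solution (a - 1 / f 0) z b (of_real l) (lincomb c x I)"
        by (rule solution_lincomb) (use eigensystemD(2)[OF es] in \<open>auto simp: I_def\<close>)
      then have "solution (a - 1 / f 0) z b (of_real l) r"
        unfolding r_def
        by (intro solutionI, unfold H.lin W.lin) (simp add: solution_form[OF sol] solution_form algebra_simps)
      moreover have "lincomb c x I \<in> vecs (N + 2)"
        by (rule lincomb_vecs) (use eigensystemD(1)[OF es] in \<open>auto simp: I_def\<close>)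
      then have "r \<in> vecs (N + 2)" unfolding r_def v_def by (intro subspace_lin[OF subspace_vecs] encode_vecs)
      moreover have "W_form r (x j) = 0" if j: "j < k" for j
      proof (cases "j \<in> I")
        case True
        have "W_form (lincomb c x I) (x j) = (\<Sum>i\<in>I. if i = j then c j else 0)"
          unfolding W.lincomb by (rule sum.cong) (use eigensystemD(3)[OF es] j in \<open>auto simp: I_def\<close>)
        then show ?thesis using True unfolding r_def W.lin by (simp add: c_def)
      next
        case False
        then have "W_form v (x j) = 0" using j by (intro eigensystem_orthogonal[OF es sol]) (auto simp: I_def)
        moreover have "W_form (lincomb c x I) (x j) = 0"
          unfolding W.lincomb by (rule sum.neutral) (use eigensystemD(3)[OF es] False j in \<open>auto simp: I_def\<close>)
        ultimately show ?thesis unfolding r_def W.lin by simp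
      qed
      ultimately have "r = 0" by (rule eigensystemD(5)[OF es])
      then have "v = lincomb c x I" by (simp add: r_def fun_eq_iff)
      then have "decode v = lincomb c d I" by (simp add: decode_lincomb d_def)
      moreover have "decode v = y" unfolding v_def using y by (intro decode_encode) (auto simp: sol_space_def)
      ultimately have "y = (\<Sum>i\<in>I. seq_scale (c i) (d i))" by (simp add: sum_seq_scale)
      then show "y \<in> seq.span (d ` I)"
        by (simp only:) (intro seq.span_sum seq.span_scale seq.span_base imageI)
    qed
    show "seq.independent (d ` I)"
    proof (rule seq.independent_if_scalars_zero)
      show "finite (d ` I)" by simp
      fix g v assume 0: "(\<Sum>v\<in>d ` I. seq_scale (g v) v) = 0" and "v \<in> d ` I"
      then obtain j where j: "j \<in> I" "v = d j" by auto
      have "lincomb (\<lambda>i. g (d i)) d I = 0"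
        using 0 by (simp add: sum.reindex[OF inj] flip: sum_seq_scale)
      then show "g v = 0" using Wlin[of I j "\<lambda>i. g (d i)"] j by simp
    qed
  qed
  then show ?thesis by (simp add: multiplicity_eig_def I_def)
qed

lemma eigenvalue_list_eigensystem:
  assumes es: "eigensystem (a - 1 / f 0) z b k x \<mu>"
  shows "eigenvalue_list N \<omega> (bc13 a z b) (map \<mu> [0..<k])"
  unfolding eigenvalue_list_def
proof (intro conjI ballI)
  show "sorted (map \<mu> [0..<k])"
    unfolding sorted_iff_nth_mono using eigensystemD(4)[OF es] by simp
  show "{\<nu>. is_eigenvalue N \<omega> (bc13 a z b) \<nu>} = of_real ` set (map \<mu> [0..<k])"
    unfolding is_eigenvalue_iff[OF es] by auto
  fix l
  have "count_list (map \<mu> [0..<k]) l = card {i. i < k \<and> \<mu> i = l}"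
  proof (induction k)
    case (Suc k)
    have "{i. i < Suc k \<and> \<mu> i = l} = {i. i < k \<and> \<mu> i = l} \<union> (if \<mu> k = l then {k} else {})"
      by (auto simp: less_Suc_eq)
    then show ?case using Suc by simp
  qed simp
  then show "count (mset (map \<mu> [0..<k])) l = multiplicity_eig N \<omega> (bc13 a z b) (of_real l)"
    unfolding count_mset multiplicity_eigensystem[OF es] .
qed

section \<open>Eigenvalues in the coordinates \<open>(p, z, b)\<close>\<close>

text \<open>The shift by 1 / f 0 puts C at the origin and turns d into the determinant of Q.\<close>

definition chart :: "real \<times> complex \<times> real \<Rightarrow> (complex^4^2) set" where
  "chart = (\<lambda>(p, z, b). bc13 (p + 1 / f 0) z b)"

definition lam :: "nat \<Rightarrow> real \<times> complex \<times> real \<Rightarrow> real" where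
  "lam n Q = nth_eigenvalue N \<omega> n (chart Q)"

definition neig :: "real \<times> complex \<times> real \<Rightarrow> nat" where
  "neig = (\<lambda>(p, z, b). N - nullity2 p z b)"

definition npi :: "real \<times> complex \<times> real \<Rightarrow> nat" where
  "npi = (\<lambda>(p, z, b). nonpos_index2 p z b)"

definition count_below :: "real \<times> complex \<times> real \<Rightarrow> real \<Rightarrow> nat" where
  "count_below Q l = card {i. i < neig Q \<and> lam i Q < l}"

lemma eigensystem_lam:
  obtains x where "eigensystem p z b (neig (p, z, b)) x (\<lambda>i. lam i (p, z, b))"
    "eigenvalue_list N \<omega> (chart (p, z, b)) (map (\<lambda>i. lam i (p, z, b)) [0..<neig (p, z, b)])"
proof -
  obtain k x \<mu> where es: "eigensystem p z b k x \<mu>" "N \<le> k + nullity2 p z b"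
    by (rule eigensystem_exists)
  then have "k + nullity2 p z b = N" by (rule eigensystem_size)
  then have k: "k = neig (p, z, b)" by (simp add: neig_def)
  have l: "eigenvalue_list N \<omega> (chart (p, z, b)) (map \<mu> [0..<k])"
    using eigenvalue_list_eigensystem[of "p + 1 / f 0" z b k x \<mu>] es by (simp add: chart_def)
  have \<mu>: "\<mu> i = lam i (p, z, b)" if "i < k" for i
    using nth_eigenvalue_eq[OF l, of i] that by (simp add: lam_def)
  have "map (\<lambda>i. lam i (p, z, b)) [0..<neig (p, z, b)] = map \<mu> [0..<k]"
    using \<mu> k by simp
  moreover have "eigensystem p z b (neig (p, z, b)) x (\<lambda>i. lam i (p, z, b))"
    using es(1) \<mu> unfolding eigensystem_def k[symmetric] by auto
  ultimately show ?thesis using l that by simp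
qed

lemma chart_eigenvalue_list:
  "eigenvalue_list N \<omega> (chart Q) (map (\<lambda>i. lam i Q) [0..<neig Q])"
  by (cases Q) (metis eigensystem_lam)

lemma chart_has_exactly_eigenvalues: "has_exactly_eigenvalues N \<omega> (chart Q) (neig Q)"
  unfolding has_exactly_eigenvalues_def using chart_eigenvalue_list[of Q]
  by (intro exI[of _ "map (\<lambda>i. lam i Q) [0..<neig Q]"]) simp

lemma chart_nth_defined: "nth_defined N \<omega> n (chart Q) \<longleftrightarrow> n < neig Q"
  using nth_defined_iff[OF chart_eigenvalue_list[of Q]] by simp

lemma lam_mono: "i \<le> j \<Longrightarrow> j < neig Q \<Longrightarrow> lam i Q \<le> lam j Q"
proof (cases Q)
  case (fields p z b)
  assume "i \<le> j" "j < neig Q"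
  moreover obtain x where "eigensystem p z b (neig (p, z, b)) x (\<lambda>i. lam i (p, z, b))"
    by (rule eigensystem_lam)
  ultimately show ?thesis unfolding fields by (intro eigensystemD(4))
qed

text \<open>Translates positions in the sorted list into values of the counting function. The guard
  matters because \<open>lam\<close> carries no information beyond the end of the list.\<close>

lemma count_below_gt_iff: "n < count_below Q l \<longleftrightarrow> n < neig Q \<and> lam n Q < l"
proof
  assume *: "n < neig Q \<and> lam n Q < l"
  have "{..n} \<subseteq> {i. i < neig Q \<and> lam i Q < l}"
    using * by (auto intro: le_less_trans[OF lam_mono])
  then have "card {..n} \<le> count_below Q l" unfolding count_below_def by (intro card_mono) auto
  then show "n < count_below Q l" by simp
next
  assume *: "n < count_below Q l"
  show "n < neig Q \<and> lam n Q < l"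
  proof (rule ccontr)
    assume neg: "\<not> (n < neig Q \<and> lam n Q < l)"
    have "{i. i < neig Q \<and> lam i Q < l} \<subseteq> {..<n}"
    proof
      fix i assume i: "i \<in> {i. i < neig Q \<and> lam i Q < l}"
      show "i \<in> {..<n}"
      proof (rule ccontr)
        assume "i \<notin> {..<n}"
        then have "n \<le> i" by simp
        then show False using i neg lam_mono[of n i Q] by auto
      qed
    qed
    then have "count_below Q l \<le> card {..<n}" unfolding count_below_def by (intro card_mono) auto
    then show False using * by simp
  qed
qed

lemma count_below_le: "count_below Q l \<le> neig Q"
  using card_mono[of "{..<neig Q}" "{i. i < neig Q \<and> lam i Q < l}"] by (auto simp: count_below_def)

lemma eventually_count_below:
  assumes l: "\<forall>i<neig Q0. lam i Q0 \<noteq> l"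
  shows "\<forall>\<^sub>F Q in nhds Q0. count_below Q l + npi Q = count_below Q0 l + npi Q0"
proof (cases Q0)
  case (fields p z b)
  obtain x where es: "eigensystem p z b (neig Q0) x (\<lambda>i. lam i Q0)"
    using eigensystem_lam[of p z b] fields by metis
  have "N \<le> neig Q0 + nullity2 p z b" using fields by (simp add: neig_def)
  from eigenvalue_count_local[OF es this l[rule_format]]
  obtain \<delta> where "\<delta> > 0" and \<delta>: "\<forall>p' z' b' k' x' \<mu>'. eigensystem p' z' b' k' x' \<mu>' \<longrightarrow> N \<le> k' + nullity2 p' z' b' \<longrightarrow>
      \<bar>p' - p\<bar> < \<delta> \<longrightarrow> cmod (z' - z) < \<delta> \<longrightarrow> \<bar>b' - b\<bar> < \<delta> \<longrightarrow>
      card {i. i < k' \<and> \<mu>' i < l} + nonpos_index2 p' z' b' = card {i. i < neig Q0 \<and> lam i Q0 < l} + nonpos_index2 p z b"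
    by blast
  have "((\<lambda>Q. fst Q) \<longlongrightarrow> fst Q0) (nhds Q0)" "((\<lambda>Q. fst (snd Q)) \<longlongrightarrow> fst (snd Q0)) (nhds Q0)"
    "((\<lambda>Q. snd (snd Q)) \<longlongrightarrow> snd (snd Q0)) (nhds Q0)"
    by (intro tendsto_fst tendsto_snd filterlim_ident)+
  then have "\<forall>\<^sub>F Q in nhds Q0. dist (fst Q) p < \<delta>" "\<forall>\<^sub>F Q in nhds Q0. dist (fst (snd Q)) z < \<delta>"
    "\<forall>\<^sub>F Q in nhds Q0. dist (snd (snd Q)) b < \<delta>"
    using \<open>\<delta> > 0\<close> fields by (auto dest: tendstoD)
  then show ?thesis
  proof eventually_elim
    case (elim Q)
    obtain p' z' b' where Q: "Q = (p', z', b')" by (cases Q)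
    obtain x' where es': "eigensystem p' z' b' (neig Q) x' (\<lambda>i. lam i Q)"
      using eigensystem_lam[of p' z' b'] Q by metis
    have "N \<le> neig Q + nullity2 p' z' b'" using Q by (simp add: neig_def)
    then show ?case
      using \<delta>[rule_format, OF es'] elim Q fields by (simp add: dist_norm count_below_def npi_def)
  qed
qed

section \<open>Limits and monotonicity from the counting function\<close>

lemma spectrum_gap:
  fixes a c :: real
  assumes "a < c"
  shows "\<exists>l. a < l \<and> l < c \<and> (\<forall>i<neig Q. lam i Q \<noteq> l)"
proof -
  have "infinite ({a<..<c} - (\<lambda>i. lam i Q) ` {..<neig Q})"
    using assms by (intro Diff_infinite_finite) auto
  then obtain l where "l \<in> {a<..<c} - (\<lambda>i. lam i Q) ` {..<neig Q}"
    by (metis finite.emptyI ex_in_conv)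
  then show ?thesis by auto
qed

text \<open>Near Q0 the count at a level off the spectrum exceeds that of Q0 by
  \<open>npi Q0 - npi Q\<close>, so the eigenvalue of index n is continued by the one whose index is
  shifted by this difference, namely m.\<close>

lemma lam_tendsto:
  assumes n: "n < neig Q0" and ev: "\<forall>\<^sub>F Q in at Q0 within S. m + npi Q = n + npi Q0"
  shows "(lam m \<longlongrightarrow> lam n Q0) (at Q0 within S)"
proof (rule order_tendstoI)
  have count: "\<forall>\<^sub>F Q in at Q0 within S. count_below Q l + npi Q = count_below Q0 l + npi Q0"
    if "\<forall>i<neig Q0. lam i Q0 \<noteq> l" for l
    using eventually_count_below[OF that]
    by (simp add: eventually_at_filter eventually_mono)
  have upper: "\<forall>\<^sub>F Q in at Q0 within S. m < neig Q \<and> lam m Q < u" if "lam n Q0 < u" for u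
  proof -
    obtain l where l: "lam n Q0 < l" "l < u" "\<forall>i<neig Q0. lam i Q0 \<noteq> l"
      using spectrum_gap[OF \<open>lam n Q0 < u\<close>, of Q0] by blast
    have "n < count_below Q0 l" using n l by (simp add: count_below_gt_iff)
    from count[OF l(3)] ev show ?thesis
    proof eventually_elim
      case (elim Q)
      then have "m < count_below Q l" using \<open>n < count_below Q0 l\<close> by linarith
      then show ?case using l(2) by (simp add: count_below_gt_iff)
    qed
  qed
  show "\<forall>\<^sub>F Q in at Q0 within S. lam m Q < u" if "lam n Q0 < u" for u
    using upper[OF that] by (auto elim: eventually_mono)
  show "\<forall>\<^sub>F Q in at Q0 within S. u < lam m Q" if "u < lam n Q0" for u
  proof -
    obtain l where l: "u < l" "l < lam n Q0" "\<forall>i<neig Q0. lam i Q0 \<noteq> l"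
      using spectrum_gap[OF \<open>u < lam n Q0\<close>, of Q0] by blast
    have "\<not> n < count_below Q0 l" using l by (simp add: count_below_gt_iff)
    \<comment> \<open>A count of at most m could also mean that Q has no eigenvalue of index m; the
      upper bound, taken with an arbitrary margin 1, excludes this.\<close>
    from count[OF l(3)] ev upper[of "lam n Q0 + 1", simplified] show ?thesis
    proof eventually_elim
      case (elim Q)
      then have "\<not> m < count_below Q l" using \<open>\<not> n < count_below Q0 l\<close> by linarith
      then show ?case using l(1) elim(3) by (auto simp: count_below_gt_iff)
    qed
  qed
qed

text \<open>At least \<open>npi Q0 - npi Q\<close> eigenvalues of Q near Q0 lie below any prescribed
  level, and index m is among them.\<close>

lemma lam_at_bot:
  assumes ev: "\<forall>\<^sub>F Q in at Q0 within S. m + npi Q < npi Q0"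
  shows "filterlim (lam m) at_bot (at Q0 within S)"
  unfolding filterlim_at_bot
proof
  fix Z
  obtain l where l: "Z - 1 < l" "l < Z" "\<forall>i<neig Q0. lam i Q0 \<noteq> l"
    using spectrum_gap[of "Z - 1" Z Q0] by auto
  have "\<forall>\<^sub>F Q in at Q0 within S. count_below Q l + npi Q = count_below Q0 l + npi Q0"
    using eventually_count_below[OF l(3)] by (simp add: eventually_at_filter eventually_mono)
  with ev show "\<forall>\<^sub>F Q in at Q0 within S. lam m Q \<le> Z"
  proof eventually_elim
    case (elim Q)
    then have "m < count_below Q l" by linarith
    then show ?case using l(2) by (simp add: count_below_gt_iff)
  qed
qed

text \<open>At most \<open>neig Q0 + npi Q0 - npi Q\<close> eigenvalues of Q near Q0 lie below a
  prescribed level, and index m is past them.\<close>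

lemma lam_at_top:
  assumes ev: "\<forall>\<^sub>F Q in at Q0 within S. m < neig Q \<and> neig Q0 + npi Q0 \<le> m + npi Q"
  shows "filterlim (lam m) at_top (at Q0 within S)"
  unfolding filterlim_at_top
proof
  fix Z
  obtain l where l: "Z < l" "l < Z + 1" "\<forall>i<neig Q0. lam i Q0 \<noteq> l"
    using spectrum_gap[of Z "Z + 1" Q0] by auto
  have "\<forall>\<^sub>F Q in at Q0 within S. count_below Q l + npi Q = count_below Q0 l + npi Q0"
    using eventually_count_below[OF l(3)] by (simp add: eventually_at_filter eventually_mono)
  with ev show "\<forall>\<^sub>F Q in at Q0 within S. Z \<le> lam m Q"
  proof eventually_elim
    case (elim Q)
    then have "\<not> m < count_below Q l" using count_below_le[of Q0 l] by linarith
    then show ?case using l(1) elim by (auto simp: count_below_gt_iff)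
  qed
qed

lemma lam_le:
  assumes le: "p \<le> p'" "b \<le> b'" and npi: "npi (p, z, b) = npi (p', z, b')"
    and n: "n < neig (p, z, b)" "n < neig (p', z, b')"
  shows "lam n (p, z, b) \<le> lam n (p', z, b')"
proof (rule ccontr)
  assume "\<not> lam n (p, z, b) \<le> lam n (p', z, b')"
  then obtain l where l: "lam n (p', z, b') < l" "l < lam n (p, z, b)"
      "\<forall>i<neig (p', z, b'). lam i (p', z, b') \<noteq> l"
    using spectrum_gap[of "lam n (p', z, b')" "lam n (p, z, b)" "(p', z, b')"] by auto
  obtain x where es: "eigensystem p z b (neig (p, z, b)) x (\<lambda>i. lam i (p, z, b))" by (rule eigensystem_lam)
  obtain x' where es': "eigensystem p' z b' (neig (p', z, b')) x' (\<lambda>i. lam i (p', z, b'))" by (rule eigensystem_lam)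
  have "N \<le> neig (p, z, b) + nullity2 p z b" "N \<le> neig (p', z, b') + nullity2 p' z b'"
    by (simp_all add: neig_def)
  then have "count_below (p', z, b') l \<le> count_below (p, z, b) l"
    using eigenvalue_count_mono[OF es _ es' _ le l(3)[rule_format]] npi by (simp add: count_below_def npi_def)
  moreover have "n < count_below (p', z, b') l" using l n by (simp add: count_below_gt_iff)
  moreover have "\<not> n < count_below (p, z, b) l" using l by (simp add: count_below_gt_iff)
  ultimately show False by linarith
qed

text \<open>At \<open>Q = 0\<close>, which is the point \<open>C\<close>, the boundary conditions are separated: an eigenfunction
  has \<open>x\<^sub>1 = 0\<close> and is determined by \<open>x\<^sub>0\<close>, hence all eigenvalues are simple.\<close>

lemma solution_origin_zero:
  assumes s: "solution 0 0 0 \<nu> v" and "v 0 = 0" and n: "n \<in> {1..N}"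
  shows "v n = 0"
proof -
  have "v n = 0 \<and> flux v (n - 1) = 0" if "1 \<le> n" "n \<le> N" for n
    using that
  proof (induction n rule: dec_induct)
    case base
    then show ?case using s \<open>v 0 = 0\<close> by (simp add: solution_def flux_def)
  next
    case (step n)
    then have n: "n \<in> {1..N}" "v n = 0" "flux v (n - 1) = 0" "n < N" by auto
    have "residual v n = \<nu> * of_real (w n) * v n" using s n(1) unfolding solution_def by blast
    then have "flux v n = 0" using n by (simp add: residual_def)
    then have "v (Suc n) = 0" using n f_nonzero[of n] by (simp add: flux_def)
    then show ?case using \<open>flux v n = 0\<close> by simp
  qed
  then show ?thesis using n by auto
qed

lemma lam_origin_simple:
  assumes "i < j" "j < neig (0, 0, 0)"
  shows "lam i (0, 0, 0) < lam j (0, 0, 0)"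
proof (rule ccontr)
  assume "\<not> lam i (0, 0, 0) < lam j (0, 0, 0)"
  then have eq: "lam i (0, 0, 0) = lam j (0, 0, 0)"
    using lam_mono[of i j "(0, 0, 0)"] assms by simp
  obtain x where es: "eigensystem 0 0 0 (neig (0, 0, 0)) x (\<lambda>i. lam i (0, 0, 0))" by (rule eigensystem_lam)
  have i: "i < neig (0, 0, 0)" using assms by simp
  note sol = eigensystemD(2)[OF es]
  have nz: "x j 0 \<noteq> 0"
  proof
    assume "x j 0 = 0"
    then have "\<forall>n\<in>{1..N}. x j n = 0" using solution_origin_zero[OF sol[OF assms(2)]] by blast
    then have "W_form (x j) (x j) = 0" by (simp add: W_form_zero_iff)
    then show False using eigensystemD(3)[OF es assms(2) assms(2)] by simp
  qed
  \<comment> \<open>The combination of two eigenfunctions for one eigenvalue that kills the entry 0.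
    By the recursion it vanishes at all inner points, yet its W-product with \<open>x i\<close> is
    \<open>x j 0\<close>.\<close>
  define v where "v = (\<lambda>n. x j 0 * x i n + (- x i 0) * x j n)"
  have "solution 0 0 0 (of_real (lam j (0, 0, 0))) v"
  proof (rule solutionI)
    fix y
    have v: "v = (\<lambda>n. x j 0 * x i n + (\<lambda>n. (- x i 0) * x j n) n)" by (simp add: v_def)
    show "H_form 0 0 0 v y = of_real (lam j (0, 0, 0)) * W_form v y"
      unfolding v H.lin W.lin H.scale W.scale
      using solution_form[OF sol[OF i], of y] solution_form[OF sol[OF assms(2)], of y] eq
      by (simp add: algebra_simps)
  qed
  moreover have "v 0 = 0" by (simp add: v_def)
  ultimately have "v n = 0" if "n \<in> {1..N}" for n using solution_origin_zero that by blast
  then have "W_form v (x i) = 0" by (rule W_form_null)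
  moreover have "W_form v (x i) = x j 0"
  proof -
    have v: "v = (\<lambda>n. x j 0 * x i n + (\<lambda>n. (- x i 0) * x j n) n)" by (simp add: v_def)
    show ?thesis unfolding v W.lin W.scale using eigensystemD(3)[OF es] i assms by simp
  qed
  ultimately show False using nz by simp
qed

end

section \<open>The chart is a homeomorphism onto its image\<close>

text \<open>Pluecker coordinates of the row space: a change of representative multiplies all of them
  by one determinant, so their quotients are functions on the classes.\<close>

definition minor2 :: "4 \<Rightarrow> 4 \<Rightarrow> complex^4^2 \<Rightarrow> complex" where
  "minor2 i j M = M$1$i * M$2$j - M$1$j * M$2$i"

lemma minor2_mult: "minor2 i j (T ** M) = det T * minor2 i j M"
  by (simp add: minor2_def matrix_matrix_mult_def sum_2 det_2 algebra_simps)

lemma bc_class_eqD: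
  assumes "bc_class M = bc_class M'"
  obtains c where "c \<noteq> 0" "\<And>i j. minor2 i j M = c * minor2 i j M'"
proof -
  have "M \<in> bc_class M'" using bc_class_self[of M] assms by simp
  then obtain T :: "complex^2^2" where "invertible T" "M = T ** M'" by (auto simp: bc_class_def)
  then show ?thesis using that[of "det T"] by (simp add: minor2_mult invertible_det_nz)
qed

definition bc_matrix :: "real \<Rightarrow> complex \<Rightarrow> real \<Rightarrow> complex^4^2" where
  "bc_matrix a z b = vector [vector [1, of_real a, 0, cnj z], vector [0, z, -1, of_real b]]"

lemma bc13_eq: "bc13 a z b = bc_class (bc_matrix a z b)"
  by (simp add: bc13_def bc_matrix_def)

lemma bc_matrix_full_rank: "bc_matrix a z b \<in> full_rank"
proof -
  define r where "r = (vector [1, of_real a, 0, cnj z] :: complex^4)"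
  define s where "s = (vector [0, z, -1, of_real b] :: complex^4)"
  have "rows (bc_matrix a z b) = (\<lambda>i. row i (bc_matrix a z b)) ` UNIV"
    by (auto simp: rows_def)
  also have "\<dots> = {r, s}"
    by (simp add: UNIV_2 row_def bc_matrix_def r_def s_def vec_lambda_eta)
  finally have "rows (bc_matrix a z b) = {r, s}" .
  moreover have "s $ 3 = -1" "s $ 1 = 0" "r $ 1 = 1" by (simp_all add: r_def s_def)
  then have "s \<noteq> 0" "r \<noteq> s" "r \<noteq> k *s s" for k by (metis zero_index zero_neq_neg_one, metis zero_neq_one,
      metis mult_zero_right vector_smult_component zero_neq_one)
  then have "vec.independent {r, s}"
    by (auto simp: vec.independent_insert vec.span_singleton)
  then have "vec.dim {r, s} = card {r, s}" by (rule vec.dim_eq_card_independent)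
  ultimately have "rank (bc_matrix a z b) = 2"
    using \<open>r \<noteq> s\<close> by (simp add: row_rank_def_gen)
  then show ?thesis by (simp add: full_rank_def)
qed

lemma bc13_BC: "bc13 a z b \<in> BC"
proof -
  have "left_block (bc_matrix a z b) ** J_mat ** conj_transpose (left_block (bc_matrix a z b))
      = right_block (bc_matrix a z b) ** J_mat ** conj_transpose (right_block (bc_matrix a z b))"
    by (simp add: vec_eq_iff forall_2 left_block_def right_block_def bc_matrix_def J_mat_def
        conj_transpose_def matrix_matrix_mult_def sum_2)
  then show ?thesis unfolding bc13_eq BC_def using bc_matrix_full_rank by blast
qed

lemma vector2_eq: "(vector [a, b] :: 'a::zero^2) = (\<chi> i. if i = 1 then a else b)"
  by (simp add: vec_eq_iff forall_2)

lemma vector4_eq: "(vector [a, b, c, d] :: 'a::zero^4) = (\<chi> i. if i = 1 then a else if i = 2 then b else if i = 3 then c else d)"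
  by (simp add: vec_eq_iff forall_4)

lemma continuous_bc_matrix:
  assumes "continuous_on S a" "continuous_on S z" "continuous_on S b"
  shows "continuous_on S (\<lambda>x. bc_matrix (a x) (z x) (b x))"
proof -
  have r: "continuous_on S (\<lambda>x. vector [1, of_real (a x), 0, cnj (z x)] :: complex^4)"
    unfolding vector4_eq
  proof (rule continuous_on_vec_lambda)
    show "continuous_on S (\<lambda>x. if i = 1 then 1 else if i = 2 then of_real (a x) else if i = 3 then 0 else cnj (z x))" for i :: 4
      using assms by (cases "i = 1"; cases "i = 2"; cases "i = 3") (auto intro!: continuous_intros)
  qed
  have s: "continuous_on S (\<lambda>x. vector [0, z x, -1, of_real (b x)] :: complex^4)"
    unfolding vector4_eq
  proof (rule continuous_on_vec_lambda)
    show "continuous_on S (\<lambda>x. if i = 1 then 0 else if i = 2 then z x else if i = 3 then -1 else of_real (b x))" for i :: 4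
      using assms by (cases "i = 1"; cases "i = 2"; cases "i = 3") (auto intro!: continuous_intros)
  qed
  show ?thesis unfolding bc_matrix_def vector2_eq
  proof (rule continuous_on_vec_lambda)
    show "continuous_on S (\<lambda>x. if i = 1 then vector [1, of_real (a x), 0, cnj (z x)] else vector [0, z x, -1, of_real (b x)] :: complex^4)" for i :: 2
      using r s by (cases "i = 1") auto
  qed
qed

context sl_problem
begin

text \<open>On the chart the minor of columns 1 and 3 is -1, and those of columns 2 and 3, 1 and 2,
  1 and 4 are - a, z and b, which explains the signs.\<close>

definition chart_inv :: "complex^4^2 \<Rightarrow> real \<times> complex \<times> real" where
  "chart_inv M = (Re (minor2 2 3 M / minor2 1 3 M) - 1 / f 0, - minor2 1 2 M / minor2 1 3 M,
     Re (- minor2 1 4 M / minor2 1 3 M))"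

lemma chart_eq: "chart (p, z, b) = bc_class (bc_matrix (p + 1 / f 0) z b)"
  by (simp add: chart_def bc13_eq)

lemma chart_inv_bc_matrix:
  "minor2 1 3 (bc_matrix a z b) = -1" "chart_inv (bc_matrix a z b) = (a - 1 / f 0, z, b)"
  by (simp_all add: chart_inv_def minor2_def bc_matrix_def)

lemma bc_class_chart_inv:
  assumes "bc_class M = bc_class M'"
  shows "minor2 1 3 M = 0 \<longleftrightarrow> minor2 1 3 M' = 0" "chart_inv M = chart_inv M'"
proof -
  obtain c where "c \<noteq> 0" "\<And>i j. minor2 i j M = c * minor2 i j M'" using bc_class_eqD[OF assms] by blast
  then show "minor2 1 3 M = 0 \<longleftrightarrow> minor2 1 3 M' = 0" "chart_inv M = chart_inv M'"
    by (simp_all add: chart_inv_def)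
qed

lemma chart_inj: "chart Q = chart Q' \<longleftrightarrow> Q = Q'"
proof
  assume eq: "chart Q = chart Q'"
  obtain p z b p' z' b' where Q: "Q = (p, z, b)" "Q' = (p', z', b')" by (cases Q, cases Q')
  have "chart_inv (bc_matrix (p + 1 / f 0) z b) = chart_inv (bc_matrix (p' + 1 / f 0) z' b')"
    using eq unfolding Q chart_eq by (rule bc_class_chart_inv)
  then show "Q = Q'" by (simp add: Q chart_inv_bc_matrix)
qed simp

lemma chart_BC: "chart Q \<in> BC"
  by (cases Q) (simp add: chart_def bc13_BC)

text \<open>The matrices with nonzero minor whose coordinates lie in U form an open set that is a
  union of classes, so their image is open in the quotient. Taking real parts in
  \<open>chart_inv\<close> does no harm, as membership is only claimed for points of the
  chart.\<close>

lemma openin_chart_image: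
  assumes "open U"
  obtains T where "openin BC_top T" "\<And>Q. chart Q \<in> T \<longleftrightarrow> Q \<in> U"
proof -
  define D where "D = {M :: complex^4^2. minor2 1 3 M \<noteq> 0}"
  define G where "G = {M \<in> D. chart_inv M \<in> U}"
  have minor_cont: "continuous_on S (minor2 i j)" for S i j
    unfolding minor2_def by (intro continuous_intros)
  have "D = - {M. minor2 1 3 M = 0}" by (auto simp: D_def)
  moreover have "closed {M. minor2 1 3 M = 0}"
    by (intro closed_Collect_eq minor_cont continuous_on_const)
  ultimately have "open D" by (metis open_Compl)
  moreover have "continuous_on D chart_inv"
    unfolding chart_inv_def[abs_def] by (intro continuous_intros minor_cont) (auto simp: D_def)
  ultimately have "open (D \<inter> chart_inv -` U)"
    using assms by (metis continuous_on_open_vimage Int_commute)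
  then have "open G" by (simp add: G_def vimage_def Int_def)
  define T where "T = bc_class ` (G \<inter> full_rank)"
  have inv: "M \<in> G \<longleftrightarrow> M' \<in> G" if "bc_class M = bc_class M'" for M M'
    using bc_class_chart_inv[OF that] by (simp add: G_def D_def)
  have mem: "bc_class M \<in> T \<longleftrightarrow> M \<in> G" if "M \<in> full_rank" for M
  proof
    assume "bc_class M \<in> T"
    then obtain M' where M': "M' \<in> G" "bc_class M = bc_class M'" by (auto simp: T_def)
    then show "M \<in> G" using inv[OF M'(2)] by simp
  qed (use that in \<open>simp add: T_def\<close>)
  then have "{M \<in> full_rank. bc_class M \<in> T} = full_rank \<inter> G" by blast
  then have "openin rank2_quotient T"
    unfolding openin_rank2_quotient using \<open>open G\<close> by (auto simp: T_def openin_open_Int)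
  then have "openin BC_top (T \<inter> BC)" unfolding BC_top_def by (rule openin_subtopology_Int)
  moreover have "chart Q \<in> T \<inter> BC \<longleftrightarrow> Q \<in> U" for Q
  proof -
    obtain p z b where Q: "Q = (p, z, b)" by (cases Q)
    define M where "M = bc_matrix (p + 1 / f 0) z b"
    have "M \<in> G \<longleftrightarrow> Q \<in> U" by (simp add: G_def D_def M_def chart_inv_bc_matrix Q)
    moreover have "chart Q = bc_class M" by (simp add: Q chart_eq M_def)
    moreover have "bc_class M \<in> T \<longleftrightarrow> M \<in> G"
      by (rule mem) (simp add: M_def bc_matrix_full_rank)
    ultimately show ?thesis using chart_BC[of Q] by simp
  qed
  ultimately show ?thesis by (rule that)
qed

lemma continuous_chart: "continuous_map euclidean BC_top chart"
proof -
  have "continuous_on UNIV (\<lambda>Q. bc_matrix (fst Q + 1 / f 0) (fst (snd Q)) (snd (snd Q)))"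
    by (intro continuous_bc_matrix continuous_intros)
  then have "continuous_map euclidean (top_of_set full_rank)
      (\<lambda>Q. bc_matrix (fst Q + 1 / f 0) (fst (snd Q)) (snd (snd Q)))"
    using bc_matrix_full_rank by (auto simp: continuous_map_in_subtopology)
  then have "continuous_map euclidean rank2_quotient
      (bc_class \<circ> (\<lambda>Q. bc_matrix (fst Q + 1 / f 0) (fst (snd Q)) (snd (snd Q))))"
    using quotient_imp_continuous_map[OF quotient_map_bc_class] by (rule continuous_map_compose)
  moreover have "bc_class \<circ> (\<lambda>Q. bc_matrix (fst Q + 1 / f 0) (fst (snd Q)) (snd (snd Q))) = chart"
    by (auto simp: fun_eq_iff chart_eq)
  ultimately show ?thesis using chart_BC by (auto simp: BC_top_def continuous_map_in_subtopology)
qed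

text \<open>Continuity of the chart gives one direction, openness the other, and injectivity matches
  punctured neighbourhoods. All limits can then be taken in \<real> \<times> \<complex> \<times>
  \<real>.\<close>

lemma near_chart: "near (chart Q0) (chart ` S) = filtermap chart (at Q0 within S)"
  unfolding filter_eq_iff
proof
  fix P
  have top: "chart Q0 \<in> topspace BC_top" using chart_BC by (simp add: topspace_BC_top)
  show "eventually P (near (chart Q0) (chart ` S)) \<longleftrightarrow> eventually P (filtermap chart (at Q0 within S))"
  proof
    assume "eventually P (near (chart Q0) (chart ` S))"
    then obtain T where T: "openin BC_top T" "chart Q0 \<in> T" "\<And>A. A \<in> T \<Longrightarrow> A \<in> chart ` S \<Longrightarrow> A \<noteq> chart Q0 \<Longrightarrow> P A"
      using top unfolding near_def eventually_atin_within by blast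
    have "openin euclidean {Q \<in> topspace euclidean. chart Q \<in> T}"
      by (rule openin_continuous_map_preimage[OF continuous_chart T(1)])
    then have "open {Q. chart Q \<in> T}" by simp
    then show "eventually P (filtermap chart (at Q0 within S))"
      unfolding eventually_filtermap eventually_at_topological
      using T by (intro exI[of _ "{Q. chart Q \<in> T}"]) (auto simp: chart_inj)
  next
    assume "eventually P (filtermap chart (at Q0 within S))"
    then obtain U where U: "open U" "Q0 \<in> U" "\<And>Q. Q \<in> U \<Longrightarrow> Q \<noteq> Q0 \<Longrightarrow> Q \<in> S \<Longrightarrow> P (chart Q)"
      unfolding eventually_filtermap eventually_at_topological by blast
    obtain T where T: "openin BC_top T" "\<And>Q. chart Q \<in> T \<longleftrightarrow> Q \<in> U" using openin_chart_image[OF U(1)] by blast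
    show "eventually P (near (chart Q0) (chart ` S))"
      unfolding near_def eventually_atin_within using T U by (intro disjI2 exI[of _ T]) blast
  qed
qed

lemma filterlim_near_chart:
  "filterlim (nth_eigenvalue N \<omega> n) F (near (chart Q0) (chart ` S)) \<longleftrightarrow> filterlim (lam n) F (at Q0 within S)"
  unfolding near_chart filterlim_filtermap lam_def[abs_def] by simp

lemma nth_continuous_on_chart:
  assumes def: "\<And>Q. Q \<in> S \<Longrightarrow> n < neig Q"
    and npi: "\<And>Q0. Q0 \<in> S \<Longrightarrow> \<forall>\<^sub>F Q in at Q0 within S. npi Q = npi Q0"
  shows "nth_continuous_on N \<omega> n (chart ` S)"
proof -
  have "limitin euclideanreal (nth_eigenvalue N \<omega> n) (nth_eigenvalue N \<omega> n \<A>) (atin (subtopology BC_top (chart ` S)) \<A>)"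
    if "\<A> \<in> chart ` S" for \<A>
  proof -
    obtain Q0 where Q0: "Q0 \<in> S" "\<A> = chart Q0" using \<open>\<A> \<in> chart ` S\<close> by auto
    have "(lam n \<longlongrightarrow> lam n Q0) (at Q0 within S)"
      by (rule lam_tendsto[OF def[OF Q0(1)]]) (use npi[OF Q0(1)] in simp)
    then have "(nth_eigenvalue N \<omega> n \<longlongrightarrow> nth_eigenvalue N \<omega> n \<A>) (near \<A> (chart ` S))"
      unfolding Q0(2) filterlim_near_chart by (simp add: lam_def)
    then show ?thesis
      using that by (simp add: atin_subtopology_within near_def)
  qed
  then have "continuous_map (subtopology BC_top (chart ` S)) euclideanreal (nth_eigenvalue N \<omega> n)"
    unfolding continuous_map_atin topspace_subtopology by blast
  moreover have "\<forall>\<A>\<in>chart ` S. nth_defined N \<omega> n \<A>"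
    using def by (simp add: chart_nth_defined)
  ultimately show ?thesis by (simp add: nth_continuous_on_def)
qed


section \<open>The regions and the limits\<close>

definition detQ :: "real \<times> complex \<times> real \<Rightarrow> real" where
  "detQ Q = fst Q * snd (snd Q) - (cmod (fst (snd Q)))\<^sup>2"

definition Sing where "Sing = {Q. detQ Q = 0}"
definition Neg where "Neg = {Q. detQ Q < 0}"
definition Sing_r where "Sing_r = {Q. detQ Q = 0 \<and> fst Q \<ge> 0 \<and> snd (snd Q) \<ge> 0} - {(0, 0, 0)}"
definition Sing_l where "Sing_l = {Q. detQ Q = 0 \<and> fst Q \<le> 0 \<and> snd (snd Q) \<le> 0} - {(0, 0, 0)}"
definition Pos_r where "Pos_r = {Q. detQ Q > 0 \<and> fst Q \<ge> 0 \<and> snd (snd Q) \<ge> 0}"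
definition Pos_l where "Pos_l = {Q. detQ Q > 0 \<and> fst Q \<le> 0 \<and> snd (snd Q) \<le> 0}"

lemma bc13_chart: "bc13 a z b = chart (a - 1 / f 0, z, b)"
  by (simp add: chart_def)

lemma region_chart: "{bc13 a z b | a z b. P (a - 1 / f 0, z, b)} = chart ` {Q. P Q}"
proof (intro equalityI subsetI)
  fix \<A> assume "\<A> \<in> chart ` {Q. P Q}"
  then obtain p z b where "P (p, z, b)" "\<A> = bc13 (p + 1 / f 0) z b" by (auto simp: chart_def)
  moreover have "p + 1 / f 0 - 1 / f 0 = p" by simp
  ultimately show "\<A> \<in> {bc13 a z b | a z b. P (a - 1 / f 0, z, b)}" by (metis (mono_tags, lifting) mem_Collect_eq)
next
  fix \<A> assume "\<A> \<in> {bc13 a z b | a z b. P (a - 1 / f 0, z, b)}"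
  then obtain a z b where "P (a - 1 / f 0, z, b)" "\<A> = chart (a - 1 / f 0, z, b)"
    unfolding bc13_chart by blast
  then show "\<A> \<in> chart ` {Q. P Q}" by blast
qed

lemma bcC_chart: "bcC \<omega> = chart (0, 0, 0)"
  by (simp add: bcC_eq chart_def)

lemma regions_chart:
  "O13 = chart ` UNIV" "B13 \<omega> = chart ` Sing" "B13_minus \<omega> = chart ` Neg"
  "B13r \<omega> = chart ` Sing_r" "B13l \<omega> = chart ` Sing_l"
  "B13r_plus \<omega> = chart ` Pos_r" "B13l_plus \<omega> = chart ` Pos_l"
proof -
  have diff: "chart ` A - {chart (0, 0, 0)} = chart ` (A - {(0, 0, 0)})" for A
    by (auto simp: chart_inj)
  show "O13 = chart ` UNIV" using region_chart[of "\<lambda>_. True"] by (simp add: O13_def)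
  show "B13 \<omega> = chart ` Sing"
    using region_chart[of "\<lambda>Q. detQ Q = 0"] by (simp add: B13_def Sing_def d13_def detQ_def)
  show "B13_minus \<omega> = chart ` Neg"
    using region_chart[of "\<lambda>Q. detQ Q < 0"] by (simp add: B13_minus_def Neg_def d13_def detQ_def)
  show "B13r \<omega> = chart ` Sing_r"
    using region_chart[of "\<lambda>Q. detQ Q = 0 \<and> fst Q \<ge> 0 \<and> snd (snd Q) \<ge> 0"]
    by (simp add: B13r_def Sing_r_def d13_def detQ_def bcC_chart flip: diff)
  show "B13l \<omega> = chart ` Sing_l"
    using region_chart[of "\<lambda>Q. detQ Q = 0 \<and> fst Q \<le> 0 \<and> snd (snd Q) \<le> 0"]
    by (simp add: B13l_def Sing_l_def d13_def detQ_def bcC_chart flip: diff)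
  show "B13r_plus \<omega> = chart ` Pos_r"
    using region_chart[of "\<lambda>Q. detQ Q > 0 \<and> fst Q \<ge> 0 \<and> snd (snd Q) \<ge> 0"]
    by (simp add: B13r_plus_def Pos_r_def d13_def detQ_def)
  show "B13l_plus \<omega> = chart ` Pos_l"
    using region_chart[of "\<lambda>Q. detQ Q > 0 \<and> fst Q \<le> 0 \<and> snd (snd Q) \<le> 0"]
    by (simp add: B13l_plus_def Pos_l_def d13_def detQ_def)
qed

lemma neig_eq: "neig Q = (if detQ Q \<noteq> 0 then N else if fst Q = 0 \<and> snd (snd Q) = 0 then N - 2 else N - 1)"
  by (cases Q) (simp add: neig_def nullity2_def detQ_def)

lemma npi_eq: "npi Q = (if detQ Q < 0 then 1 else if detQ Q > 0 then (if fst Q > 0 then 0 else 2)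
    else if fst Q + snd (snd Q) > 0 then 1 else 2)"
  by (cases Q) (simp add: npi_def nonpos_index2_def detQ_def)

lemma detQ_pos_imp: "detQ Q > 0 \<Longrightarrow> fst Q \<noteq> 0"
  by (auto simp: detQ_def)

lemma Sing_zero:
  assumes "detQ Q = 0" "fst Q + snd (snd Q) = 0"
  shows "Q = (0, 0, 0)"
proof -
  obtain p z b where Q: "Q = (p, z, b)" by (cases Q)
  have b: "b = - p" and d: "p * b = (cmod z)\<^sup>2" using assms by (simp_all add: Q detQ_def)
  then have "p * p + (cmod z)\<^sup>2 = 0" by simp
  then have "p = 0" "z = 0" by (simp_all add: add_nonneg_eq_0_iff)
  then show ?thesis using b Q by simp
qed

text \<open>The table behind all limits: passing from one region to another shifts indices by the
  difference of \<open>npi\<close>, and \<open>neig\<close> says which indices exist. On the cone of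
  singular Q without its vertex the trace cannot vanish, so its sign tells the two halves
  apart.\<close>

lemma index_facts:
  "Q \<in> Neg \<Longrightarrow> neig Q = N" "Q \<in> Neg \<Longrightarrow> npi Q = 1"
  "Q \<in> Pos_r \<Longrightarrow> neig Q = N" "Q \<in> Pos_r \<Longrightarrow> npi Q = 0"
  "Q \<in> Pos_l \<Longrightarrow> neig Q = N" "Q \<in> Pos_l \<Longrightarrow> npi Q = 2"
  "Q \<in> Sing_r \<Longrightarrow> neig Q = N - 1" "Q \<in> Sing_r \<Longrightarrow> npi Q = 1"
  "Q \<in> Sing_l \<Longrightarrow> neig Q = N - 1" "Q \<in> Sing_l \<Longrightarrow> npi Q = 2"
  "neig (0, 0, 0) = N - 2" "npi (0, 0, 0) = 2"
proof -
  have sr: "fst Q + snd (snd Q) > 0" if "Q \<in> Sing_r"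
    using Sing_zero[of Q] that unfolding Sing_r_def by fastforce
  have sl: "fst Q + snd (snd Q) < 0" if "Q \<in> Sing_l"
    using Sing_zero[of Q] that unfolding Sing_l_def by fastforce
  show "Q \<in> Sing_r \<Longrightarrow> neig Q = N - 1" "Q \<in> Sing_r \<Longrightarrow> npi Q = 1"
    using sr by (auto simp: neig_eq npi_eq Sing_r_def)
  show "Q \<in> Sing_l \<Longrightarrow> neig Q = N - 1" "Q \<in> Sing_l \<Longrightarrow> npi Q = 2"
    using sl by (auto simp: neig_eq npi_eq Sing_l_def)
qed (use detQ_pos_imp[of Q] in
  \<open>auto simp: neig_eq npi_eq Neg_def Pos_r_def Pos_l_def\<close>, simp_all add: detQ_def)

lemma neig_Sing: "Q \<in> Sing \<Longrightarrow> Q \<noteq> (0, 0, 0) \<Longrightarrow> neig Q = N - 1"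
  using Sing_zero[of Q] by (auto simp: neig_eq Sing_def)

lemma neig_not_Sing: "Q \<notin> Sing \<Longrightarrow> neig Q = N"
  by (simp add: neig_eq Sing_def)

lemma eventually_within: "(\<And>Q. Q \<in> S \<Longrightarrow> P Q) \<Longrightarrow> eventually P (at Q0 within S)"
  by (simp add: eventually_at_filter)

lemma near_tendsto:
  assumes "n < neig Q0" "\<And>Q. Q \<in> S \<Longrightarrow> m + npi Q = n + npi Q0"
  shows "(nth_eigenvalue N \<omega> m \<longlongrightarrow> nth_eigenvalue N \<omega> n (chart Q0)) (near (chart Q0) (chart ` S))"
  unfolding filterlim_near_chart lam_def[symmetric]
  by (rule lam_tendsto[OF assms(1) eventually_within]) (rule assms)

lemma near_at_bot:
  assumes "\<And>Q. Q \<in> S \<Longrightarrow> m + npi Q < npi Q0"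
  shows "filterlim (nth_eigenvalue N \<omega> m) at_bot (near (chart Q0) (chart ` S))"
  unfolding filterlim_near_chart by (rule lam_at_bot[OF eventually_within]) (rule assms)

lemma near_at_top:
  assumes "\<And>Q. Q \<in> S \<Longrightarrow> m < neig Q \<and> neig Q0 + npi Q0 \<le> m + npi Q"
  shows "filterlim (nth_eigenvalue N \<omega> m) at_top (near (chart Q0) (chart ` S))"
  unfolding filterlim_near_chart by (rule lam_at_top[OF eventually_within]) (rule assms)

lemma continuous_on_constant_index:
  assumes "\<And>Q. Q \<in> S \<Longrightarrow> n < neig Q \<and> npi Q = c"
  shows "nth_continuous_on N \<omega> n (chart ` S)"
  by (rule nth_continuous_on_chart) (use assms in \<open>auto intro: eventually_within\<close>)

lemma nondecreasing_constant_index: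
  assumes S: "\<And>Q. Q \<in> S \<Longrightarrow> n < neig Q \<and> npi Q = c"
  shows "nondecreasing_a12 (nth_eigenvalue N \<omega> n) (chart ` S)" "nondecreasing_b22 (nth_eigenvalue N \<omega> n) (chart ` S)"
proof -
  have mem: "chart Q \<in> chart ` S \<longleftrightarrow> Q \<in> S" for Q
    by (auto simp: chart_inj)
  show "nondecreasing_a12 (nth_eigenvalue N \<omega> n) (chart ` S)" "nondecreasing_b22 (nth_eigenvalue N \<omega> n) (chart ` S)"
    unfolding nondecreasing_a12_def nondecreasing_b22_def bc13_chart mem lam_def[symmetric]
    using S by (auto intro!: lam_le)
qed

text \<open>The determinant keeps its sign nearby; where it is positive, p is nonzero and keeps its
  sign as well.\<close>

lemma npi_locally_constant:
  assumes "detQ Q0 \<noteq> 0"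
  shows "\<forall>\<^sub>F Q in at Q0 within S. npi Q = npi Q0"
proof -
  have "continuous_on UNIV detQ" unfolding detQ_def[abs_def] by (intro continuous_intros)
  then have op: "open {Q. detQ Q < 0}" "open {Q. detQ Q > 0}"
    by (intro open_Collect_less continuous_on_const; assumption)+
  have fs: "open {Q :: real \<times> complex \<times> real. fst Q > 0}" "open {Q :: real \<times> complex \<times> real. fst Q < 0}"
    by (intro open_Collect_less continuous_intros)+
  consider "detQ Q0 < 0" | "detQ Q0 > 0" "fst Q0 > 0" | "detQ Q0 > 0" "fst Q0 < 0"
    using assms detQ_pos_imp[of Q0] by linarith
  then obtain T where T: "open T" "Q0 \<in> T" "\<And>Q. Q \<in> T \<Longrightarrow> npi Q = npi Q0"
  proof cases
    case 1
    then show ?thesis using op by (intro that[of "{Q. detQ Q < 0}"]) (auto simp: npi_eq)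
  next
    case 2
    then show ?thesis using op fs
      by (intro that[of "{Q. detQ Q > 0} \<inter> {Q. fst Q > 0}"] open_Int) (auto simp: npi_eq)
  next
    case 3
    then show ?thesis using op fs
      by (intro that[of "{Q. detQ Q > 0} \<inter> {Q. fst Q < 0}"] open_Int) (auto simp: npi_eq)
  qed
  then show ?thesis unfolding eventually_at_topological by blast
qed

text \<open>Moving along \<open>Q + t I\<close> with \<open>t > 0\<close> makes all zero eigenvalues of \<open>Q\<close> positive, so that
  as many eigenvalues of the problem emerge from \<open>- \<infinity>\<close>.\<close>

lemma continuous_at_Sing_imp:
  assumes Q0: "Q0 \<in> Sing" and cont: "nth_continuous_at N \<omega> n (chart Q0)"
  defines "s \<equiv> N - neig Q0"
  shows "n < neig Q0" "s \<le> n" "lam n Q0 = lam (n - s) Q0"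
proof -
  obtain p z b where Q: "Q0 = (p, z, b)" by (cases Q0)
  have d0: "p * b = (cmod z)\<^sup>2" using Q0 by (simp add: Sing_def detQ_def Q)
  show n: "n < neig Q0" using cont by (simp add: nth_continuous_at_def chart_nth_defined)
  \<comment> \<open>For singular Q the determinant of Q + t I is t (p + b + t). With negative trace
    it changes sign at t = - (p + b), so the path stops there; with zero trace any positive length
    serves.\<close>
  define t0 where "t0 = (if p + b = 0 then 1 else \<bar>p + b\<bar>)"
  define path where "path = (\<lambda>t. (p + t, z, b + t))"
  define S where "S = path ` {0<..<t0}"
  have t0: "t0 > 0" by (simp add: t0_def)
  \<comment> \<open>On the path the matrix is regular, and \<open>npi\<close> has dropped by exactly
    the nullity s.\<close>
  have S: "npi R + s = npi Q0 \<and> neig R = N" if "R \<in> S" for R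
  proof -
    obtain t where t: "0 < t" "t < t0" "R = (p + t, z, b + t)" using \<open>R \<in> S\<close> by (auto simp: S_def path_def)
    have dR: "detQ R = t * (p + b + t)" using d0 t(3) by (simp add: detQ_def algebra_simps)
    have dQ: "detQ Q0 = 0" using d0 by (simp add: Q detQ_def)
    consider (C) "p + b = 0" | (r) "p + b > 0" | (l) "p + b < 0" by linarith
    then show ?thesis
    proof cases
      case C
      then have "p = 0" "b = 0" using Sing_zero[OF dQ] by (simp_all add: Q)
      then show ?thesis using dR dQ t N2 by (simp add: npi_eq neig_eq s_def Q)
    next
      case r
      have "p * b \<ge> 0" using d0 by simp
      then have "p \<ge> 0" using r by (auto simp: zero_le_mult_iff)
      moreover have "detQ R > 0" using r t dR by simp
      ultimately show ?thesis using dQ t r N2 by (simp add: npi_eq neig_eq s_def Q)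
    next
      case l
      then have "detQ R < 0" using t dR by (simp add: t0_def mult_less_0_iff)
      then show ?thesis using dQ l N2 by (simp add: npi_eq neig_eq s_def Q)
    qed
  qed
  have "limitin euclideanreal (nth_eigenvalue N \<omega> n) (nth_eigenvalue N \<omega> n (chart Q0))
      (atin_within BC_top (chart Q0) {\<B>. nth_defined N \<omega> n \<B>})"
    using cont by (auto simp: nth_continuous_at_def topcontinuous_at_atin atin_subtopology_within)
  moreover have "neig Q0 \<le> N" by (simp add: neig_eq)
  \<comment> \<open>Continuity of the partial function is tested only where it is defined, so the
    path has to stay there.\<close>
  then have "chart ` S \<subseteq> {\<B>. nth_defined N \<omega> n \<B>}" using S n by (auto simp: chart_nth_defined)
  ultimately have "limitin euclideanreal (nth_eigenvalue N \<omega> n) (nth_eigenvalue N \<omega> n (chart Q0))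
      (near (chart Q0) (chart ` S))"
    unfolding near_def by (rule limit_within_subset)
  then have lim: "(lam n \<longlongrightarrow> lam n Q0) (at Q0 within S)"
    by (simp add: filterlim_near_chart lam_def)
  have path: "filterlim path (at Q0 within S) (at_right 0)"
    unfolding filterlim_at
  proof
    show "\<forall>\<^sub>F t in at_right 0. path t \<in> S \<and> path t \<noteq> Q0"
      using eventually_at_right_real[OF t0]
      by (rule eventually_mono) (auto simp: S_def path_def Q)
    have "((\<lambda>t. (p + t, z, b + t)) \<longlongrightarrow> (p + 0, z, b + 0)) (at_right 0)"
      by (intro tendsto_intros)
    then show "(path \<longlongrightarrow> Q0) (at_right 0)" by (simp add: path_def Q)
  qed
  have lim': "((\<lambda>t. lam n (path t)) \<longlongrightarrow> lam n Q0) (at_right 0)"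
    by (rule filterlim_compose[OF lim path])
  \<comment> \<open>The first s eigenvalues run to -\<infinity> along the path, which excludes n <
    s. Otherwise the limit along the path is the eigenvalue of index n - s at Q0, and continuity
    equates it with that of index n.\<close>
  show "s \<le> n"
  proof (rule ccontr)
    assume "\<not> s \<le> n"
    then have "filterlim (lam n) at_bot (at Q0 within S)"
      using S by (intro lam_at_bot eventually_within) force
    then have "filterlim (\<lambda>t. lam n (path t)) at_bot (at_right 0)" using path by (rule filterlim_compose)
    then have "\<forall>\<^sub>F t in at_right 0. lam n (path t) \<le> lam n Q0 - 1" by (simp add: filterlim_at_bot)
    moreover have "\<forall>\<^sub>F t in at_right 0. lam n Q0 - 1 < lam n (path t)"
      by (rule order_tendstoD(1)[OF lim']) simp
    ultimately have "\<forall>\<^sub>F t in at_right (0::real). False" by eventually_elim simp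
    then show False by simp
  qed
  then have "(lam n \<longlongrightarrow> lam (n - s) Q0) (at Q0 within S)"
    using S n by (intro lam_tendsto eventually_within) force+
  then have "((\<lambda>t. lam n (path t)) \<longlongrightarrow> lam (n - s) Q0) (at_right 0)" using path by (rule filterlim_compose)
  then show "lam n Q0 = lam (n - s) Q0" using lim' by (intro tendsto_unique[of "at_right (0::real)"]) auto
qed

end

text \<open>The exception in (iii) is due to the limits themselves: from the two sides of the cone
  \<lambda>_n tends to \<lambda>_n and to \<lambda>_(n-1) of the limit point, and these may
  coincide. At C the comparison is with \<lambda>_(n-2), and all eigenvalues there are simple, so no
  exception arises.\<close>

theorem theorem4p3:
  fixes N :: nat and \<omega> :: sl_equation
  assumes "N \<ge> 2" and "\<omega> \<in> Omega N"
  shows "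
    (has_exactly_eigenvalues N \<omega> (bcC \<omega>) (N - 2)) \<and>
    (\<forall>\<A> \<in> B13 \<omega> - {bcC \<omega>}. has_exactly_eigenvalues N \<omega> \<A> (N - 1)) \<and>
    (\<forall>\<A> \<in> O13 - B13 \<omega>. has_exactly_eigenvalues N \<omega> \<A> N) \<and>
    \<comment> \<open>(i)\<close>
    (\<forall>n<N. nth_continuous_on N \<omega> n (O13 - B13 \<omega>)) \<and>
    \<comment> \<open>(ii)\<close>
    (\<forall>n<N. \<forall>S \<in> {B13_minus \<omega>, B13r_plus \<omega>, B13l_plus \<omega>}.
       nondecreasing_a12 (nth_eigenvalue N \<omega> n) S \<and> nondecreasing_b22 (nth_eigenvalue N \<omega> n) S) \<and>
    \<comment> \<open>(iii); at a double eigenvalue of a point other than \<open>C\<close> the jump of \<open>\<lambda>\<^sub>n\<close> has size zero\<close>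
    (\<forall>\<A> \<in> B13 \<omega>. \<forall>n<N. \<not> nth_continuous_at N \<omega> n \<A> \<or>
       (\<A> \<noteq> bcC \<omega> \<and> 0 < n \<and> n < N - 1 \<and> nth_eigenvalue N \<omega> n \<A> = nth_eigenvalue N \<omega> (n - 1) \<A>)) \<and>
    \<comment> \<open>(iiia)\<close>
    (\<forall>\<A>\<^sub>0 \<in> B13r \<omega>.
       (\<forall>n. n \<le> N - 2 \<longrightarrow>
          (nth_eigenvalue N \<omega> n \<longlongrightarrow> nth_eigenvalue N \<omega> n \<A>\<^sub>0) (near \<A>\<^sub>0 (B13_minus \<omega> \<union> B13r \<omega>))) \<and>
       filterlim (nth_eigenvalue N \<omega> (N - 1)) at_top (near \<A>\<^sub>0 (B13_minus \<omega>)) \<and>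
       filterlim (nth_eigenvalue N \<omega> 0) at_bot (near \<A>\<^sub>0 (B13r_plus \<omega>)) \<and>
       (\<forall>n. 1 \<le> n \<and> n \<le> N - 1 \<longrightarrow>
          (nth_eigenvalue N \<omega> n \<longlongrightarrow> nth_eigenvalue N \<omega> (n - 1) \<A>\<^sub>0) (near \<A>\<^sub>0 (B13r_plus \<omega>)))) \<and>
    \<comment> \<open>(iiib)\<close>
    (\<forall>\<A>\<^sub>0 \<in> B13l \<omega>.
       filterlim (nth_eigenvalue N \<omega> 0) at_bot (near \<A>\<^sub>0 (B13_minus \<omega>)) \<and>
       (\<forall>n. 1 \<le> n \<and> n \<le> N - 1 \<longrightarrow>
          (nth_eigenvalue N \<omega> n \<longlongrightarrow> nth_eigenvalue N \<omega> (n - 1) \<A>\<^sub>0) (near \<A>\<^sub>0 (B13_minus \<omega>))) \<and>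
       (\<forall>n. n \<le> N - 2 \<longrightarrow>
          (nth_eigenvalue N \<omega> n \<longlongrightarrow> nth_eigenvalue N \<omega> n \<A>\<^sub>0) (near \<A>\<^sub>0 (B13l_plus \<omega> \<union> B13l \<omega>))) \<and>
       filterlim (nth_eigenvalue N \<omega> (N - 1)) at_top (near \<A>\<^sub>0 (B13l_plus \<omega>))) \<and>
    \<comment> \<open>(iiic); the range \<open>0 \<le> n \<le> N - 3\<close>, empty for \<open>N = 2\<close>, is written \<open>n + 3 \<le> N\<close>\<close>
    (filterlim (nth_eigenvalue N \<omega> 0) at_bot (near (bcC \<omega>) (B13r_plus \<omega> \<union> B13r \<omega> \<union> B13_minus \<omega>))) \<and>
    (filterlim (nth_eigenvalue N \<omega> 1) at_bot (near (bcC \<omega>) (B13r_plus \<omega>))) \<and>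
    (\<forall>n. n + 3 \<le> N \<longrightarrow>
       (nth_eigenvalue N \<omega> n \<longlongrightarrow> nth_eigenvalue N \<omega> n (bcC \<omega>)) (near (bcC \<omega>) (B13l_plus \<omega> \<union> B13l \<omega>))) \<and>
    (\<forall>n. 1 \<le> n \<and> n \<le> N - 2 \<longrightarrow>
       (nth_eigenvalue N \<omega> n \<longlongrightarrow> nth_eigenvalue N \<omega> (n - 1) (bcC \<omega>)) (near (bcC \<omega>) (B13r \<omega> \<union> B13_minus \<omega>))) \<and>
    (\<forall>n. 2 \<le> n \<and> n \<le> N - 1 \<longrightarrow>
       (nth_eigenvalue N \<omega> n \<longlongrightarrow> nth_eigenvalue N \<omega> (n - 2) (bcC \<omega>)) (near (bcC \<omega>) (B13r_plus \<omega>))) \<and>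
    (filterlim (nth_eigenvalue N \<omega> (N - 2)) at_top (near (bcC \<omega>) (B13l_plus \<omega> \<union> B13l \<omega>))) \<and>
    (filterlim (nth_eigenvalue N \<omega> (N - 1)) at_top (near (bcC \<omega>) (B13l_plus \<omega> \<union> B13_minus \<omega>))) \<and>
    \<comment> \<open>consequence\<close>
    (\<forall>n. n + 3 \<le> N \<longrightarrow>
       nth_continuous_on N \<omega> n (B13_minus \<omega> \<union> B13r \<omega>) \<and>
       nth_continuous_on N \<omega> n (B13l_plus \<omega> \<union> B13l \<omega> \<union> {bcC \<omega>})) \<and>
    (nth_continuous_on N \<omega> (N - 2) (B13_minus \<omega> \<union> B13r \<omega>)) \<and>
    (nth_continuous_on N \<omega> (N - 2) (B13l_plus \<omega> \<union> B13l \<omega>))"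
proof -
  interpret sl_problem N \<omega> by (rule sl_problem.intro) fact+
  have diff: "chart ` A - {chart (0, 0, 0)} = chart ` (A - {(0, 0, 0)})" "chart ` A - chart ` B = chart ` (A - B)" for A B
    by (auto simp: chart_inj)
  \<comment> \<open>Written as an image so that a union with {C} also becomes the image of one set
    of coordinates.\<close>
  have C: "{chart (0, 0, 0)} = chart ` {(0, 0, 0)}" by simp
  show ?thesis
  proof (intro conjI)
    show "has_exactly_eigenvalues N \<omega> (bcC \<omega>) (N - 2)"
      unfolding bcC_chart using chart_has_exactly_eigenvalues[of "(0, 0, 0)"] by (simp add: index_facts)
    show "\<forall>\<A>\<in>B13 \<omega> - {bcC \<omega>}. has_exactly_eigenvalues N \<omega> \<A> (N - 1)"
      unfolding regions_chart bcC_chart diff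
    proof
      fix \<A> assume "\<A> \<in> chart ` (Sing - {(0, 0, 0)})"
      then obtain Q where "Q \<in> Sing" "Q \<noteq> (0, 0, 0)" "\<A> = chart Q" by blast
      then show "has_exactly_eigenvalues N \<omega> \<A> (N - 1)"
        using chart_has_exactly_eigenvalues[of Q] neig_Sing[of Q] by simp
    qed
    show "\<forall>\<A>\<in>O13 - B13 \<omega>. has_exactly_eigenvalues N \<omega> \<A> N"
      unfolding regions_chart diff
    proof
      fix \<A> assume "\<A> \<in> chart ` (UNIV - Sing)"
      then obtain Q where "Q \<notin> Sing" "\<A> = chart Q" by blast
      then show "has_exactly_eigenvalues N \<omega> \<A> N"
        using chart_has_exactly_eigenvalues[of Q] neig_not_Sing[of Q] by simp
    qed
    show "\<forall>n<N. nth_continuous_on N \<omega> n (O13 - B13 \<omega>)"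
      unfolding regions_chart diff
    proof (intro allI impI nth_continuous_on_chart)
      fix n Q assume "n < N" "Q \<in> UNIV - Sing"
      then show "n < neig Q" by (simp add: neig_not_Sing)
    next
      fix Q assume "Q \<in> UNIV - Sing"
      then show "\<forall>\<^sub>F R in at Q within UNIV - Sing. npi R = npi Q"
        by (intro npi_locally_constant) (simp add: Sing_def)
    qed
    show "\<forall>n<N. \<forall>S\<in>{B13_minus \<omega>, B13r_plus \<omega>, B13l_plus \<omega>}.
        nondecreasing_a12 (nth_eigenvalue N \<omega> n) S \<and> nondecreasing_b22 (nth_eigenvalue N \<omega> n) S"
    proof (intro allI impI ballI)
      fix n S assume n: "n < N" and "S \<in> {B13_minus \<omega>, B13r_plus \<omega>, B13l_plus \<omega>}"
      then consider "S = chart ` Neg" | "S = chart ` Pos_r" | "S = chart ` Pos_l"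
        by (auto simp: regions_chart)
      then obtain R c where "S = chart ` R" "\<And>Q. Q \<in> R \<Longrightarrow> n < neig Q \<and> npi Q = c"
        by cases (use n in \<open>force simp: index_facts\<close>)+
      then show "nondecreasing_a12 (nth_eigenvalue N \<omega> n) S \<and> nondecreasing_b22 (nth_eigenvalue N \<omega> n) S"
        using nondecreasing_constant_index by blast
    qed
    show "\<forall>\<A>\<in>B13 \<omega>. \<forall>n<N. \<not> nth_continuous_at N \<omega> n \<A> \<or>
        (\<A> \<noteq> bcC \<omega> \<and> 0 < n \<and> n < N - 1 \<and> nth_eigenvalue N \<omega> n \<A> = nth_eigenvalue N \<omega> (n - 1) \<A>)"
      unfolding regions_chart bcC_chart
    proof (intro ballI allI impI disjCI)
      fix \<A> n assume "\<A> \<in> chart ` Sing"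
      then obtain Q where Q: "Q \<in> Sing" "\<A> = chart Q" by auto
      assume "\<not> (\<A> \<noteq> chart (0, 0, 0) \<and> 0 < n \<and> n < N - 1 \<and> nth_eigenvalue N \<omega> n \<A> = nth_eigenvalue N \<omega> (n - 1) \<A>)"
      then have neg: "\<not> (Q \<noteq> (0, 0, 0) \<and> 0 < n \<and> n < N - 1 \<and> lam n Q = lam (n - 1) Q)"
        by (simp add: Q lam_def chart_inj)
      show "\<not> nth_continuous_at N \<omega> n \<A>"
      proof
        assume "nth_continuous_at N \<omega> n \<A>"
        \<comment> \<open>The shift \<open>N - neig Q\<close> is 2 at C and 1 at the other points of
          the cone.\<close>
        then have *: "n < neig Q" "N - neig Q \<le> n" "lam n Q = lam (n - (N - neig Q)) Q"
          using continuous_at_Sing_imp[OF Q(1)] Q(2) by auto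
        show False
        proof (cases "Q = (0, 0, 0)")
          case True
          then have "N - neig Q = 2" using assms(1) by (simp add: index_facts)
          then show False using * True lam_origin_simple[of "n - 2" n] by simp
        next
          case False
          then show False using * neg neig_Sing[OF Q(1)] assms(1) by auto
        qed
      qed
    qed
    show "\<forall>\<A>\<^sub>0\<in>B13r \<omega>.
       (\<forall>n. n \<le> N - 2 \<longrightarrow>
          (nth_eigenvalue N \<omega> n \<longlongrightarrow> nth_eigenvalue N \<omega> n \<A>\<^sub>0) (near \<A>\<^sub>0 (B13_minus \<omega> \<union> B13r \<omega>))) \<and>
       filterlim (nth_eigenvalue N \<omega> (N - 1)) at_top (near \<A>\<^sub>0 (B13_minus \<omega>)) \<and>
       filterlim (nth_eigenvalue N \<omega> 0) at_bot (near \<A>\<^sub>0 (B13r_plus \<omega>)) \<and>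
       (\<forall>n. 1 \<le> n \<and> n \<le> N - 1 \<longrightarrow>
          (nth_eigenvalue N \<omega> n \<longlongrightarrow> nth_eigenvalue N \<omega> (n - 1) \<A>\<^sub>0) (near \<A>\<^sub>0 (B13r_plus \<omega>)))"
      \<comment> \<open>Each limit reduces to arithmetic between the indices of the approaching
        region and those of the limit point.\<close>
      unfolding regions_chart ball_simps(9) image_Un[symmetric]
      by (intro ballI conjI allI impI near_tendsto near_at_top near_at_bot)
         (use assms(1) in \<open>auto simp: index_facts\<close>)
    show "\<forall>\<A>\<^sub>0\<in>B13l \<omega>.
       filterlim (nth_eigenvalue N \<omega> 0) at_bot (near \<A>\<^sub>0 (B13_minus \<omega>)) \<and>
       (\<forall>n. 1 \<le> n \<and> n \<le> N - 1 \<longrightarrow>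
          (nth_eigenvalue N \<omega> n \<longlongrightarrow> nth_eigenvalue N \<omega> (n - 1) \<A>\<^sub>0) (near \<A>\<^sub>0 (B13_minus \<omega>))) \<and>
       (\<forall>n. n \<le> N - 2 \<longrightarrow>
          (nth_eigenvalue N \<omega> n \<longlongrightarrow> nth_eigenvalue N \<omega> n \<A>\<^sub>0) (near \<A>\<^sub>0 (B13l_plus \<omega> \<union> B13l \<omega>))) \<and>
       filterlim (nth_eigenvalue N \<omega> (N - 1)) at_top (near \<A>\<^sub>0 (B13l_plus \<omega>))"
      unfolding regions_chart ball_simps(9) image_Un[symmetric]
      by (intro ballI conjI allI impI near_tendsto near_at_top near_at_bot)
         (use assms(1) in \<open>auto simp: index_facts\<close>)
  \<comment> \<open>Unions of regions are admissible because \<open>npi\<close> is constant on them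
    or, for a divergence, because the inequality between the indices holds on every member.\<close>
  qed (unfold regions_chart bcC_chart C image_Un[symmetric],
       (intro conjI allI impI near_tendsto near_at_top near_at_bot continuous_on_constant_index;
        (use assms(1) in \<open>auto simp: index_facts\<close>))+)
qed

end
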